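(* Let the parameters be regular. Let $(\boldsymbol n,\boldsymbol m)\in\mathbb N_0^p\times\mathbb N_0^q$ with $|\boldsymbol n|=|\boldsymbol m|+1$, $\boldsymbol m$ near the diagonal and $\boldsymbol m-\mathbf 1_q\in\mathbb N_0^q$. Choose an admissible $A$-side local data set $(\boldsymbol t_k),(\boldsymbol{\mathfrak t}_k),(\boldsymbol s_k),(\boldsymbol{\mathfrak s}_k)$ (see context), with associated vectors $\mathbf V_i^+,\mathbf V^0,\mathbf V_j^-$, and assume the denominators below do not vanish. Then $$z\mathbf V^0(z)=\sum_{i=1}^pa^{+i}_{\boldsymbol n,\boldsymbol m}\mathbf V_i^+(z)+a^0_{\boldsymbol n,\boldsymbol m}\mathbf V^0(z)+\sum_{j=1}^qa^{-j}_{\boldsymbol n,\boldsymbol m}\mathbf V_j^-(z),$$ where for $1\le i\le p$, $1\le j\le q$ $$a^{+i}_{\boldsymbol n,\boldsymbol m}=\frac{\mathscr P^{(\boldsymbol n,\boldsymbol m)}_{1,(\boldsymbol n+\boldsymbol t_{i-1},\boldsymbol m+\boldsymbol{\mathfrak s}_{i+1})}}{\mathscr P^{(\boldsymbol n+\boldsymbol t_i,\boldsymbol m+\boldsymbol{\mathfrak s}_i)}_{0,(\boldsymbol n+\boldsymbol t_{i-1},\boldsymbol m+\boldsymbol{\mathfrak s}_{i+1})}},\quad a^0_{\boldsymbol n,\boldsymbol m}=\frac{\mathscr P^{(\boldsymbol n,\boldsymbol m)}_{1,(\boldsymbol n-\boldsymbol{\mathfrak t}_1,\boldsymbol m+\boldsymbol{\mathfrak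 s}_1)}}{\mathscr P^{(\boldsymbol n,\boldsymbol m)}_{0,(\boldsymbol n-\boldsymbol{\mathfrak t}_1,\boldsymbol m+\boldsymbol{\mathfrak s}_1)}},\quad a^{-j}_{\boldsymbol n,\boldsymbol m}=\frac{\mathscr P^{(\boldsymbol n,\boldsymbol m)}_{1,(\boldsymbol n-\boldsymbol{\mathfrak t}_{j+1},\boldsymbol m-\boldsymbol s_{j-1})}}{\mathscr P^{(\boldsymbol n-\boldsymbol{\mathfrak t}_j,\boldsymbol m-\boldsymbol s_j)}_{0,(\boldsymbol n-\boldsymbol{\mathfrak t}_{j+1},\boldsymbol m-\boldsymbol s_{j-1})}} .$$ The $p+q+1$ vectors $\mathbf V_1^+,\dots,\mathbf V_p^+,\mathbf V^0,\mathbf V_1^-,\dots,\mathbf V_q^-$ form a basis of the local recurrence space $\mathscr R(\boldsymbol n+\mathbf 1_p,\boldsymbol m-\mathbf 1_q)$ containing $z\mathbf V^0$.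
   Context: Notation. $\mathbf 1_d$: all-ones vector; $\boldsymbol e_j$: standard basis vector; $|\boldsymbol n|=\sum n_i$; $\boldsymbol c^{*i}$: $\boldsymbol c$ with its $i$-th component removed; vector inequalities are componentwise. $(x)_n=\Gamma(x+n)/\Gamma(x)$ for $n\in\mathbb Z$; for vectors $\Gamma(\boldsymbol v)=\prod_h\Gamma(v_h)$, $(\boldsymbol c)_{\boldsymbol m}=\prod_h(c_h)_{m_h}$, a scalar subscript is applied to each component; empty products are $1$. $\mathbb P_N$: polynomials of degree $\le N$, $\mathbb P_{-1}=\{0\}$. $\mathbb T$: positively oriented unit circle. $\mathbb Z_{\le0}=\{0,-1,\dots\}$. $\mathcal N_q(M)=\{\boldsymbol\nu\in\mathbb N_0^q:|\boldsymbol\nu|=M,\ |\nu_\alpha-\nu_\beta|\le1\ \forall\alpha,\beta\}$ ("near the diagonal"). Parameters: $p,q\ge1$, $0\le r<q$, $\boldsymbol a\in\mathbb C^r$, $\boldsymbol b\in\mathbb C^q$, $\boldsymbol\kappa\in\mathbb C^p$; regular: $b_j-b_h\notin\mathbb Z$ $(j\ne h)$, $\kappa_i-\kappa_h\notin\mathbb Z$ $(i\ne h)$. Weights: $C_{j,i}(z)=\sum_{k\ge0}\frac{\Gamma((k+\kappa_i)\mathbf 1_r+\boldsymbol a+\mathbf 1_r)}{\Gamma((k+\kappa_i)\mathbf 1_q+\boldsymbol b+\boldsymbol e_j+\mathbf 1_q)}z^{-k-1}$. For near-diagonal $\boldsymbol m$: $m_{\min}=\min_hm_h$, $j_{\min}=\min\{j:m_j=m_{\min}\}$,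 $m_{\max}=\max_hm_h$, $j_{\max}=\max\{j:m_j=m_{\max}\}$. Parameters are admissible for $\boldsymbol m$ if for all $i,j,\rho$, $\kappa_i+a_\rho+1\notin\mathbb Z_{\le0}$, $\kappa_i+b_j+1\notin\mathbb Z_{\le0}$; $a_\rho-b_j-m_j+1\notin\mathbb Z_{\le0}$ whenever $m_j\ge1$; $a_\rho-b_{j_{\min}}-m_{\min}\notin\mathbb Z_{\le0}$. Local recurrence space: $\mathscr R(\boldsymbol N,\boldsymbol M)$ is the space of column vectors $(P^{(1)},\dots,P^{(p)})^{\mathsf T}$ with $P^{(i)}\in\mathbb P_{N_i-1}$ and $\sum_i\oint_{\mathbb T}z^\ell C_{j,i}P^{(i)}\frac{\mathrm dz}{2\pi\mathrm i}=0$ for $0\le\ell\le M_j-1$, $1\le j\le q$. $A$-side local data: sequences $\boldsymbol t_k,\boldsymbol{\mathfrak t}_k\in\mathbb N_0^p$, $\boldsymbol s_k,\boldsymbol{\mathfrak s}_k\in\mathbb N_0^q$, $k\in\mathbb N_0$, all starting at $\boldsymbol 0$ and obtained by adding one standard basis vector at each step, with $\boldsymbol t_i\le\mathbf 1_p$ for $i\le p$, $\boldsymbol s_j\le\mathbf 1_q$ for $j\le q$, $\boldsymbol m+\boldsymbol{\mathfrak s}_k\in\mathcal N_q(|\boldsymbol m|+k)$ for $0\le k\le p+1$, and $\boldsymbol m-\boldsymbol s_k\in\mathcal N_q(|\boldsymbol m|-k)$ for $0\le k\le q$. Recurrence vectors: $\mathbf V_i^+=\mathbf A_{\boldsymbol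 n+\boldsymbol t_i,\boldsymbol m+\boldsymbol{\mathfrak s}_i}$ $(1\le i\le p)$, $\mathbf V^0=\mathbf A_{\boldsymbol n,\boldsymbol m}$, $\mathbf V_j^-=\mathbf A_{\boldsymbol n-\boldsymbol{\mathfrak t}_j,\boldsymbol m-\boldsymbol s_j}$ $(1\le j\le q)$. Test vectors: $\mathbf T_i^+=\mathbf B_{\boldsymbol n+\boldsymbol t_{i-1},\boldsymbol m+\boldsymbol{\mathfrak s}_{i+1}}$, $\mathbf T^0=\mathbf B_{\boldsymbol n-\boldsymbol{\mathfrak t}_1,\boldsymbol m+\boldsymbol{\mathfrak s}_1}$, $\mathbf T_j^-=\mathbf B_{\boldsymbol n-\boldsymbol{\mathfrak t}_{j+1},\boldsymbol m-\boldsymbol s_{j-1}}$. The data set is admissible if every index pair appearing in these recurrence and test vectors is componentwise nonnegative with near-diagonal row index, and the parameters are admissible for each of these row indices. Normalized vectors. For $|\boldsymbol n|=|\boldsymbol m|+1$: $A^{(i)}_{\boldsymbol n,\boldsymbol m}=0$ if $n_i=0$, else $$A^{(i)}_{\boldsymbol n,\boldsymbol m}(z)=\nu^AC_{\boldsymbol n,\boldsymbol m;i}\sum_{k=0}^{n_i-1}\frac{(1-n_i)_k(\kappa_i\mathbf 1_q+\boldsymbol b+\boldsymbol m+\mathbf 1_q)_k(\kappa_i\mathbf 1_{p-1}-\boldsymbol\kappa^{*i}-\boldsymbol n^{*i}+\mathbf 1_{p-1})_k}{(\kappa_i\mathbf 1_r+\boldsymbol a+\mathbf 1_r)_k(\kappa_i\mathbf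 1_{p-1}-\boldsymbol\kappa^{*i}+\mathbf 1_{p-1})_k}\frac{z^k}{k!},$$ $$C_{\boldsymbol n,\boldsymbol m;i}=(-1)^{|\boldsymbol n|}\frac{\Gamma(\kappa_i\mathbf 1_q+\boldsymbol b+\mathbf 1_q)}{\Gamma(\kappa_i\mathbf 1_r+\boldsymbol a+\mathbf 1_r)}\frac{\prod_j(\kappa_i+b_j+1)_{m_j}}{(-1)^{n_i-1}(n_i-1)!\prod_{\ell\ne i}(\kappa_i-\kappa_\ell-n_\ell+1)_{n_\ell}},$$ $$\nu^A=-\frac{\prod_i(\kappa_i+b_{j_{\min}}+m_{\min}+1)_{n_i}}{(\boldsymbol a-b_{j_{\min}}\mathbf 1_r-m_{\min}\mathbf 1_r)_{m_{\min}}\prod_{h:m_h=m_{\min}+1}(b_h-b_{j_{\min}})}.$$ For $|\boldsymbol m|=|\boldsymbol n|+1$: $B^{(j)}_{\boldsymbol n,\boldsymbol m}=0$ if $m_j=0$, else $$B^{(j)}_{\boldsymbol n,\boldsymbol m}(z)=\nu^B\Bigg[\pi_{j,0}+\frac{(\boldsymbol a-b_j\mathbf 1_r)_1}{(\boldsymbol b^{*j}-b_j\mathbf 1_{q-1})_1}\sum_{H=1}^q\sum_{K=1}^{m_H-1}\pi_{H,K}\frac{(\boldsymbol b^{*j}-(b_H+K)\mathbf 1_{q-1})_1}{(\boldsymbol a-(b_H+K)\mathbf 1_r)_1}\sum_{d=0}^{K-1+\delta_{j,H}}\frac{(\boldsymbol b-(b_H+K)\mathbf 1_q+\mathbf 1_q-\boldsymbol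 e_j)_d}{(\boldsymbol a-(b_H+K)\mathbf 1_r+\mathbf 1_r)_d}z^d\Bigg],$$ $$\pi_{H,K}=-\frac{\prod_i(\kappa_i+b_H+K+1)_{n_i}}{(-1)^KK!(m_H-K-1)!\prod_{I\ne H}(b_I-b_H-K)_{m_I}},$$ $$\nu^B=-\frac{(\boldsymbol a-b_{j_{\max}}\mathbf 1_r-(m_{\max}-1)\mathbf 1_r)_{m_{\max}}\prod_{h\ne j_{\max},m_h=m_{\max}}(b_h-b_{j_{\max}})}{(\boldsymbol a-b_{j_{\max}}\mathbf 1_r)_1\prod_i(\kappa_i+b_{j_{\max}}+m_{\max})_{n_i}}.$$ Pairing block, for $|\boldsymbol\mu|=|\boldsymbol\nu|+1$, $|\boldsymbol\lambda|=|\boldsymbol\eta|+1$, $\boldsymbol\mu,\boldsymbol\eta$ near the diagonal, $d\in\{0,1\}$ (it equals $\sum_{j,i}\oint_{\mathbb T}z^dB^{(j)}_{\boldsymbol\nu,\boldsymbol\mu}C_{j,i}A^{(i)}_{\boldsymbol\lambda,\boldsymbol\eta}\frac{\mathrm dz}{2\pi\mathrm i}$). Put $\eta_-=\min_h\eta_h$, $j_-=\min\{h:\eta_h=\eta_-\}$, $\mu_+=\max_h\mu_h$, $j_+=\max\{h:\mu_h=\mu_+\}$, $K_+=\mu_+-1$, $$\mathcal N=\frac{(\boldsymbol\kappa+(b_{j_-}+\eta_-+1)\mathbf 1_p)_{\boldsymbol\lambda}\,(\boldsymbol a-(b_{j_+}+K_+)\mathbf 1_r)_{K_+}}{(\boldsymbol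 a-(b_{j_-}+\eta_-)\mathbf 1_r)_{\eta_-}\prod_{h:\eta_h=\eta_-+1}(b_h-b_{j_-})}\prod_{h\ne j_+,\,\mu_h=\mu_+}(b_h-b_{j_+}).$$ For $0\le\alpha\le\lambda_i-1$: if $H=j$, $0\le K\le\mu_H-1$, $0\le\beta\le K$, $$\begin{aligned}\mathcal S_{d;i,H,H,K}(\alpha,\beta)=&\frac{(-1)^{|\boldsymbol\lambda|-\lambda_i+\alpha+\beta-K}}{\alpha!(\lambda_i-1-\alpha)!(K-\beta)!(\mu_H-K-1)!}\\&\times\frac{(\kappa_i\mathbf 1_r+\boldsymbol a+(\alpha+1)\mathbf 1_r)_{d+\beta}\,(\boldsymbol a-(b_H+K)\mathbf 1_r+(\beta+1)\mathbf 1_r)_{K-\beta}}{(\kappa_i\mathbf 1_{p-1}-\boldsymbol\kappa^{*i}-\boldsymbol\lambda^{*i}+(\alpha+1)\mathbf 1_{p-1})_{\boldsymbol\lambda^{*i}}\,(\boldsymbol a-(b_H+K)\mathbf 1_r)_K}\cdot\frac{(\boldsymbol\kappa+(b_H+K+1)\mathbf 1_p)_{\boldsymbol\nu}}{(\boldsymbol\kappa+(b_{j_+}+K_++1)\mathbf 1_p)_{\boldsymbol\nu}}\\&\times\frac{(\kappa_i\mathbf 1_q+\boldsymbol b+(d+\alpha+\beta+1)\mathbf 1_q+\boldsymbol e_H)_{\boldsymbol\eta-(d+\beta)\mathbf 1_q-\boldsymbol e_H}}{(\boldsymbol b^{*H}-b_H\mathbf 1_{q-1})_1\,(\boldsymbol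 b^{*H}-(b_H+K)\mathbf 1_{q-1}+(\beta+1)\mathbf 1_{q-1})_{\boldsymbol\mu^{*H}-(\beta+1)\mathbf 1_{q-1}}};\end{aligned}$$ if $H\ne j$, $1\le K\le\mu_H-1$, $0\le\beta\le K-1$, $$\begin{aligned}\mathcal S_{d;i,j,H,K}(\alpha,\beta)=&\frac{(-1)^{|\boldsymbol\lambda|-\lambda_i+1+\alpha+K+\beta}}{\alpha!(\lambda_i-1-\alpha)!(K-1-\beta)!(\mu_H-K-1)!}\\&\times\frac{(\boldsymbol a-b_j\mathbf 1_r)_1\,(\kappa_i\mathbf 1_r+\boldsymbol a+(\alpha+1)\mathbf 1_r)_{d+\beta}}{(\kappa_i\mathbf 1_{p-1}-\boldsymbol\kappa^{*i}-\boldsymbol\lambda^{*i}+(\alpha+1)\mathbf 1_{p-1})_{\boldsymbol\lambda^{*i}}\,(\boldsymbol a-(b_H+K)\mathbf 1_r)_{\beta+1}}\cdot\frac{(\boldsymbol\kappa+(b_H+K+1)\mathbf 1_p)_{\boldsymbol\nu}}{(\boldsymbol\kappa+(b_{j_+}+K_++1)\mathbf 1_p)_{\boldsymbol\nu}}\\&\times\frac{(\kappa_i\mathbf 1_q+\boldsymbol b+(d+\alpha+\beta+1)\mathbf 1_q+\boldsymbol e_j)_{\boldsymbol\eta-(d+\beta)\mathbf 1_q-\boldsymbol e_j}}{(\boldsymbol b^{*j}-b_j\mathbf 1_{q-1})_1\,(\boldsymbol b^{*H}-(b_H+K)\mathbf 1_{q-1}+(\beta+1)\mathbf 1_{q-1}-\boldsymbol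 e_j^{*H})_{\boldsymbol\mu^{*H}-(\beta+1)\mathbf 1_{q-1}+\boldsymbol e_j^{*H}}};\end{aligned}$$ and $\mathcal S=0$ otherwise. Then $\mathscr P^{(\boldsymbol\lambda,\boldsymbol\eta)}_{d,(\boldsymbol\nu,\boldsymbol\mu)}=\mathcal N\sum_{j=1}^q\sum_{i=1}^p\sum_{\beta=0}^{\mu_j-1}\sum_{\alpha=0}^{\lambda_i-1}\sum_{H=1}^q\sum_{K=0}^{\mu_H-1}\mathcal S_{d;i,j,H,K}(\alpha,\beta)$. *)

theory Defs
  imports "HOL-Complex_Analysis.Complex_Analysis" "HOL-Library.Function_Algebras"
begin

(* A vector of length d is a function on nat, read only at the indices 1..d; its other values
   are irrelevant. Multi-indices are nat-valued; subtraction of functions on nat is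
   pointwise and truncated, so where a difference of multi-indices occurs, its nonnegativity is
   required separately. *)

subsection \<open>Multi-indices\<close>

definition vsum :: "nat \<Rightarrow> (nat \<Rightarrow> nat) \<Rightarrow> nat" where
  "vsum d v = (\<Sum>i=1..d. v i)"

definition unit_vec :: "nat \<Rightarrow> nat \<Rightarrow> nat" where
  "unit_vec j = (\<lambda>h. if h = j then 1 else 0)"

definition near_diag :: "nat \<Rightarrow> nat \<Rightarrow> (nat \<Rightarrow> nat) set" where
  "near_diag q M = {v. vsum q v = M \<and>
     (\<forall>\<alpha>\<in>{1..q}. \<forall>\<beta>\<in>{1..q}. \<bar>int (v \<alpha>) - int (v \<beta>)\<bar> \<le> 1)}"

definition vmin :: "nat \<Rightarrow> (nat \<Rightarrow> nat) \<Rightarrow> nat" where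
  "vmin q v = Min (v ` {1..q})"

definition jmin :: "nat \<Rightarrow> (nat \<Rightarrow> nat) \<Rightarrow> nat" where
  "jmin q v = Min {j\<in>{1..q}. v j = vmin q v}"

definition vmax :: "nat \<Rightarrow> (nat \<Rightarrow> nat) \<Rightarrow> nat" where
  "vmax q v = Max (v ` {1..q})"

definition jmax :: "nat \<Rightarrow> (nat \<Rightarrow> nat) \<Rightarrow> nat" where
  "jmax q v = Max {j\<in>{1..q}. v j = vmax q v}"

subsection \<open>Pochhammer symbols with integer index\<close>

(* The usual extension of Gamma (x + n) / Gamma x to all x: a finite product for n \<ge> 0,
   the reciprocal of a finite product for n < 0. *)
definition ipoch :: "complex \<Rightarrow> int \<Rightarrow> complex" where
  "ipoch x n = (if n \<ge> 0 then pochhammer x (nat n)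
                else 1 / pochhammer (x + of_int n) (nat (- n)))"

lemma ipoch_of_nat: "ipoch x (int n) = pochhammer x n"
  by (simp add: ipoch_def)

lemma ipoch_Gamma:
  assumes "x \<notin> \<int>\<^sub>\<le>\<^sub>0" "x + of_int n \<notin> \<int>\<^sub>\<le>\<^sub>0"
  shows "ipoch x n = Gamma (x + of_int n) / Gamma x"
proof (cases "n \<ge> 0")
  case True
  then show ?thesis
    using pochhammer_Gamma[OF assms(1), of "nat n"] by (simp add: ipoch_def)
next
  case False
  then show ?thesis
    using pochhammer_Gamma[OF assms(2), of "nat (- n)"] by (simp add: ipoch_def)
qed

subsection \<open>Parameters and weights\<close>

definition regular :: "nat \<Rightarrow> nat \<Rightarrow> (nat \<Rightarrow> complex) \<Rightarrow> (nat \<Rightarrow> complex) \<Rightarrow> bool" where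
  "regular p q b \<kappa> \<longleftrightarrow>
     (\<forall>j\<in>{1..q}. \<forall>h\<in>{1..q}. j \<noteq> h \<longrightarrow> b j - b h \<notin> \<int>) \<and>
     (\<forall>i\<in>{1..p}. \<forall>h\<in>{1..p}. i \<noteq> h \<longrightarrow> \<kappa> i - \<kappa> h \<notin> \<int>)"

definition params_admissible ::
  "nat \<Rightarrow> nat \<Rightarrow> nat \<Rightarrow> (nat \<Rightarrow> complex) \<Rightarrow> (nat \<Rightarrow> complex) \<Rightarrow> (nat \<Rightarrow> complex) \<Rightarrow> (nat \<Rightarrow> nat) \<Rightarrow> bool"
where
  "params_admissible p q r a b \<kappa> m \<longleftrightarrow>
     (\<forall>i\<in>{1..p}. \<forall>\<rho>\<in>{1..r}. \<kappa> i + a \<rho> + 1 \<notin> \<int>\<^sub>\<le>\<^sub>0) \<and>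
     (\<forall>i\<in>{1..p}. \<forall>j\<in>{1..q}. \<kappa> i + b j + 1 \<notin> \<int>\<^sub>\<le>\<^sub>0) \<and>
     (\<forall>\<rho>\<in>{1..r}. \<forall>j\<in>{1..q}. m j \<ge> 1 \<longrightarrow> a \<rho> - b j - of_nat (m j) + 1 \<notin> \<int>\<^sub>\<le>\<^sub>0) \<and>
     (\<forall>\<rho>\<in>{1..r}. a \<rho> - b (jmin q m) - of_nat (vmin q m) \<notin> \<int>\<^sub>\<le>\<^sub>0)"

(* As r < q, the series converges for all z \<noteq> 0. *)
definition weight ::
  "nat \<Rightarrow> nat \<Rightarrow> (nat \<Rightarrow> complex) \<Rightarrow> (nat \<Rightarrow> complex) \<Rightarrow> (nat \<Rightarrow> complex) \<Rightarrow> nat \<Rightarrow> nat \<Rightarrow> complex \<Rightarrow> complex"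
where
  "weight q r a b \<kappa> j i z =
     (\<Sum>k. (\<Prod>\<rho>=1..r. Gamma (of_nat k + \<kappa> i + a \<rho> + 1)) /
           (\<Prod>h=1..q. Gamma (of_nat k + \<kappa> i + b h + of_nat (unit_vec j h) + 1)) *
           z powi (- int k - 1))"

subsection \<open>Polynomial vectors and the local recurrence space\<close>

(* Polynomial vectors have zero entries outside 1..p. *)
type_synonym pvec = "nat \<Rightarrow> complex poly"

definition pscale :: "complex \<Rightarrow> pvec \<Rightarrow> pvec" where
  "pscale c P = (\<lambda>i. smult c (P i))"

interpretation pvec: vector_space pscale
  by unfold_locales (auto simp: pscale_def fun_eq_iff smult_add_right smult_add_left)

definition mult_z :: "pvec \<Rightarrow> pvec" where
  "mult_z P = (\<lambda>i. monom 1 1 * P i)"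

(* The degree condition expresses membership in the polynomials of degree at most N i - 1,
   which is the zero space for N i = 0. *)
definition rec_space ::
  "nat \<Rightarrow> nat \<Rightarrow> nat \<Rightarrow> (nat \<Rightarrow> complex) \<Rightarrow> (nat \<Rightarrow> complex) \<Rightarrow> (nat \<Rightarrow> complex) \<Rightarrow>
   (nat \<Rightarrow> nat) \<Rightarrow> (nat \<Rightarrow> nat) \<Rightarrow> pvec set"
where
  "rec_space p q r a b \<kappa> N M = {P.
     (\<forall>i. i \<notin> {1..p} \<longrightarrow> P i = 0) \<and>
     (\<forall>i\<in>{1..p}. P i = 0 \<or> degree (P i) < N i) \<and>
     (\<forall>j\<in>{1..q}. \<forall>l<M j.
        (\<Sum>i=1..p. contour_integral (circlepath 0 1)
           (\<lambda>z. z ^ l * weight q r a b \<kappa> j i z * poly (P i) z) / (2 * of_real pi * \<i>)) = 0)}"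

(* The list enumerates a basis of the subspace S. *)
definition basis_of :: "pvec list \<Rightarrow> pvec set \<Rightarrow> bool" where
  "basis_of vs S \<longleftrightarrow> distinct vs \<and> pvec.independent (set vs) \<and> pvec.span (set vs) = S"

subsection \<open>The normalized vectors A\<close>

definition A_const ::
  "nat \<Rightarrow> nat \<Rightarrow> nat \<Rightarrow> (nat \<Rightarrow> complex) \<Rightarrow> (nat \<Rightarrow> complex) \<Rightarrow> (nat \<Rightarrow> complex) \<Rightarrow>
   (nat \<Rightarrow> nat) \<Rightarrow> (nat \<Rightarrow> nat) \<Rightarrow> nat \<Rightarrow> complex"
where
  "A_const p q r a b \<kappa> n m i =
     (-1) ^ vsum p n *
     ((\<Prod>h=1..q. Gamma (\<kappa> i + b h + 1)) / (\<Prod>\<rho>=1..r. Gamma (\<kappa> i + a \<rho> + 1))) *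
     ((\<Prod>j=1..q. pochhammer (\<kappa> i + b j + 1) (m j)) /
      ((-1) ^ (n i - 1) * fact (n i - 1) *
       (\<Prod>l\<in>{1..p} - {i}. pochhammer (\<kappa> i - \<kappa> l - of_nat (n l) + 1) (n l))))"

definition A_norm ::
  "nat \<Rightarrow> nat \<Rightarrow> nat \<Rightarrow> (nat \<Rightarrow> complex) \<Rightarrow> (nat \<Rightarrow> complex) \<Rightarrow> (nat \<Rightarrow> complex) \<Rightarrow>
   (nat \<Rightarrow> nat) \<Rightarrow> (nat \<Rightarrow> nat) \<Rightarrow> complex"
where
  "A_norm p q r a b \<kappa> n m =
     - ((\<Prod>i=1..p. pochhammer (\<kappa> i + b (jmin q m) + of_nat (vmin q m) + 1) (n i)) /
        ((\<Prod>\<rho>=1..r. pochhammer (a \<rho> - b (jmin q m) - of_nat (vmin q m)) (vmin q m)) *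
         (\<Prod>h\<in>{h\<in>{1..q}. m h = vmin q m + 1}. b h - b (jmin q m))))"

definition A_vec ::
  "nat \<Rightarrow> nat \<Rightarrow> nat \<Rightarrow> (nat \<Rightarrow> complex) \<Rightarrow> (nat \<Rightarrow> complex) \<Rightarrow> (nat \<Rightarrow> complex) \<Rightarrow>
   (nat \<Rightarrow> nat) \<Rightarrow> (nat \<Rightarrow> nat) \<Rightarrow> pvec"
where
  "A_vec p q r a b \<kappa> n m = (\<lambda>i.
     if i \<notin> {1..p} \<or> n i = 0 then 0
     else smult (A_norm p q r a b \<kappa> n m * A_const p q r a b \<kappa> n m i)
       (\<Sum>k=0..n i - 1. monom
          (pochhammer (1 - of_nat (n i)) k *
           (\<Prod>h=1..q. pochhammer (\<kappa> i + b h + of_nat (m h) + 1) k) *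
           (\<Prod>l\<in>{1..p} - {i}. pochhammer (\<kappa> i - \<kappa> l - of_nat (n l) + 1) k) /
           ((\<Prod>\<rho>=1..r. pochhammer (\<kappa> i + a \<rho> + 1) k) *
            (\<Prod>l\<in>{1..p} - {i}. pochhammer (\<kappa> i - \<kappa> l + 1) k)) /
           fact k) k))"

subsection \<open>The pairing block\<close>

definition block_norm ::
  "nat \<Rightarrow> nat \<Rightarrow> nat \<Rightarrow> (nat \<Rightarrow> complex) \<Rightarrow> (nat \<Rightarrow> complex) \<Rightarrow> (nat \<Rightarrow> complex) \<Rightarrow>
   (nat \<Rightarrow> nat) \<Rightarrow> (nat \<Rightarrow> nat) \<Rightarrow> (nat \<Rightarrow> nat) \<Rightarrow> complex"
where
  "block_norm p q r a b \<kappa> lam eta mu =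
     (let em = vmin q eta; jm = jmin q eta; jp = jmax q mu; Kp = vmax q mu - 1 in
      (\<Prod>i=1..p. pochhammer (\<kappa> i + b jm + of_nat em + 1) (lam i)) *
      (\<Prod>\<rho>=1..r. pochhammer (a \<rho> - (b jp + of_nat Kp)) Kp) /
      ((\<Prod>\<rho>=1..r. pochhammer (a \<rho> - (b jm + of_nat em)) em) *
       (\<Prod>h\<in>{h\<in>{1..q}. eta h = em + 1}. b h - b jm)) *
      (\<Prod>h\<in>{h\<in>{1..q}. h \<noteq> jp \<and> mu h = vmax q mu}. b h - b jp))"

definition block_term ::
  "nat \<Rightarrow> nat \<Rightarrow> nat \<Rightarrow> (nat \<Rightarrow> complex) \<Rightarrow> (nat \<Rightarrow> complex) \<Rightarrow> (nat \<Rightarrow> complex) \<Rightarrow>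
   (nat \<Rightarrow> nat) \<Rightarrow> (nat \<Rightarrow> nat) \<Rightarrow> nat \<Rightarrow> (nat \<Rightarrow> nat) \<Rightarrow> (nat \<Rightarrow> nat) \<Rightarrow>
   nat \<Rightarrow> nat \<Rightarrow> nat \<Rightarrow> nat \<Rightarrow> nat \<Rightarrow> nat \<Rightarrow> complex"
where
  "block_term p q r a b \<kappa> lam eta d nu mu i j H K \<alpha> \<beta> =
     (let jp = jmax q mu; Kp = vmax q mu - 1;
          e = unit_vec j;
          kap = (\<Prod>l\<in>{1..p} - {i}. pochhammer (\<kappa> i - \<kappa> l - of_nat (lam l) + of_nat \<alpha> + 1) (lam l));
          quot = (\<Prod>l=1..p. pochhammer (\<kappa> l + b H + of_nat K + 1) (nu l)) /
                 (\<Prod>l=1..p. pochhammer (\<kappa> l + b jp + of_nat Kp + 1) (nu l))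
      in
      if \<alpha> < lam i \<and> H = j \<and> K < mu H \<and> \<beta> \<le> K then
        ((-1) powi (int (vsum p lam) - int (lam i) + int \<alpha> + int \<beta> - int K) /
          (fact \<alpha> * fact (lam i - 1 - \<alpha>) * fact (K - \<beta>) * fact (mu H - K - 1))) *
        ((\<Prod>\<rho>=1..r. pochhammer (\<kappa> i + a \<rho> + of_nat \<alpha> + 1) (d + \<beta>)) *
         (\<Prod>\<rho>=1..r. pochhammer (a \<rho> - (b H + of_nat K) + of_nat \<beta> + 1) (K - \<beta>)) /
         (kap * (\<Prod>\<rho>=1..r. pochhammer (a \<rho> - (b H + of_nat K)) K))) *
        quot *
        ((\<Prod>h=1..q. ipoch (\<kappa> i + b h + of_nat (d + \<alpha> + \<beta> + 1) + of_nat (e h))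
                          (int (eta h) - int (d + \<beta>) - int (e h))) /
         ((\<Prod>h\<in>{1..q} - {H}. b h - b H) *
          (\<Prod>h\<in>{1..q} - {H}. ipoch (b h - (b H + of_nat K) + of_nat (\<beta> + 1))
                                   (int (mu h) - int (\<beta> + 1)))))
      else if \<alpha> < lam i \<and> H \<noteq> j \<and> 1 \<le> K \<and> K < mu H \<and> \<beta> \<le> K - 1 then
        ((-1) powi (int (vsum p lam) - int (lam i) + 1 + int \<alpha> + int K + int \<beta>) /
          (fact \<alpha> * fact (lam i - 1 - \<alpha>) * fact (K - 1 - \<beta>) * fact (mu H - K - 1))) *
        ((\<Prod>\<rho>=1..r. a \<rho> - b j) *
         (\<Prod>\<rho>=1..r. pochhammer (\<kappa> i + a \<rho> + of_nat \<alpha> + 1) (d + \<beta>)) /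
         (kap * (\<Prod>\<rho>=1..r. pochhammer (a \<rho> - (b H + of_nat K)) (\<beta> + 1)))) *
        quot *
        ((\<Prod>h=1..q. ipoch (\<kappa> i + b h + of_nat (d + \<alpha> + \<beta> + 1) + of_nat (e h))
                          (int (eta h) - int (d + \<beta>) - int (e h))) /
         ((\<Prod>h\<in>{1..q} - {j}. b h - b j) *
          (\<Prod>h\<in>{1..q} - {H}. ipoch (b h - (b H + of_nat K) + of_nat (\<beta> + 1) - of_nat (e h))
                                   (int (mu h) - int (\<beta> + 1) + int (e h)))))
      else 0)"

(* The block with upper index pair (lam, eta) and lower indices d, (nu, mu). *)
definition pairing_block ::
  "nat \<Rightarrow> nat \<Rightarrow> nat \<Rightarrow> (nat \<Rightarrow> complex) \<Rightarrow> (nat \<Rightarrow> complex) \<Rightarrow> (nat \<Rightarrow> complex) \<Rightarrow>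
   (nat \<Rightarrow> nat) \<Rightarrow> (nat \<Rightarrow> nat) \<Rightarrow> nat \<Rightarrow> (nat \<Rightarrow> nat) \<Rightarrow> (nat \<Rightarrow> nat) \<Rightarrow> complex"
where
  "pairing_block p q r a b \<kappa> lam eta d nu mu =
     block_norm p q r a b \<kappa> lam eta mu *
     (\<Sum>j=1..q. \<Sum>i=1..p. \<Sum>\<beta><mu j. \<Sum>\<alpha><lam i. \<Sum>H=1..q. \<Sum>K<mu H.
        block_term p q r a b \<kappa> lam eta d nu mu i j H K \<alpha> \<beta>)"

subsection \<open>Local data\<close>

definition basis_steps :: "nat \<Rightarrow> (nat \<Rightarrow> nat \<Rightarrow> nat) \<Rightarrow> bool" where
  "basis_steps d x \<longleftrightarrow> x 0 = 0 \<and> (\<forall>k. \<exists>j\<in>{1..d}. x (Suc k) = x k + unit_vec j)"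

(* t and s are the sequences set in bold italic, tf and sf those set in bold fraktur. *)
definition A_local_data ::
  "nat \<Rightarrow> nat \<Rightarrow> (nat \<Rightarrow> nat) \<Rightarrow> (nat \<Rightarrow> nat \<Rightarrow> nat) \<Rightarrow> (nat \<Rightarrow> nat \<Rightarrow> nat) \<Rightarrow>
   (nat \<Rightarrow> nat \<Rightarrow> nat) \<Rightarrow> (nat \<Rightarrow> nat \<Rightarrow> nat) \<Rightarrow> bool"
where
  "A_local_data p q m t tf s sf \<longleftrightarrow>
     basis_steps p t \<and> basis_steps p tf \<and> basis_steps q s \<and> basis_steps q sf \<and>
     (\<forall>k\<le>p. \<forall>i\<in>{1..p}. t k i \<le> 1) \<and>
     (\<forall>k\<le>q. \<forall>j\<in>{1..q}. s k j \<le> 1) \<and>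
     (\<forall>k\<le>p + 1. m + sf k \<in> near_diag q (vsum q m + k)) \<and>
     (\<forall>k\<le>q. m - s k \<in> near_diag q (vsum q m - k))"

(* The index pairs of the recurrence vectors and of the test vectors, in this order in each of
   the three families. *)
definition local_index_pairs ::
  "nat \<Rightarrow> nat \<Rightarrow> (nat \<Rightarrow> nat) \<Rightarrow> (nat \<Rightarrow> nat) \<Rightarrow> (nat \<Rightarrow> nat \<Rightarrow> nat) \<Rightarrow> (nat \<Rightarrow> nat \<Rightarrow> nat) \<Rightarrow>
   (nat \<Rightarrow> nat \<Rightarrow> nat) \<Rightarrow> (nat \<Rightarrow> nat \<Rightarrow> nat) \<Rightarrow> ((nat \<Rightarrow> nat) \<times> (nat \<Rightarrow> nat)) set"
where
  "local_index_pairs p q n m t tf s sf =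
     (\<Union>i\<in>{1..p}. {(n + t i, m + sf i), (n + t (i - 1), m + sf (i + 1))}) \<union>
     {(n, m), (n - tf 1, m + sf 1)} \<union>
     (\<Union>j\<in>{1..q}. {(n - tf j, m - s j), (n - tf (j + 1), m - s (j - 1))})"

(* The conditions on tf and s say that no subtraction in the index pairs is truncated, i.e. that
   all these pairs are componentwise nonnegative. *)
definition admissible_data ::
  "nat \<Rightarrow> nat \<Rightarrow> nat \<Rightarrow> (nat \<Rightarrow> complex) \<Rightarrow> (nat \<Rightarrow> complex) \<Rightarrow> (nat \<Rightarrow> complex) \<Rightarrow>
   (nat \<Rightarrow> nat) \<Rightarrow> (nat \<Rightarrow> nat) \<Rightarrow> (nat \<Rightarrow> nat \<Rightarrow> nat) \<Rightarrow> (nat \<Rightarrow> nat \<Rightarrow> nat) \<Rightarrow>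
   (nat \<Rightarrow> nat \<Rightarrow> nat) \<Rightarrow> (nat \<Rightarrow> nat \<Rightarrow> nat) \<Rightarrow> bool"
where
  "admissible_data p q r a b \<kappa> n m t tf s sf \<longleftrightarrow>
     A_local_data p q m t tf s sf \<and>
     (\<forall>k\<in>{1..q + 1}. \<forall>i\<in>{1..p}. tf k i \<le> n i) \<and>
     (\<forall>k\<le>q. \<forall>j\<in>{1..q}. s k j \<le> m j) \<and>
     (\<forall>(\<nu>, \<mu>) \<in> local_index_pairs p q n m t tf s sf.
        \<mu> \<in> near_diag q (vsum q \<mu>) \<and> params_admissible p q r a b \<kappa> \<mu>)"

end

theory Submission
  imports Defs
begin

text \<open>Put \<open>x = \<kappa> i + k\<close>. The moments of the weights are a factor depending on \<open>x\<close> times rational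
  functions \<open>wfrac j l x\<close>, so that orthogonality conditions become conditions on sums over the nodes
  \<open>x\<close>. For row indices near the diagonal, a telescoping sum shows that the functions \<open>wfrac j l\<close>
  span all \<open>g / D\<close>, where \<open>D\<close> is their common denominator and \<open>deg g < deg D\<close>. Choosing \<open>g\<close> as
  the product over all nodes but one shows that square systems of conditions are regular; choosing
  \<open>g\<close> as the product over all nodes gives the test vectors, and their coefficients are the ones
  that appear in the pairing block. The pairing matrix of the recurrence vectors and the test vectors
  is diagonal, and the degrees of the recurrence vectors grow by one coefficient at a time. Hence a
  vector of the local recurrence space on which all test functionals vanish has its degrees lowered
  step by step until it lies in the null space of a regular square system.\<close>

subsection \<open>Partial fractions and Lagrange interpolation\<close>

text \<open>The vectors \<open>B\<close> are never formed. What matters is the linear functional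
  that each induces on polynomial vectors, and it has two faces: a combination of moments of orders
  below the row index, and a weighted sum of values of its numerator at the nodes. Orthogonality
  kills the first form, roots of the numerator kill the second, and these are the two triangles of
  the pairing matrix. Near-diagonality makes the ranges fit: the denominator of
  \<open>wfrac j l\<close> with \<open>l < M j\<close> divides \<open>bden M\<close>, and the
  expansion of \<open>1 / (x + b H + K + 1)\<close> with \<open>K < M H\<close> stays within these
  functions. No dimension is computed; independence comes from the diagonal pairing and spanning
  from the descent in degree. Nonvanishing of the blocks serves both, since a block is the new
  coefficient of a recurrence vector times the weight that the test functional gives to it.\<close>

lemma lagrange_interpolation:
  fixes z :: "'i \<Rightarrow> 'a::field"
  assumes "finite I" "inj_on z I" "degree g < card I"
  shows "g = (\<Sum>s\<in>I. smult (poly g (z s) / (\<Prod>s'\<in>I-{s}. z s - z s')) (\<Prod>s'\<in>I-{s}. [:- z s', 1:]))"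
    (is "g = (\<Sum>s\<in>I. ?T s)")
proof (rule poly_eqI_degree[where A = "z ` I"])
  have card: "card (z ` I) = card I"
    using assms(2) by (rule card_image)
  then show "degree g < card (z ` I)"
    using assms(3) by simp
  have "degree (?T s) < card I" if "s \<in> I" for s
  proof -
    have "degree (?T s) \<le> degree (\<Prod>s'\<in>I-{s}. [:- z s', 1:])"
      by (rule degree_smult_le)
    also have "\<dots> \<le> (\<Sum>s'\<in>I-{s}. degree [:- z s', 1:])"
      using assms(1) by (intro degree_prod_sum_le[unfolded comp_def]) auto
    also have "\<dots> = card I - 1"
      using that assms(1) by simp
    also have "\<dots> < card I"
      using assms(3) by simp
    finally show ?thesis .
  qed
  then show "degree (\<Sum>s\<in>I. ?T s) < card (z ` I)"
    unfolding card using assms(3) by (intro degree_sum_less) auto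
next
  fix x assume "x \<in> z ` I"
  then obtain t where t: "t \<in> I" "x = z t" by auto
  have "poly (?T s) x = (if s = t then poly g x else 0)" if "s \<in> I" for s
  proof (cases "s = t")
    case True
    have "(\<Prod>s'\<in>I-{t}. z t - z s') \<noteq> 0"
      using assms(1,2) t by (auto simp: prod_zero_iff inj_on_def)
    then show ?thesis
      using True t by (simp add: poly_prod)
  next
    case False
    have "(\<Prod>s'\<in>I-{s}. x - z s') = 0"
      using False t assms(1) by (auto simp: prod_zero_iff)
    then show ?thesis
      using False by (simp add: poly_prod)
  qed
  then have "poly (\<Sum>s\<in>I. ?T s) x = (\<Sum>s\<in>I. if s = t then poly g x else 0)"
    unfolding poly_sum by (intro sum.cong) auto
  also have "\<dots> = poly g x"
    using t assms(1) by simp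
  finally show "poly g x = poly (\<Sum>s\<in>I. ?T s) x" ..
qed

lemma partial_fractions:
  fixes z :: "'i \<Rightarrow> 'a::field"
  assumes "finite I" "inj_on z I" "degree g < card I" "x \<notin> z ` I"
  shows "(\<Sum>s\<in>I. poly g (z s) / ((\<Prod>s'\<in>I-{s}. z s - z s') * (x - z s)))
         = poly g x / (\<Prod>s\<in>I. x - z s)"
proof -
  have nz: "(\<Prod>s\<in>I. x - z s) \<noteq> 0"
    using assms(1,4) by (auto simp: prod_zero_iff)
  have "poly g x = (\<Sum>s\<in>I. poly g (z s) / (\<Prod>s'\<in>I-{s}. z s - z s') * (\<Prod>s'\<in>I-{s}. x - z s'))"
    using arg_cong[OF lagrange_interpolation[OF assms(1-3)], of "\<lambda>p. poly p x"]
    by (simp add: poly_sum poly_prod)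
  also have "\<dots> = (\<Sum>s\<in>I. poly g (z s) / ((\<Prod>s'\<in>I-{s}. z s - z s') * (x - z s))
                    * (\<Prod>s\<in>I. x - z s))"
  proof (rule sum.cong[OF refl])
    fix s assume s: "s \<in> I"
    then have "x - z s \<noteq> 0" using assms(4) by auto
    then show "poly g (z s) / (\<Prod>s'\<in>I-{s}. z s - z s') * (\<Prod>s'\<in>I-{s}. x - z s')
       = poly g (z s) / ((\<Prod>s'\<in>I-{s}. z s - z s') * (x - z s)) * (\<Prod>s\<in>I. x - z s)"
      unfolding prod.remove[OF assms(1) s, of "\<lambda>s. x - z s"] by simp
  qed
  finally show ?thesis
    using nz by (simp only: sum_distrib_right[symmetric] nonzero_eq_divide_eq not_False_eq_True)
qed

text \<open>Split off one node \<open>t\<close>: the remaining terms form minus the partial fraction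
  expansion over the other nodes, evaluated at \<open>z t\<close>, and this is minus the term of
  \<open>t\<close>. The vanishing is the source of the orthogonality of the vectors
  \<open>A\<close>.\<close>

lemma sum_div_vandermonde_eq_0:
  fixes z :: "'i \<Rightarrow> 'a::field"
  assumes "finite I" "inj_on z I" "degree g + 1 < card I"
  shows "(\<Sum>s\<in>I. poly g (z s) / (\<Prod>s'\<in>I-{s}. z s - z s')) = 0"
proof -
  obtain t where t: "t \<in> I" using assms(3) by fastforce
  define J where "J = I - {t}"
  have J: "finite J" "inj_on z J" "degree g < card J" "z t \<notin> z ` J"
    using assms t by (auto simp: J_def inj_on_def)
  have "(\<Sum>s\<in>J. poly g (z s) / (\<Prod>s'\<in>I-{s}. z s - z s'))
        = (\<Sum>s\<in>J. - (poly g (z s) / ((\<Prod>s'\<in>J-{s}. z s - z s') * (z t - z s))))"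
  proof (rule sum.cong[OF refl])
    fix s assume s: "s \<in> J"
    have "I - {s} = insert t (J - {s})" "t \<notin> J - {s}"
      using s t by (auto simp: J_def)
    then have "(\<Prod>s'\<in>I-{s}. z s - z s') = (z s - z t) * (\<Prod>s'\<in>J-{s}. z s - z s')"
      using J(1) by simp
    then show "poly g (z s) / (\<Prod>s'\<in>I-{s}. z s - z s')
        = - (poly g (z s) / ((\<Prod>s'\<in>J-{s}. z s - z s') * (z t - z s)))"
      by (metis (no_types, lifting) divide_minus_right minus_diff_eq mult.commute mult_minus_left)
  qed
  also have "\<dots> = - (poly g (z t) / (\<Prod>s\<in>J. z t - z s))"
    using partial_fractions[OF J] by (simp add: sum_negf)
  finally show ?thesis
    using sum.remove[OF assms(1) t, of "\<lambda>s. poly g (z s) / (\<Prod>s'\<in>I-{s}. z s - z s')"]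
    by (simp add: J_def)
qed

subsection \<open>Contour integrals of Laurent series\<close>

lemma circle_integral_powi:
  "((\<lambda>z::complex. z powi n) has_contour_integral (if n = -1 then 2 * of_real pi * \<i> else 0))
     (circlepath 0 1)"
proof (cases "n = -1")
  case True
  then show ?thesis
    using has_contour_integral_winding_number[of "circlepath 0 1" 0]
    by (simp add: winding_number_circlepath_centre power_int_minus divide_inverse)
next
  case False
  have "((\<lambda>z::complex. z powi n) has_contour_integral 0) (circlepath 0 1)"
  proof (rule Cauchy_theorem_primitive[where S = "- {0}" and f = "\<lambda>z. z powi (n + 1) / of_int (n + 1)"])
    fix x :: complex assume "x \<in> - {0}"
    then show "((\<lambda>z. z powi (n + 1) / of_int (n + 1)) has_field_derivative x powi n) (at x within - {0})"
      using False by (auto intro!: derivative_eq_intros simp: of_int_add[symmetric] simp del: of_int_add)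
  qed auto
  then show ?thesis using False by simp
qed

text \<open>On the unit circle all powers of \<open>z\<close> have norm 1, so summability of
  \<open>norm (c k)\<close> gives uniform convergence and termwise integration. \<open>N\<close> is
  only a bound for the degree, which lets one summation range serve a whole space of
  polynomials.\<close>

lemma circle_integral_laurent:
  fixes c :: "nat \<Rightarrow> complex" and P :: "complex poly"
  assumes "summable (\<lambda>k. norm (c k))" and deg: "P = 0 \<or> degree P < N"
  shows "contour_integral (circlepath 0 1)
           (\<lambda>z. z ^ l * (\<Sum>k. c k * z powi (- int k - 1)) * poly P z) / (2 * of_real pi * \<i>)
         = (\<Sum>\<alpha><N. coeff P \<alpha> * c (\<alpha> + l))"
proof -
  define f where "f = (\<lambda>k z. z ^ l * (c k * z powi (- int k - 1)) * poly P z)"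
  have poly_eq: "poly P z = (\<Sum>\<alpha><N. coeff P \<alpha> * z ^ \<alpha>)" for z
  proof (cases "P = 0")
    case False
    then have "{..degree P} \<subseteq> {..<N}" using deg by auto
    then show ?thesis
      unfolding poly_altdef by (intro sum.mono_neutral_left) (auto simp: coeff_eq_0)
  qed simp
  define B where "B = (\<Sum>\<alpha><N. norm (coeff P \<alpha>))"
  have B: "norm (poly P z) \<le> B" if "norm z = 1" for z
    unfolding poly_eq B_def
    by (rule order_trans[OF norm_sum]) (simp add: norm_mult norm_power that)
  have summ: "summable (\<lambda>k. c k * z powi (- int k - 1))" if "norm z = 1" for z
    by (rule summable_norm_cancel) (simp add: norm_mult norm_power_int that assms(1))
  have "uniform_limit (sphere 0 1) (\<lambda>n z. \<Sum>k<n. f k z) (\<lambda>z. \<Sum>k. f k z) sequentially"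
  proof (rule Weierstrass_m_test)
    fix k and z :: complex assume "z \<in> sphere 0 1"
    then show "norm (f k z) \<le> norm (c k) * B"
      using B[of z] by (simp add: f_def norm_mult norm_power norm_power_int mult_left_mono)
  qed (use assms(1) in \<open>intro summable_mult2\<close>)
  then have lim: "uniform_limit (sphere 0 1) (\<lambda>n z. \<Sum>k<n. f k z)
       (\<lambda>z. z ^ l * (\<Sum>k. c k * z powi (- int k - 1)) * poly P z) sequentially"
    by (rule uniform_limit_cong'[THEN iffD1, rotated -1])
       (use summ in \<open>auto simp: f_def suminf_mult suminf_mult2[symmetric] summable_mult\<close>)
  define J where "J = (\<lambda>k. \<Sum>\<alpha><N. c k * coeff P \<alpha> * (if k = \<alpha> + l then 2 * of_real pi * \<i> else 0))"
  have int_f: "(f k has_contour_integral J k) (circlepath 0 1)" for k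
  proof (rule has_contour_integral_eq)
    have "((\<lambda>z. z powi (int \<alpha> + int l - int k - 1)) has_contour_integral
             (if k = \<alpha> + l then 2 * of_real pi * \<i> else 0)) (circlepath 0 1)" for \<alpha>
    proof -
      have "int \<alpha> + int l - int k - 1 = -1 \<longleftrightarrow> k = \<alpha> + l" by linarith
      then show ?thesis
        using circle_integral_powi[of "int \<alpha> + int l - int k - 1"] by (simp only:)
    qed
    then show "((\<lambda>z. \<Sum>\<alpha><N. c k * coeff P \<alpha> * z powi (int \<alpha> + int l - int k - 1))
          has_contour_integral J k) (circlepath 0 1)"
      unfolding J_def by (intro has_contour_integral_sum has_contour_integral_lmul) auto
    fix z :: complex assume "z \<in> path_image (circlepath 0 1)"
    then have "z \<noteq> 0" by auto
    then have "z powi (int \<alpha> + int l - int k - 1) = z ^ \<alpha> * z ^ l * z powi (- int k - 1)" for \<alpha>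
      using power_int_add[of z "int \<alpha> + int l" "- int k - 1"] power_int_add[of z "int \<alpha>" "int l"]
      by (simp add: algebra_simps)
    then show "(\<Sum>\<alpha><N. c k * coeff P \<alpha> * z powi (int \<alpha> + int l - int k - 1)) = f k z"
      by (simp add: f_def poly_eq sum_distrib_left sum_distrib_right mult_ac)
  qed
  then have int_sum: "((\<lambda>z. \<Sum>k<n. f k z) has_contour_integral (\<Sum>k<n. J k)) (circlepath 0 1)" for n
    by (intro has_contour_integral_sum) auto
  have "((\<lambda>n. contour_integral (circlepath 0 1) (\<lambda>z. \<Sum>k<n. f k z)) \<longlongrightarrow>
      contour_integral (circlepath 0 1) (\<lambda>z. z ^ l * (\<Sum>k. c k * z powi (- int k - 1)) * poly P z)) sequentially"
    using int_sum lim
    by (intro contour_integral_uniform_limit_circlepath(2)[OF eventuallyI])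
       (auto simp: contour_integrable_on_def)
  \<comment> \<open>\<open>J k\<close> can be nonzero only for \<open>k = \<alpha> + l\<close> with
    \<open>\<alpha> < N\<close>, so the partial sums are constant from \<open>n = N + l\<close>
    on.\<close>
  moreover have "(\<Sum>k<n. J k) = 2 * of_real pi * \<i> * (\<Sum>\<alpha><N. coeff P \<alpha> * c (\<alpha> + l))" if "n \<ge> N + l" for n
  proof -
    have "(\<Sum>k<n. J k) = (\<Sum>\<alpha><N. \<Sum>k<n. c k * coeff P \<alpha> * (if k = \<alpha> + l then 2 * of_real pi * \<i> else 0))"
      unfolding J_def by (rule sum.swap)
    also have "\<dots> = (\<Sum>\<alpha><N. c (\<alpha> + l) * coeff P \<alpha> * (2 * of_real pi * \<i>))"
      using that by (intro sum.cong refl) (simp add: if_distrib[of "(*) _"] sum.delta cong: if_cong)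
    finally show ?thesis by (simp add: sum_distrib_left mult_ac)
  qed
  then have "((\<lambda>n. contour_integral (circlepath 0 1) (\<lambda>z. \<Sum>k<n. f k z)) \<longlongrightarrow>
      2 * of_real pi * \<i> * (\<Sum>\<alpha><N. coeff P \<alpha> * c (\<alpha> + l))) sequentially"
    using contour_integral_unique[OF int_sum]
    by (intro tendsto_eventually eventually_sequentiallyI[of "N + l"]) simp
  ultimately show ?thesis
    using LIMSEQ_unique by (fastforce simp: field_simps)
qed

subsection \<open>Moments of the weights\<close>

lemma nonpos_Ints_add_of_nat: "x \<notin> \<int>\<^sub>\<le>\<^sub>0 \<Longrightarrow> x + of_nat n \<notin> (\<int>\<^sub>\<le>\<^sub>0 :: complex set)"
  using nonpos_Ints_diff_Nats[of "x + of_nat n" "of_nat n"] by auto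

lemma nonpos_Ints_add_of_nat_neq_0: "x \<notin> (\<int>\<^sub>\<le>\<^sub>0 :: complex set) \<Longrightarrow> x + of_nat n \<noteq> 0"
  using plus_of_nat_eq_0_imp by blast

lemma pochhammer_neq_0: "x \<notin> (\<int>\<^sub>\<le>\<^sub>0 :: complex set) \<Longrightarrow> pochhammer x n \<noteq> 0"
  by (auto simp: pochhammer_eq_0_iff)

lemma tendsto_of_nat_add_divide:
  fixes x y :: complex
  assumes "y \<notin> \<int>\<^sub>\<le>\<^sub>0"
  shows "(\<lambda>k. inverse (of_nat k + y)) \<longlonglongrightarrow> 0"
    and "(\<lambda>k. (of_nat k + x) / (of_nat k + y)) \<longlonglongrightarrow> 1"
proof -
  have "filterlim (\<lambda>k. y + of_nat k) at_infinity sequentially"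
    by (rule tendsto_add_filterlim_at_infinity[OF tendsto_const tendsto_of_nat])
  then show *: "(\<lambda>k. inverse (of_nat k + y)) \<longlonglongrightarrow> 0"
    using filterlim_compose[OF tendsto_inverse_0] by (simp add: add.commute)
  have "(\<lambda>k. 1 + (x - y) * inverse (of_nat k + y)) \<longlonglongrightarrow> 1 + (x - y) * 0"
    by (intro tendsto_intros *)
  moreover have "1 + (x - y) * inverse (of_nat k + y) = (of_nat k + x) / (of_nat k + y)" for k
    using nonpos_Ints_add_of_nat_neq_0[OF assms, of k] by (simp add: field_simps)
  ultimately show "(\<lambda>k. (of_nat k + x) / (of_nat k + y)) \<longlonglongrightarrow> 1" by simp
qed

lemma summable_norm_ratio_tendsto_0:
  fixes c R :: "nat \<Rightarrow> complex"
  assumes "R \<longlonglongrightarrow> 0" "\<And>k. c (Suc k) = R k * c k"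
  shows "summable (\<lambda>k. norm (c k))"
proof -
  have "eventually (\<lambda>k. norm (R k) < 1/2) sequentially"
    using tendstoD[OF assms(1), of "1/2"] by simp
  then obtain K where K: "\<And>k. k \<ge> K \<Longrightarrow> norm (R k) < 1/2"
    by (auto simp: eventually_sequentially)
  then have "norm (c (Suc k)) \<le> 1/2 * norm (c k)" if "k \<ge> K" for k
    using K[OF that] unfolding assms(2) norm_mult by (intro mult_right_mono) auto
  then show ?thesis
    by (intro summable_ratio_test[of "1/2" K]) auto
qed

text \<open>The conditions that are the same for all row indices; what varies with the row index is
  left to \<open>balanced\<close>.\<close>

locale hypergeometric_weights =
  fixes p q r :: nat and a b \<kappa> :: "nat \<Rightarrow> complex"
  assumes r_less_q: "r < q"
    and regular: "regular p q b \<kappa>"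
    and kappa_a: "\<lbrakk>i \<in> {1..p}; \<rho> \<in> {1..r}\<rbrakk> \<Longrightarrow> \<kappa> i + a \<rho> + 1 \<notin> \<int>\<^sub>\<le>\<^sub>0"
    and kappa_b: "\<lbrakk>i \<in> {1..p}; h \<in> {1..q}\<rbrakk> \<Longrightarrow> \<kappa> i + b h + 1 \<notin> \<int>\<^sub>\<le>\<^sub>0"
begin

text \<open>The coefficient of \<open>z^(-k-1)\<close> in the weight, hence the integral of
  \<open>z^k\<close> against it over the unit circle, divided by
  \<open>2 * pi * \<i>\<close>.\<close>

definition moment :: "nat \<Rightarrow> nat \<Rightarrow> nat \<Rightarrow> complex" where
  "moment j i k = (\<Prod>\<rho>=1..r. Gamma (of_nat k + \<kappa> i + a \<rho> + 1)) /
     (\<Prod>h=1..q. Gamma (of_nat k + \<kappa> i + b h + of_nat (unit_vec j h) + 1))"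

definition gquot :: "complex \<Rightarrow> complex" where
  "gquot x = (\<Prod>\<rho>=1..r. Gamma (x + a \<rho> + 1)) / (\<Prod>h=1..q. Gamma (x + b h + 1))"

text \<open>The moment \<open>moment j i (k + l)\<close> is \<open>wfrac j l\<close> at the node \<open>\<kappa> i + k\<close>, up to a factor that
  depends on the node only.\<close>
definition wfrac :: "nat \<Rightarrow> nat \<Rightarrow> complex \<Rightarrow> complex" where
  "wfrac j l x = (\<Prod>\<rho>=1..r. pochhammer (x + a \<rho> + 1) l) /
     ((\<Prod>h=1..q. pochhammer (x + b h + 1) l) * (x + b j + of_nat l + 1))"

lemma kappa_a': "\<lbrakk>i \<in> {1..p}; \<rho> \<in> {1..r}\<rbrakk> \<Longrightarrow> \<kappa> i + of_nat k + a \<rho> + 1 \<notin> \<int>\<^sub>\<le>\<^sub>0"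
  using nonpos_Ints_add_of_nat[OF kappa_a, of i \<rho> k] by (simp add: algebra_simps)

lemma kappa_b': "\<lbrakk>i \<in> {1..p}; h \<in> {1..q}\<rbrakk> \<Longrightarrow> \<kappa> i + of_nat k + b h + 1 \<notin> \<int>\<^sub>\<le>\<^sub>0"
  using nonpos_Ints_add_of_nat[OF kappa_b, of i h k] by (simp add: algebra_simps)

lemma gquot_neq_0: "i \<in> {1..p} \<Longrightarrow> gquot (\<kappa> i + of_nat k) \<noteq> 0"
  unfolding gquot_def using kappa_a' kappa_b'
  by (auto simp: prod_zero_iff Gamma_eq_zero_iff)

text \<open>By the shift relation of Gamma; the additional shift in component \<open>j\<close> of
  the denominator contributes the single factor \<open>x + b j + l + 1\<close>.\<close>

lemma moment_eq:
  assumes i: "i \<in> {1..p}" and j: "j \<in> {1..q}"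
  shows "moment j i (k + l) = gquot (\<kappa> i + of_nat k) * wfrac j l (\<kappa> i + of_nat k)"
proof -
  define x where "x = \<kappa> i + of_nat k"
  have G: "Gamma (y + of_nat l) = Gamma y * pochhammer y l" if "y \<notin> \<int>\<^sub>\<le>\<^sub>0" for y :: complex
    using pochhammer_Gamma[OF that] that by (simp add: Gamma_eq_zero_iff)
  have "(\<Prod>\<rho>=1..r. Gamma (of_nat (k + l) + \<kappa> i + a \<rho> + 1))
        = (\<Prod>\<rho>=1..r. Gamma (x + a \<rho> + 1) * pochhammer (x + a \<rho> + 1) l)"
    using G[OF kappa_a'[OF i, of _ k]] by (intro prod.cong) (simp_all add: x_def algebra_simps)
  moreover have "(\<Prod>h=1..q. Gamma (of_nat (k + l) + \<kappa> i + b h + of_nat (unit_vec j h) + 1))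
     = (\<Prod>h=1..q. Gamma (x + b h + 1) * pochhammer (x + b h + 1) l
                    * (if h = j then x + b j + of_nat l + 1 else 1))"
  proof (rule prod.cong[OF refl])
    fix h assume h: "h \<in> {1..q}"
    let ?y = "x + b h + 1"
    have y: "?y + of_nat l \<notin> \<int>\<^sub>\<le>\<^sub>0" "?y \<notin> \<int>\<^sub>\<le>\<^sub>0"
      using nonpos_Ints_add_of_nat kappa_b'[OF i h] by (simp_all add: x_def)
    have "Gamma (of_nat (k + l) + \<kappa> i + b h + of_nat (unit_vec j h) + 1)
          = Gamma (?y + of_nat l + of_nat (unit_vec j h))"
      by (simp add: x_def algebra_simps)
    also have "\<dots> = Gamma (?y + of_nat l) * (if h = j then ?y + of_nat l else 1)"
      using Gamma_plus1[OF y(1)] by (cases "h = j") (simp_all add: unit_vec_def)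
    also have "\<dots> = Gamma ?y * pochhammer ?y l * (if h = j then x + b j + of_nat l + 1 else 1)"
      using G[OF y(2)] by (simp add: algebra_simps)
    finally show "Gamma (of_nat (k + l) + \<kappa> i + b h + of_nat (unit_vec j h) + 1) = \<dots>" .
  qed
  moreover have "(\<Prod>h=1..q. if h = j then x + b j + of_nat l + 1 else 1) = x + b j + of_nat l + 1"
    using j by (simp add: prod.delta)
  ultimately show ?thesis
    by (simp add: moment_def gquot_def wfrac_def prod.distrib x_def)
qed

text \<open>Ratio test. The quotient of consecutive moments has \<open>r\<close> linear factors over
  \<open>q\<close>: paired off, the first \<open>r\<close> quotients tend to 1, and the remaining
  reciprocals, of which there is at least one since \<open>r < q\<close>, tend to 0.\<close>

lemma summable_moment:
  assumes i: "i \<in> {1..p}"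
  shows "summable (\<lambda>k. norm (moment j i k))"
proof (rule summable_norm_ratio_tendsto_0)
  define y where "y = (\<lambda>h. \<kappa> i + b h + of_nat (unit_vec j h) + 1)"
  define R where "R = (\<lambda>k. (\<Prod>\<rho>=1..r. (of_nat k + (\<kappa> i + a \<rho> + 1)) / (of_nat k + y \<rho>)) *
                          (\<Prod>h\<in>{r<..q}. inverse (of_nat k + y h)))"
  have y: "y h \<notin> \<int>\<^sub>\<le>\<^sub>0" if "h \<in> {1..q}" for h
    using nonpos_Ints_add_of_nat[OF kappa_b[OF i that], of "unit_vec j h"]
    by (simp add: y_def add.commute add.left_commute)
  have "R \<longlonglongrightarrow> (\<Prod>\<rho>=1..r. 1) * (\<Prod>h\<in>{r<..q}. 0)"
    unfolding R_def using r_less_q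
    by (intro tendsto_mult tendsto_prod tendsto_of_nat_add_divide y) auto
  then show "R \<longlonglongrightarrow> 0"
    using r_less_q by (simp add: prod_constant power_0_left)
  fix k
  have "moment j i (Suc k) = (\<Prod>\<rho>=1..r. of_nat k + (\<kappa> i + a \<rho> + 1)) / (\<Prod>h=1..q. of_nat k + y h) * moment j i k"
  proof -
    have "Gamma (of_nat (Suc k) + \<kappa> i + a \<rho> + 1)
      = (of_nat k + (\<kappa> i + a \<rho> + 1)) * Gamma (of_nat k + \<kappa> i + a \<rho> + 1)" if "\<rho> \<in> {1..r}" for \<rho>
      using Gamma_plus1[OF kappa_a'[OF i that, of k]] by (simp add: algebra_simps)
    moreover have "Gamma (of_nat (Suc k) + \<kappa> i + b h + of_nat (unit_vec j h) + 1)
      = (of_nat k + y h) * Gamma (of_nat k + \<kappa> i + b h + of_nat (unit_vec j h) + 1)" if "h \<in> {1..q}" for h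
      using Gamma_plus1[OF nonpos_Ints_add_of_nat[OF y[OF that], of k]] by (simp add: y_def algebra_simps)
    ultimately show ?thesis
      by (simp add: moment_def prod.distrib)
  qed
  moreover have "{1..q} = {1..r} \<union> {r<..q}" using r_less_q by auto
  then have "(\<Prod>h=1..q. of_nat k + y h) = (\<Prod>h=1..r. of_nat k + y h) * (\<Prod>h\<in>{r<..q}. of_nat k + y h)"
    by (simp only:) (rule prod.union_disjoint; auto)
  ultimately show "moment j i (Suc k) = R k * moment j i k"
    by (simp add: R_def prod_dividef prod_inversef field_simps)
qed

text \<open>Taken with a degree bound \<open>N\<close> in place of the actual degrees, so that it is
  linear in \<open>P\<close>; it agrees with the contour integrals of \<open>rec_space\<close> when
  \<open>P\<close> respects the bound.\<close>

definition mom :: "(nat \<Rightarrow> nat) \<Rightarrow> pvec \<Rightarrow> nat \<Rightarrow> nat \<Rightarrow> complex" where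
  "mom N P j l = (\<Sum>i=1..p. \<Sum>\<alpha><N i. coeff (P i) \<alpha> * moment j i (\<alpha> + l))"

lemma rec_space_eq:
  "rec_space p q r a b \<kappa> N M = {P. (\<forall>i. i \<notin> {1..p} \<longrightarrow> P i = 0) \<and>
     (\<forall>i\<in>{1..p}. P i = 0 \<or> degree (P i) < N i) \<and>
     (\<forall>j\<in>{1..q}. \<forall>l<M j. mom N P j l = 0)}"
proof -
  have "(\<Sum>i=1..p. contour_integral (circlepath 0 1)
           (\<lambda>z. z ^ l * weight q r a b \<kappa> j i z * poly (P i) z) / (2 * of_real pi * \<i>)) = mom N P j l"
    if deg: "\<forall>i\<in>{1..p}. P i = 0 \<or> degree (P i) < N i" for P j l
    unfolding mom_def weight_def moment_def[symmetric]
    using deg by (intro sum.cong circle_integral_laurent summable_moment) auto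
  then show ?thesis
    unfolding rec_space_def by (intro Collect_cong) (auto simp only:)
qed

end

subsection \<open>Expansion of simple fractions\<close>

context hypergeometric_weights
begin

lemma b_diff_notin_Ints: "\<lbrakk>j \<in> {1..q}; h \<in> {1..q}; j \<noteq> h\<rbrakk> \<Longrightarrow> b j - b h \<notin> \<int>"
  using regular by (auto simp: regular_def)

lemma kappa_diff_notin_Ints: "\<lbrakk>i \<in> {1..p}; h \<in> {1..p}; i \<noteq> h\<rbrakk> \<Longrightarrow> \<kappa> i - \<kappa> h \<notin> \<int>"
  using regular by (auto simp: regular_def)

lemma b_shift_eq_iff:
  assumes "h \<in> {1..q}" "H \<in> {1..q}"
  shows "b h + of_int k = b H + of_int l \<longleftrightarrow> h = H \<and> k = l"
proof (cases "h = H")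
  case False
  have "b h - b H \<noteq> of_int (l - k)"
    using b_diff_notin_Ints[OF assms False] by (metis Ints_of_int)
  then show ?thesis using False by (auto simp: algebra_simps)
qed auto

lemma b_shift_neq_0:
  assumes "h \<in> {1..q}" "H \<in> {1..q}" "h \<noteq> H \<or> d \<noteq> K"
  shows "b h - (b H + of_nat K) + of_nat d \<noteq> 0"
  using b_shift_eq_iff[OF assms(1,2), of "int d" "int K"] assms(3) by (auto simp: algebra_simps)

text \<open>The residue at \<open>t = - b j\<close> of the rational function on the right of
  \<open>sum_resb\<close>.\<close>

definition resb :: "nat \<Rightarrow> complex" where
  "resb j = (\<Prod>\<rho>=1..r. a \<rho> - b j) / (\<Prod>h\<in>{1..q}-{j}. b h - b j)"

text \<open>Since \<open>r < q\<close>, the fraction is proper in \<open>t\<close> and equals the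
  sum of its polar parts.\<close>

lemma sum_resb:
  assumes "\<And>h. h \<in> {1..q} \<Longrightarrow> t + b h \<noteq> 0"
  shows "(\<Sum>j=1..q. resb j / (t + b j)) = (\<Prod>\<rho>=1..r. t + a \<rho>) / (\<Prod>h=1..q. t + b h)"
proof -
  define g where "g = (\<Prod>\<rho>=1..r. [:a \<rho>, 1:])"
  have "degree g \<le> (\<Sum>\<rho>=1..r. degree [:a \<rho>, 1:])"
    unfolding g_def by (intro degree_prod_sum_le[unfolded comp_def]) auto
  then have "degree g < card {1..q}" using r_less_q by simp
  moreover have "inj_on (\<lambda>j. - b j) {1..q}"
    using b_shift_eq_iff[of _ _ 0 0] by (auto simp: inj_on_def)
  moreover have "t \<notin> (\<lambda>j. - b j) ` {1..q}"
    using assms by force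
  ultimately have "(\<Sum>j=1..q. poly g (- b j) / ((\<Prod>h\<in>{1..q}-{j}. - b j - - b h) * (t - - b j)))
      = poly g t / (\<Prod>h=1..q. t - - b h)"
    by (intro partial_fractions) auto
  then show ?thesis
    by (simp add: g_def poly_prod resb_def algebra_simps)
qed

text \<open>The coefficient of \<open>wfrac j \<beta>\<close> in the expansion of
  \<open>1 / (x + b H + K + 1)\<close>. Giving the index \<open>j\<close> a Pochhammer symbol of one
  order less, instead of dividing a full product by its last factor, keeps the value right for
  \<open>j = H\<close>, \<open>\<beta> = K\<close>, where that factor is zero.\<close>

definition ecoef :: "nat \<Rightarrow> nat \<Rightarrow> nat \<Rightarrow> nat \<Rightarrow> complex" where
  "ecoef j \<beta> H K = resb j *
     ((\<Prod>h\<in>{1..q}-{j}. pochhammer (b h - (b H + of_nat K)) (Suc \<beta>)) *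
      pochhammer (b j - (b H + of_nat K)) \<beta>) /
     (\<Prod>\<rho>=1..r. pochhammer (a \<rho> - (b H + of_nat K)) (Suc \<beta>))"

text \<open>The index \<open>H\<close> contributes a Pochhammer symbol of \<open>- K\<close>, of
  order \<open>Suc \<beta>\<close> if \<open>j \<noteq> H\<close> but only of order
  \<open>\<beta>\<close> if \<open>j = H\<close>. This difference of one lets the term
  \<open>j = H\<close>, \<open>\<beta> = K\<close> survive.\<close>

lemma ecoef_eq_0:
  assumes j: "j \<in> {1..q}" and H: "H \<in> {1..q}" and that: "if j = H then \<beta> > K else \<beta> \<ge> K"
  shows "ecoef j \<beta> H K = 0"
proof (cases "j = H")
  case True
  then show ?thesis using that by (simp add: ecoef_def pochhammer_eq_0_iff)
next
  case False
  then have "pochhammer (b H - (b H + of_nat K)) (Suc \<beta>) = 0"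
    using that by (auto simp: pochhammer_eq_0_iff intro: le_imp_less_Suc)
  then have "(\<Prod>h\<in>{1..q}-{j}. pochhammer (b h - (b H + of_nat K)) (Suc \<beta>)) = 0"
    using False H by (intro prod_zero bexI[of _ H]) auto
  then show ?thesis by (simp add: ecoef_def)
qed

text \<open>With \<open>u = b H + K\<close> and
  \<open>G d = \<Prod>(b - u)\<^sub>d (x + a + 1)\<^sub>d / \<Prod>(a - u)\<^sub>d (x + b + 1)\<^sub>d\<close>, the inner sum over
  \<open>j\<close> equals \<open>(G d - G (d + 1)) / (x + u + 1)\<close> by two applications of \<open>sum_resb\<close>; the sum over \<open>d\<close>
  telescopes. The term \<open>d = K\<close>, in which only \<open>j = H\<close> survives, is treated apart, since there
  \<open>b H - u + d = 0\<close>.\<close>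
lemma ecoef_expansion:
  assumes H: "H \<in> {1..q}" and K: "K < \<mu> H"
    and near: "\<And>h. h \<in> {1..q} \<Longrightarrow> \<mu> H \<le> \<mu> h + 1"
    and aH: "\<And>\<rho> d. \<lbrakk>\<rho> \<in> {1..r}; d \<le> K\<rbrakk> \<Longrightarrow> a \<rho> - (b H + of_nat K) + of_nat d \<noteq> 0"
    and x: "\<And>h. h \<in> {1..q} \<Longrightarrow> x + b h + 1 \<notin> \<int>\<^sub>\<le>\<^sub>0"
  shows "(\<Sum>j=1..q. \<Sum>\<beta><\<mu> j. ecoef j \<beta> H K * wfrac j \<beta> x) = 1 / (x + b H + of_nat K + 1)"
proof -
  define u where "u = b H + of_nat K"
  define G where "G = (\<lambda>d. (\<Prod>h=1..q. pochhammer (b h - u) d) * (\<Prod>\<rho>=1..r. pochhammer (x + a \<rho> + 1) d) /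
     ((\<Prod>\<rho>=1..r. pochhammer (a \<rho> - u) d) * (\<Prod>h=1..q. pochhammer (x + b h + 1) d)))"
  have xb: "x + of_nat d + 1 + b h \<noteq> 0" if "h \<in> {1..q}" for h d
    using nonpos_Ints_add_of_nat_neq_0[OF x[OF that], of d] by (simp add: algebra_simps)
  have xu: "x + u + 1 \<noteq> 0"
    using xb[OF H, of K] by (simp add: u_def algebra_simps)
  have poch_a: "(\<Prod>\<rho>=1..r. pochhammer (a \<rho> - u) d) \<noteq> 0" if "d \<le> Suc K" for d
  proof -
    have "pochhammer (a \<rho> - u) d \<noteq> 0" if \<rho>: "\<rho> \<in> {1..r}" for \<rho>
    proof
      assume "pochhammer (a \<rho> - u) d = 0"
      then obtain k where "k < d" "a \<rho> - u = - of_nat k"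
        by (auto simp: pochhammer_eq_0_iff)
      then show False
        using aH[OF \<rho>, of k] \<open>d \<le> Suc K\<close> by (simp add: u_def)
    qed
    then show ?thesis by (simp add: prod_zero_iff)
  qed
  have split_prod: "(\<Prod>h=1..q. f h) = (\<Prod>h\<in>{1..q}-{j}. f h) * f j" if "j \<in> {1..q}" for j and f :: "nat \<Rightarrow> complex"
    using prod.remove[of "{1..q}" j f] that by (simp add: mult.commute)
  have step: "(\<Sum>j=1..q. ecoef j d H K * wfrac j d x) = (G d - G (Suc d)) / (x + u + 1)" if d: "d < K" for d
  proof -
    \<comment> \<open>In \<open>C\<close> the symbols at \<open>u\<close> already have order
      \<open>Suc d\<close>, those at \<open>x\<close> still have order \<open>d\<close>. Hence
      \<open>G d\<close> and \<open>G (Suc d)\<close> are \<open>C\<close> times the fraction of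
      \<open>sum_resb\<close> at \<open>t = d - u\<close> and at
      \<open>t = x + d + 1\<close>.\<close>
    define C where "C = (\<Prod>h=1..q. pochhammer (b h - u) (Suc d)) * (\<Prod>\<rho>=1..r. pochhammer (x + a \<rho> + 1) d) /
     ((\<Prod>\<rho>=1..r. pochhammer (a \<rho> - u) (Suc d)) * (\<Prod>h=1..q. pochhammer (x + b h + 1) d))"
    have ub: "of_nat d - u + b h \<noteq> 0" if "h \<in> {1..q}" for h
      using b_shift_neq_0[OF that H, of d K] d by (auto simp: u_def algebra_simps)
    have "ecoef j d H K * wfrac j d x
        = C * (resb j / (of_nat d - u + b j) - resb j / (x + of_nat d + 1 + b j)) / (x + u + 1)"
      if j: "j \<in> {1..q}" for j
    proof -
      define D where "D = (\<Prod>h\<in>{1..q}-{j}. pochhammer (b h - u) (Suc d)) * pochhammer (b j - u) d"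
      have "(\<Prod>h=1..q. pochhammer (b h - u) (Suc d)) = D * (of_nat d - u + b j)"
        unfolding split_prod[OF j] D_def pochhammer_Suc[of "b j - u"] by (simp add: algebra_simps)
      moreover have "ecoef j d H K = resb j * D / (\<Prod>\<rho>=1..r. pochhammer (a \<rho> - u) (Suc d))"
        by (simp only: ecoef_def D_def u_def)
      moreover have "wfrac j d x = (\<Prod>\<rho>=1..r. pochhammer (x + a \<rho> + 1) d) /
          ((\<Prod>h=1..q. pochhammer (x + b h + 1) d) * (x + of_nat d + 1 + b j))"
        by (simp add: wfrac_def add_ac)
      ultimately have "ecoef j d H K * wfrac j d x
        = C / (of_nat d - u + b j) * (resb j / (x + of_nat d + 1 + b j))"
        using ub[OF j] by (simp add: C_def mult_ac)
      \<comment> \<open>The two denominators differ by \<open>x + u + 1\<close> for every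
        \<open>j\<close>, so the product of their reciprocals becomes a difference to which
        \<open>sum_resb\<close> applies twice.\<close>
      moreover have "1 / (of_nat d - u + b j) - 1 / (x + of_nat d + 1 + b j)
          = (x + u + 1) / ((of_nat d - u + b j) * (x + of_nat d + 1 + b j))"
        using ub[OF j] xb[OF j, of d] by (simp add: diff_frac_eq)
      then have "C * (resb j / (of_nat d - u + b j) - resb j / (x + of_nat d + 1 + b j)) / (x + u + 1)
        = C * resb j * ((x + u + 1) / ((of_nat d - u + b j) * (x + of_nat d + 1 + b j))) / (x + u + 1)"
        by (metis (no_types, opaque_lifting) mult.assoc mult.right_neutral right_diff_distrib times_divide_eq_right)
      ultimately show ?thesis using xu by simp
    qed
    then have "(\<Sum>j=1..q. ecoef j d H K * wfrac j d x)
        = C * ((\<Sum>j=1..q. resb j / (of_nat d - u + b j)) - (\<Sum>j=1..q. resb j / (x + of_nat d + 1 + b j))) / (x + u + 1)"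
      by (simp add: sum_subtractf[symmetric] sum_distrib_left sum_divide_distrib)
    also have "\<dots> = (C * ((\<Prod>\<rho>=1..r. of_nat d - u + a \<rho>) / (\<Prod>h=1..q. of_nat d - u + b h))
                  - C * ((\<Prod>\<rho>=1..r. x + of_nat d + 1 + a \<rho>) / (\<Prod>h=1..q. x + of_nat d + 1 + b h))) / (x + u + 1)"
      using sum_resb[OF ub] sum_resb[OF xb] by (simp add: right_diff_distrib)
    also have "C * ((\<Prod>\<rho>=1..r. of_nat d - u + a \<rho>) / (\<Prod>h=1..q. of_nat d - u + b h)) = G d"
    proof -
      have "(\<Prod>h=1..q. of_nat d - u + b h) \<noteq> 0"
        using ub by (simp add: prod_zero_iff)
      moreover have "(\<Prod>\<rho>=1..r. pochhammer (a \<rho> - u) (Suc d)) = (\<Prod>\<rho>=1..r. pochhammer (a \<rho> - u) d) * (\<Prod>\<rho>=1..r. of_nat d - u + a \<rho>)"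
        unfolding pochhammer_Suc prod.distrib[symmetric] by (intro prod.cong) (simp_all add: algebra_simps)
      moreover have "(\<Prod>h=1..q. pochhammer (b h - u) (Suc d)) = (\<Prod>h=1..q. pochhammer (b h - u) d) * (\<Prod>h=1..q. of_nat d - u + b h)"
        unfolding pochhammer_Suc prod.distrib[symmetric] by (intro prod.cong) (simp_all add: algebra_simps)
      ultimately show ?thesis
        using poch_a[of "Suc d"] d by (simp add: C_def G_def)
    qed
    also have "C * ((\<Prod>\<rho>=1..r. x + of_nat d + 1 + a \<rho>) / (\<Prod>h=1..q. x + of_nat d + 1 + b h)) = G (Suc d)"
    proof -
      have "(\<Prod>\<rho>=1..r. pochhammer (x + a \<rho> + 1) (Suc d)) = (\<Prod>\<rho>=1..r. pochhammer (x + a \<rho> + 1) d) * (\<Prod>\<rho>=1..r. x + of_nat d + 1 + a \<rho>)"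
        unfolding pochhammer_Suc prod.distrib[symmetric] by (intro prod.cong) (simp_all add: algebra_simps)
      moreover have "(\<Prod>h=1..q. pochhammer (x + b h + 1) (Suc d)) = (\<Prod>h=1..q. pochhammer (x + b h + 1) d) * (\<Prod>h=1..q. x + of_nat d + 1 + b h)"
        unfolding pochhammer_Suc prod.distrib[symmetric] by (intro prod.cong) (simp_all add: algebra_simps)
      ultimately show ?thesis
        by (simp add: C_def G_def mult.assoc)
    qed
    finally show ?thesis .
  qed
  \<comment> \<open>For \<open>j \<noteq> H\<close>, the bound
    \<open>\<mu> H \<le> \<mu> j + 1\<close> gives \<open>K \<le> \<mu> j\<close>: all orders
    \<open>\<beta> < K\<close> are available, and the higher ones have coefficient zero.\<close>
  have inner: "(\<Sum>\<beta><\<mu> j. ecoef j \<beta> H K * wfrac j \<beta> x)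
     = (\<Sum>\<beta><K. ecoef j \<beta> H K * wfrac j \<beta> x) + (if j = H then ecoef H K H K * wfrac H K x else 0)"
    if j: "j \<in> {1..q}" for j
  proof (cases "j = H")
    case True
    have "(\<Sum>\<beta><\<mu> j. ecoef j \<beta> H K * wfrac j \<beta> x) = (\<Sum>\<beta><Suc K. ecoef j \<beta> H K * wfrac j \<beta> x)"
      using True K ecoef_eq_0[OF j H] by (intro sum.mono_neutral_right) auto
    then show ?thesis using True by simp
  next
    case False
    have "(\<Sum>\<beta><\<mu> j. ecoef j \<beta> H K * wfrac j \<beta> x) = (\<Sum>\<beta><K. ecoef j \<beta> H K * wfrac j \<beta> x)"
      using False K ecoef_eq_0[OF j H] near[OF j] by (intro sum.mono_neutral_right) auto
    then show ?thesis using False by simp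
  qed
  have last: "ecoef H K H K * wfrac H K x = G K / (x + u + 1)"
  proof -
    have 1: "(\<Prod>h\<in>{1..q}-{H}. pochhammer (b h - u) (Suc K)) =
        (\<Prod>h\<in>{1..q}-{H}. pochhammer (b h - u) K) * (\<Prod>h\<in>{1..q}-{H}. b h - b H)"
      by (simp add: pochhammer_Suc prod.distrib u_def)
    have 2: "(\<Prod>\<rho>=1..r. pochhammer (a \<rho> - u) (Suc K)) =
        (\<Prod>\<rho>=1..r. pochhammer (a \<rho> - u) K) * (\<Prod>\<rho>=1..r. a \<rho> - b H)"
      by (simp add: pochhammer_Suc prod.distrib u_def)
    have 3: "(\<Prod>h\<in>{1..q}-{H}. b h - b H) \<noteq> 0"
      using b_shift_neq_0[of _ H 0 0] H by (auto simp: prod_zero_iff)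
    have 4: "(\<Prod>\<rho>=1..r. a \<rho> - b H) \<noteq> 0"
      using poch_a[of "Suc K", unfolded 2] by simp
    show ?thesis
      unfolding ecoef_def wfrac_def G_def resb_def u_def[symmetric] 1 2
        split_prod[OF H, of "\<lambda>h. pochhammer (b h - u) K"]
      using 3 4 by (simp add: u_def add.assoc)
  qed
  have "(\<Sum>j=1..q. \<Sum>\<beta><\<mu> j. ecoef j \<beta> H K * wfrac j \<beta> x)
      = (\<Sum>j=1..q. \<Sum>\<beta><K. ecoef j \<beta> H K * wfrac j \<beta> x) + ecoef H K H K * wfrac H K x"
    using inner H by (simp add: sum.distrib)
  also have "(\<Sum>j=1..q. \<Sum>\<beta><K. ecoef j \<beta> H K * wfrac j \<beta> x) = (\<Sum>\<beta><K. (G \<beta> - G (Suc \<beta>)) / (x + u + 1))"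
    by (subst sum.swap) (intro sum.cong refl step, simp)
  also have "\<dots> = (G 0 - G K) / (x + u + 1)"
    by (simp add: sum_divide_distrib[symmetric] sum_lessThan_telescope')
  \<comment> \<open>\<open>G 0 = 1\<close> by empty products, and the last term restores exactly the
    \<open>G K\<close> that the telescoping sum subtracts.\<close>
  also have "(G 0 - G K) / (x + u + 1) + ecoef H K H K * wfrac H K x = 1 / (x + u + 1)"
    unfolding last add_divide_distrib[symmetric] by (simp add: G_def)
  finally show ?thesis
    by (simp only: u_def add.assoc)
qed

end

subsection \<open>Test functionals\<close>

lemma pochhammer_prod_lessThan: "pochhammer x n = (\<Prod>k<n. x + of_nat k)"
  by (simp add: pochhammer_prod atLeast0LessThan)

lemma degree_prod_linear_le:
  fixes f :: "'a \<Rightarrow> 'b::comm_ring_1"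
  assumes "finite A"
  shows "degree (\<Prod>s\<in>A. [:f s, 1:]) \<le> card A"
proof -
  have "degree (\<Prod>s\<in>A. [:f s, 1:]) \<le> (\<Sum>s\<in>A. degree [:f s, 1:])"
    using assms by (intro degree_prod_sum_le[unfolded comp_def])
  also have "\<dots> = card A" using assms by simp
  finally show ?thesis .
qed

lemma sum_unique_nonzero:
  assumes "finite A" "s \<in> A" "\<And>t. \<lbrakk>t \<in> A; t \<noteq> s\<rbrakk> \<Longrightarrow> f t = 0"
  shows "sum f A = (f s :: 'a::comm_monoid_add)"
proof -
  have "sum f A = sum f {s}"
    using assms by (intro sum.mono_neutral_right) auto
  then show ?thesis by simp
qed

definition index_set :: "nat \<Rightarrow> (nat \<Rightarrow> nat) \<Rightarrow> (nat \<times> nat) set" where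
  "index_set d N = (SIGMA i:{1..d}. {..<N i})"

lemma finite_index_set [simp]: "finite (index_set d N)"
  by (simp add: index_set_def)

lemma card_index_set: "card (index_set d N) = vsum d N"
  by (simp add: index_set_def vsum_def)

lemma sum_index_set: "(\<Sum>(i, k)\<in>index_set d N. f i k) = (\<Sum>i=1..d. \<Sum>k<N i. f i k)"
  by (simp add: index_set_def sum.Sigma)

lemma prod_index_set: "(\<Prod>(i, k)\<in>index_set d N. f i k) = (\<Prod>i=1..d. \<Prod>k<N i. f i k)"
  by (simp add: index_set_def prod.Sigma)

context hypergeometric_weights
begin

text \<open>The second condition says that no factor \<open>a \<rho> - (b H + K) + d\<close> with
  \<open>d \<le> K < M H\<close> vanishes; these are the factors in the denominators of
  \<open>ecoef\<close>.\<close>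

definition balanced :: "(nat \<Rightarrow> nat) \<Rightarrow> bool" where
  "balanced M \<longleftrightarrow> (\<forall>h\<in>{1..q}. \<forall>h'\<in>{1..q}. M h \<le> M h' + 1) \<and>
     (\<forall>\<rho>\<in>{1..r}. \<forall>h\<in>{1..q}. \<forall>k<M h. a \<rho> - b h - of_nat k \<noteq> 0)"

lemma balancedI:
  assumes "M \<in> near_diag q (vsum q M)" "params_admissible p q r a b \<kappa> M"
  shows "balanced M"
  unfolding balanced_def
proof (intro conjI ballI allI impI)
  fix h h' assume "h \<in> {1..q}" "h' \<in> {1..q}"
  then have "\<bar>int (M h) - int (M h')\<bar> \<le> 1" using assms(1) by (simp add: near_diag_def)
  then show "M h \<le> M h' + 1" by linarith
next
  fix \<rho> h k assume *: "\<rho> \<in> {1..r}" "h \<in> {1..q}" "k < M h"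
  then have "a \<rho> - b h - of_nat (M h) + 1 \<notin> \<int>\<^sub>\<le>\<^sub>0"
    using assms(2) by (auto simp: params_admissible_def)
  then have "a \<rho> - b h - of_nat (M h) + 1 + of_nat (M h - 1 - k) \<noteq> 0"
    by (rule nonpos_Ints_add_of_nat_neq_0)
  then show "a \<rho> - b h - of_nat k \<noteq> 0"
    using * by (simp add: of_nat_diff algebra_simps)
qed

definition pole :: "nat \<times> nat \<Rightarrow> complex" where
  "pole = (\<lambda>(h, k). - (b h + of_nat k + 1))"

definition node :: "nat \<times> nat \<Rightarrow> complex" where
  "node = (\<lambda>(i, k). \<kappa> i + of_nat k)"

definition bden :: "(nat \<Rightarrow> nat) \<Rightarrow> complex \<Rightarrow> complex" where
  "bden M x = (\<Prod>h=1..q. pochhammer (x + b h + 1) (M h))"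

lemma bden_neq_0: "i \<in> {1..p} \<Longrightarrow> bden M (\<kappa> i + of_nat k) \<noteq> 0"
  using pochhammer_neq_0[OF kappa_b'] by (simp add: bden_def prod_zero_iff)

lemma inj_on_pole: "inj_on pole (index_set q M)"
proof (rule inj_onI)
  fix s t assume *: "s \<in> index_set q M" "t \<in> index_set q M" "pole s = pole t"
  obtain h k h' k' where st: "s = (h, k)" "t = (h', k')" by (cases s, cases t)
  have "b h + of_nat k = - pole s - 1" "b h' + of_nat k' = - pole t - 1"
    by (simp_all add: st pole_def)
  then have "b h + of_int (int k) = b h' + of_int (int k')"
    using *(3) by simp
  then show "s = t"
    using b_shift_eq_iff[of h h' "int k" "int k'"] * by (simp add: st index_set_def)
qed

lemma inj_on_node: "inj_on node (index_set p N)"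
proof (rule inj_onI)
  fix s t assume *: "s \<in> index_set p N" "t \<in> index_set p N" "node s = node t"
  obtain i k i' k' where st: "s = (i, k)" "t = (i', k')" by (cases s, cases t)
  then have **: "\<kappa> i + of_nat k = \<kappa> i' + of_nat k'"
    using *(3) by (simp add: node_def)
  then have "\<kappa> i - \<kappa> i' = of_nat k' - of_nat k"
    by (simp add: algebra_simps)
  then have "\<kappa> i - \<kappa> i' \<in> \<int>" by simp
  then have "i = i'"
    using kappa_diff_notin_Ints[of i i'] * by (auto simp: st index_set_def)
  then show "s = t" using ** by (simp add: st)
qed

text \<open>The residue of \<open>poly g x / bden M x\<close> at the pole with index
  \<open>(H, K)\<close>.\<close>

definition pcoef :: "complex poly \<Rightarrow> (nat \<Rightarrow> nat) \<Rightarrow> nat \<Rightarrow> nat \<Rightarrow> complex" where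
  "pcoef g M H K = poly g (pole (H, K)) / (\<Prod>s\<in>index_set q M - {(H, K)}. pole (H, K) - pole s)"

lemma partial_fractions_bden:
  assumes deg: "degree g < vsum q M" and x: "\<And>h. h \<in> {1..q} \<Longrightarrow> x + b h + 1 \<notin> \<int>\<^sub>\<le>\<^sub>0"
  shows "(\<Sum>H=1..q. \<Sum>K<M H. pcoef g M H K * (1 / (x + b H + of_nat K + 1))) = poly g x / bden M x"
proof -
  have nz: "x + b h + of_nat k + 1 \<noteq> 0" if "h \<in> {1..q}" for h k
    using nonpos_Ints_add_of_nat_neq_0[OF x[OF that], of k] by (simp add: algebra_simps)
  have "x \<notin> pole ` index_set q M"
  proof
    assume "x \<in> pole ` index_set q M"
    then obtain h k where "h \<in> {1..q}" "x = pole (h, k)"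
      by (auto simp: index_set_def)
    then show False using nz[of h k] by (simp add: pole_def)
  qed
  then have "(\<Sum>s\<in>index_set q M. poly g (pole s) / ((\<Prod>s'\<in>index_set q M - {s}. pole s - pole s') * (x - pole s)))
       = poly g x / (\<Prod>s\<in>index_set q M. x - pole s)"
    using deg inj_on_pole by (intro partial_fractions) (auto simp: card_index_set)
  moreover have "(\<Prod>s\<in>index_set q M. x - pole s) = (\<Prod>(h, k)\<in>index_set q M. x + b h + 1 + of_nat k)"
    by (intro prod.cong) (auto simp: pole_def algebra_simps)
  then have "(\<Prod>s\<in>index_set q M. x - pole s) = bden M x"
    by (simp add: prod_index_set bden_def pochhammer_prod_lessThan)
  moreover have "(\<Sum>s\<in>index_set q M. poly g (pole s) / ((\<Prod>s'\<in>index_set q M - {s}. pole s - pole s') * (x - pole s)))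
     = (\<Sum>(H, K)\<in>index_set q M. pcoef g M H K * (1 / (x + b H + of_nat K + 1)))"
    by (intro sum.cong) (auto simp: pcoef_def pole_def algebra_simps)
  ultimately show ?thesis by (simp add: sum_index_set)
qed

text \<open>The coefficient of \<open>z\<^sup>\<beta>\<close> in the \<open>j\<close>-th entry of the test vector with numerator \<open>g\<close>.\<close>
definition bcoef :: "complex poly \<Rightarrow> (nat \<Rightarrow> nat) \<Rightarrow> nat \<Rightarrow> nat \<Rightarrow> complex" where
  "bcoef g M j \<beta> = (\<Sum>H=1..q. \<Sum>K<M H. pcoef g M H K * ecoef j \<beta> H K)"

text \<open>Decompose \<open>g / bden M\<close> into simple fractions and expand each by
  \<open>ecoef_expansion\<close>; exchanging the sums collects the coefficient of each
  \<open>wfrac j \<beta>\<close>. This is the spanning property of the functions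
  \<open>wfrac\<close>.\<close>

lemma bcoef_expansion:
  assumes deg: "degree g < vsum q M" and M: "balanced M"
    and x: "\<And>h. h \<in> {1..q} \<Longrightarrow> x + b h + 1 \<notin> \<int>\<^sub>\<le>\<^sub>0"
  shows "(\<Sum>j=1..q. \<Sum>\<beta><M j. bcoef g M j \<beta> * wfrac j \<beta> x) = poly g x / bden M x"
proof -
  have e: "(\<Sum>j=1..q. \<Sum>\<beta><M j. ecoef j \<beta> H K * wfrac j \<beta> x) = 1 / (x + b H + of_nat K + 1)"
    if "H \<in> {1..q}" "K < M H" for H K
  proof (rule ecoef_expansion[where \<mu> = M, OF that _ _ x])
    fix \<rho> d assume *: "\<rho> \<in> {1..r}" "d \<le> K"
    then have "a \<rho> - b H - of_nat (K - d) \<noteq> 0"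
      using M that unfolding balanced_def by (metis less_imp_diff_less)
    then show "a \<rho> - (b H + of_nat K) + of_nat d \<noteq> 0"
      using * by (simp add: of_nat_diff algebra_simps)
  qed (use M that in \<open>auto simp: balanced_def\<close>)
  have "(\<Sum>j=1..q. \<Sum>\<beta><M j. bcoef g M j \<beta> * wfrac j \<beta> x)
      = (\<Sum>(j, \<beta>)\<in>index_set q M. \<Sum>(H, K)\<in>index_set q M. pcoef g M H K * (ecoef j \<beta> H K * wfrac j \<beta> x))"
    by (simp add: sum_index_set bcoef_def sum_distrib_right mult.assoc)
  also have "\<dots> = (\<Sum>(H, K)\<in>index_set q M. \<Sum>(j, \<beta>)\<in>index_set q M. pcoef g M H K * (ecoef j \<beta> H K * wfrac j \<beta> x))"
    unfolding case_prod_beta by (rule sum.swap)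
  also have "\<dots> = (\<Sum>H=1..q. \<Sum>K<M H. pcoef g M H K * (1 / (x + b H + of_nat K + 1)))"
    unfolding sum_index_set sum_distrib_left[symmetric]
    by (intro sum.cong refl arg_cong2[of _ _ _ _ "(*)"] e) auto
  finally show ?thesis
    by (rule trans[OF _ partial_fractions_bden[OF deg x]])
qed

definition pair :: "(nat \<Rightarrow> nat) \<Rightarrow> complex poly \<Rightarrow> (nat \<Rightarrow> nat) \<Rightarrow> pvec \<Rightarrow> complex" where
  "pair N g M P = (\<Sum>j=1..q. \<Sum>\<beta><M j. bcoef g M j \<beta> * mom N P j \<beta>)"

text \<open>Each moment is a node factor times \<open>wfrac\<close>, so the sum over
  \<open>j\<close> and \<open>\<beta>\<close> can be carried out at every node separately. The left
  side involves only moments of orders below \<open>M\<close>, the right side only values of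
  \<open>g\<close> at nodes; every vanishing of \<open>pair\<close> is read off from one of the
  two.\<close>

lemma pair_eval:
  assumes "degree g < vsum q M" "balanced M"
  shows "pair N g M P = (\<Sum>(i, \<alpha>)\<in>index_set p N. coeff (P i) \<alpha> * gquot (node (i, \<alpha>)) *
            (poly g (node (i, \<alpha>)) / bden M (node (i, \<alpha>))))"
proof -
  have "pair N g M P = (\<Sum>(j, \<beta>)\<in>index_set q M. \<Sum>(i, \<alpha>)\<in>index_set p N.
      bcoef g M j \<beta> * (coeff (P i) \<alpha> * moment j i (\<alpha> + \<beta>)))"
    unfolding pair_def mom_def sum_index_set by (simp add: sum_distrib_left)
  also have "\<dots> = (\<Sum>(i, \<alpha>)\<in>index_set p N. \<Sum>(j, \<beta>)\<in>index_set q M.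
      bcoef g M j \<beta> * (coeff (P i) \<alpha> * moment j i (\<alpha> + \<beta>)))"
    unfolding case_prod_beta by (rule sum.swap)
  also have "\<dots> = (\<Sum>(i, \<alpha>)\<in>index_set p N. coeff (P i) \<alpha> * gquot (node (i, \<alpha>)) *
            (\<Sum>(j, \<beta>)\<in>index_set q M. bcoef g M j \<beta> * wfrac j \<beta> (node (i, \<alpha>))))"
    unfolding sum_distrib_left
    by (intro sum.cong refl) (auto simp: index_set_def moment_eq node_def intro!: sum.cong)
  also have "\<dots> = (\<Sum>(i, \<alpha>)\<in>index_set p N. coeff (P i) \<alpha> * gquot (node (i, \<alpha>)) *
            (poly g (node (i, \<alpha>)) / bden M (node (i, \<alpha>))))"
  proof (rule sum.cong[OF refl])
    fix s assume "s \<in> index_set p N"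
    then obtain i \<alpha> where s: "s = (i, \<alpha>)" and i: "i \<in> {1..p}"
      by (auto simp: index_set_def)
    show "(case s of (i, \<alpha>) \<Rightarrow> coeff (P i) \<alpha> * gquot (node (i, \<alpha>)) *
        (\<Sum>(j, \<beta>)\<in>index_set q M. bcoef g M j \<beta> * wfrac j \<beta> (node (i, \<alpha>)))) =
      (case s of (i, \<alpha>) \<Rightarrow> coeff (P i) \<alpha> * gquot (node (i, \<alpha>)) *
            (poly g (node (i, \<alpha>)) / bden M (node (i, \<alpha>))))"
      using bcoef_expansion[OF assms kappa_b'[OF i, of _ \<alpha>]] by (simp add: s sum_index_set node_def)
  qed
  finally show ?thesis .
qed

lemma pair_eq_0:
  assumes "\<And>j l. \<lbrakk>j \<in> {1..q}; l < M j\<rbrakk> \<Longrightarrow> mom N P j l = 0"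
  shows "pair N g M P = 0"
  using assms by (simp add: pair_def)

text \<open>To isolate one coefficient, \<open>g\<close> gets a root at every node except
  \<open>t\<close>. Its degree is below the number of nodes, which
  \<open>vsum p N \<le> vsum q M\<close> keeps within the reach of \<open>pair_eval\<close>.\<close>

lemma coeff_eq_0_if_mom_eq_0:
  assumes M: "balanced M" and le: "vsum p N \<le> vsum q M"
    and mom: "\<And>j l. \<lbrakk>j \<in> {1..q}; l < M j\<rbrakk> \<Longrightarrow> mom N P j l = 0"
    and i: "i \<in> {1..p}" "k < N i"
  shows "coeff (P i) k = 0"
proof -
  define t where "t = (i, k)"
  have t: "t \<in> index_set p N" using i by (simp add: t_def index_set_def)
  define g where "g = (\<Prod>s\<in>index_set p N - {t}. [:- node s, 1:])"
  have "degree g \<le> card (index_set p N - {t})"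
    unfolding g_def by (rule degree_prod_linear_le) simp
  also have "\<dots> < card (index_set p N)"
    using t by (intro psubset_card_mono) auto
  finally have deg: "degree g < vsum q M" using le by (simp add: card_index_set)
  have g0: "poly g (node s) = 0" if "s \<in> index_set p N" "s \<noteq> t" for s
    unfolding g_def poly_prod using that by (intro prod_zero) auto
  have "poly g (node t) \<noteq> 0"
    using inj_on_node[of N] t by (auto simp: g_def poly_prod prod_zero_iff inj_on_def)
  moreover have "(\<Sum>(i, \<alpha>)\<in>index_set p N. coeff (P i) \<alpha> * gquot (node (i, \<alpha>)) *
            (poly g (node (i, \<alpha>)) / bden M (node (i, \<alpha>)))) = 0"
    using pair_eval[OF deg M, of N P] pair_eq_0[OF mom, where g = g] by simp
  then have "coeff (P i) k * gquot (node t) * (poly g (node t) / bden M (node t)) = 0"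
  proof (subst (asm) sum_unique_nonzero[OF _ t])
    fix s assume "s \<in> index_set p N" "s \<noteq> t"
    then show "(case s of (i, \<alpha>) \<Rightarrow> coeff (P i) \<alpha> * gquot (node (i, \<alpha>)) *
            (poly g (node (i, \<alpha>)) / bden M (node (i, \<alpha>)))) = 0"
      using g0[of s] by (cases s) simp
  qed (simp_all add: t_def)
  ultimately show ?thesis
    using gquot_neq_0[OF i(1), of k] bden_neq_0[OF i(1), of M k] by (simp add: node_def t_def)
qed

end

subsection \<open>The vectors A\<close>

lemma prod_index_set_remove:
  assumes "(i, k) \<in> index_set d N"
  shows "(\<Prod>(i', k')\<in>index_set d N - {(i, k)}. f i' k')
    = (\<Prod>k'\<in>{..<N i} - {k}. f i k') * (\<Prod>i'\<in>{1..d} - {i}. \<Prod>k'<N i'. f i' k')"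
proof -
  have eq: "index_set d N - {(i, k)}
      = (\<Union>k'\<in>{..<N i} - {k}. {(i, k')}) \<union> (SIGMA i':{1..d} - {i}. {..<N i'})"
    using assms by (auto simp: index_set_def)
  have "(\<Prod>(i', k')\<in>index_set d N - {(i, k)}. f i' k')
     = (\<Prod>(i', k')\<in>(\<Union>k'\<in>{..<N i} - {k}. {(i, k')}). f i' k')
       * (\<Prod>(i', k')\<in>(SIGMA i':{1..d} - {i}. {..<N i'}). f i' k')"
    unfolding eq by (rule prod.union_disjoint) auto
  also have "(\<Prod>(i', k')\<in>(\<Union>k'\<in>{..<N i} - {k}. {(i, k')}). f i' k') = (\<Prod>k'\<in>{..<N i} - {k}. f i k')"
    by (subst prod.UNION_disjoint) auto
  finally show ?thesis
    by (simp add: prod.Sigma)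
qed

section \<open>Pochhammer symbols and products of integer differences\<close>

lemma pochhammer_neg_of_nat:
  "k \<le> n \<Longrightarrow> pochhammer (- of_nat n :: complex) k = (-1) ^ k * fact n / fact (n - k)"
proof (induction k)
  case (Suc k)
  then have "n - k = Suc (n - Suc k)" by simp
  moreover define c where "c = (of_nat n - of_nat k :: complex)"
  ultimately have fact: "fact (n - k) = c * fact (n - Suc k)"
    using Suc.prems by (simp add: of_nat_diff)
  have neg: "- of_nat n + of_nat k = - c" and "c \<noteq> 0"
    using Suc.prems by (simp_all add: c_def)
  then show ?case
    using Suc unfolding pochhammer_Suc fact neg by simp
qed simp

lemma prod_of_nat_diff:
  assumes "k < n"
  shows "(\<Prod>k'\<in>{..<n} - {k}. of_nat k' - of_nat k :: complex) = (-1) ^ k * fact k * fact (n - 1 - k)"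
  using Suc_leI[OF assms]
proof (induction n rule: dec_induct)
  case base
  have "(\<Prod>k'\<in>{..<Suc k} - {k}. of_nat k' - of_nat k :: complex) = pochhammer (- of_nat k) k"
    by (simp add: pochhammer_prod_lessThan lessThan_Suc)
  then show ?case by (simp add: pochhammer_neg_of_nat)
next
  case (step n)
  have "{..<Suc n} - {k} = insert n ({..<n} - {k})" using step.hyps by auto
  moreover have "n - k = Suc (n - 1 - k)" using step.hyps by simp
  then have "fact (n - k) = (of_nat n - of_nat k) * (fact (n - 1 - k) :: complex)"
    using step.hyps by (simp add: of_nat_diff)
  ultimately show ?case using step.IH by simp
qed

lemma prod_of_nat_diff':
  assumes "k < n"
  shows "(\<Prod>k'\<in>{..<n} - {k}. of_nat k - of_nat k' :: complex) = (-1) ^ (n - 1 - k) * fact k * fact (n - 1 - k)"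
proof -
  have "(\<Prod>k'\<in>{..<n} - {k}. of_nat k - of_nat k' :: complex) = (\<Prod>k'\<in>{..<n} - {k}. - 1 * (of_nat k' - of_nat k))"
    by simp
  also have "\<dots> = (-1) ^ (n - 1) * ((-1) ^ k * fact k * fact (n - 1 - k))"
    unfolding prod.distrib prod_of_nat_diff[OF assms] using assms by (simp add: card_Diff_singleton)
  also have "n - 1 = n - 1 - k + k" using assms by simp
  finally show ?thesis by (simp only: power_add) (simp add: power2_eq_square[symmetric] flip: power_mult_distrib)
qed

lemma prod_diff_of_nat: "(\<Prod>k<n. x - of_nat k) = pochhammer (x - of_nat n + 1 :: complex) n"
proof -
  have "(\<Prod>k<n. x - of_nat k) = (\<Prod>k<n. x - of_nat (n - Suc k))"
    by (rule prod.nat_diff_reindex[symmetric])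
  also have "\<dots> = (\<Prod>k<n. x - of_nat n + 1 + of_nat k)"
    by (intro prod.cong) (auto simp: of_nat_diff Suc_le_eq algebra_simps)
  finally show ?thesis by (simp add: pochhammer_prod_lessThan)
qed

text \<open>Turns the integer-index symbols of the block into quotients of ordinary ones, uniformly
  in the sign of the index; the assumption on \<open>x\<close> keeps all denominators
  nonzero.\<close>

lemma ipoch_add_diff:
  assumes "x \<notin> \<int>\<^sub>\<le>\<^sub>0"
  shows "ipoch (x + of_nat k) (int n - int k) = pochhammer x n / pochhammer x k"
proof (cases "k \<le> n")
  case True
  then have "pochhammer x n = pochhammer x k * pochhammer (x + of_nat k) (n - k)"
    by (rule pochhammer_product)
  then show ?thesis
    using True pochhammer_neq_0[OF assms, of k] by (simp add: ipoch_def nat_diff_distrib')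
next
  case False
  then have "pochhammer x k = pochhammer x n * pochhammer (x + of_nat n) (k - n)"
    by (intro pochhammer_product) simp
  then show ?thesis
    using False pochhammer_neq_0[OF assms, of n] by (simp add: ipoch_def nat_diff_distrib')
qed

context hypergeometric_weights
begin

text \<open>The product of the differences between the node \<open>(i, \<alpha>)\<close> and all
  nodes of the other components.\<close>

definition kprod :: "(nat \<Rightarrow> nat) \<Rightarrow> nat \<Rightarrow> nat \<Rightarrow> complex" where
  "kprod lam i \<alpha> = (\<Prod>l\<in>{1..p} - {i}. pochhammer (\<kappa> i - \<kappa> l - of_nat (lam l) + of_nat \<alpha> + 1) (lam l))"

lemma prod_node_diff:
  assumes "(i, \<alpha>) \<in> index_set p N"
  shows "(\<Prod>s\<in>index_set p N - {(i, \<alpha>)}. node (i, \<alpha>) - node s)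
     = (-1) ^ (N i - 1 - \<alpha>) * fact \<alpha> * fact (N i - 1 - \<alpha>) * kprod N i \<alpha>"
proof -
  have "(\<Prod>s\<in>index_set p N - {(i, \<alpha>)}. node (i, \<alpha>) - node s)
     = (\<Prod>(i', k)\<in>index_set p N - {(i, \<alpha>)}. node (i, \<alpha>) - node (i', k))"
    by (intro prod.cong) auto
  also have "\<dots> = (\<Prod>k\<in>{..<N i} - {\<alpha>}. of_nat \<alpha> - of_nat k)
       * (\<Prod>l\<in>{1..p} - {i}. \<Prod>k<N l. (\<kappa> i + of_nat \<alpha> - \<kappa> l) - of_nat k)"
    unfolding prod_index_set_remove[OF assms]
    by (intro arg_cong2[of _ _ _ _ "(*)"] prod.cong) (simp_all add: node_def)
  also have "\<dots> = (-1) ^ (N i - 1 - \<alpha>) * fact \<alpha> * fact (N i - 1 - \<alpha>) * kprod N i \<alpha>"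
    using assms unfolding prod_diff_of_nat kprod_def
    by (subst prod_of_nat_diff') (auto simp: index_set_def algebra_simps)
  finally show ?thesis .
qed

lemma prod_pole_diff:
  assumes "(H, K) \<in> index_set q M"
  shows "(\<Prod>s\<in>index_set q M - {(H, K)}. pole (H, K) - pole s)
     = (-1) ^ K * fact K * fact (M H - 1 - K) *
       (\<Prod>h\<in>{1..q} - {H}. pochhammer (b h - (b H + of_nat K)) (M h))"
proof -
  have "(\<Prod>s\<in>index_set q M - {(H, K)}. pole (H, K) - pole s)
     = (\<Prod>(h, k)\<in>index_set q M - {(H, K)}. pole (H, K) - pole (h, k))"
    by (intro prod.cong) auto
  also have "\<dots> = (\<Prod>k\<in>{..<M H} - {K}. of_nat k - of_nat K)
       * (\<Prod>h\<in>{1..q} - {H}. \<Prod>k<M h. b h - (b H + of_nat K) + of_nat k)"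
    unfolding prod_index_set_remove[OF assms]
    by (intro arg_cong2[of _ _ _ _ "(*)"] prod.cong) (simp_all add: pole_def)
  also have "\<dots> = (-1) ^ K * fact K * fact (M H - 1 - K) *
       (\<Prod>h\<in>{1..q} - {H}. pochhammer (b h - (b H + of_nat K)) (M h))"
    using assms by (subst prod_of_nat_diff) (auto simp: index_set_def pochhammer_prod_lessThan)
  finally show ?thesis .
qed

abbreviation A :: "(nat \<Rightarrow> nat) \<Rightarrow> (nat \<Rightarrow> nat) \<Rightarrow> pvec" where
  "A \<equiv> A_vec p q r a b \<kappa>"

text \<open>The Gamma quotient in \<open>A_const\<close> cancels \<open>gquot (\<kappa> i)\<close>,
  and the identity \<open>(y)_m (y+m)_\<alpha> = (y)_\<alpha> (y+\<alpha>)_m\<close> moves all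
  Pochhammer symbols from the base point \<open>\<kappa> i\<close> to the node
  \<open>\<kappa> i + \<alpha>\<close>.\<close>

lemma A_coeff:
  assumes i: "i \<in> {1..p}" and \<alpha>: "\<alpha> < lam i"
  shows "coeff (A lam eta i) \<alpha> * gquot (\<kappa> i + of_nat \<alpha>)
    = A_norm p q r a b \<kappa> lam eta * (-1) ^ (vsum p lam + (lam i - 1) + \<alpha>) * bden eta (\<kappa> i + of_nat \<alpha>) /
      (fact \<alpha> * fact (lam i - 1 - \<alpha>) * kprod lam i \<alpha>)"
proof -
  define n where "n = lam i"
  define pa where "pa = (\<Prod>\<rho>=1..r. pochhammer (\<kappa> i + a \<rho> + 1) \<alpha>)"
  define pb where "pb = (\<Prod>h=1..q. pochhammer (\<kappa> i + b h + 1) \<alpha>)"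
  define pe where "pe = (\<Prod>h=1..q. pochhammer (\<kappa> i + b h + of_nat (eta h) + 1) \<alpha>)"
  define k1 where "k1 = (\<Prod>l\<in>{1..p} - {i}. pochhammer (\<kappa> i - \<kappa> l - of_nat (lam l) + 1) \<alpha>)"
  define k2 where "k2 = (\<Prod>l\<in>{1..p} - {i}. pochhammer (\<kappa> i - \<kappa> l + 1) \<alpha>)"
  have pa0: "pa \<noteq> 0" and pb0: "pb \<noteq> 0"
    using pochhammer_neq_0[OF kappa_a[OF i]] pochhammer_neq_0[OF kappa_b[OF i]]
    by (simp_all add: pa_def pb_def prod_zero_iff)
  \<comment> \<open>The shift \<open>c\<close> is an integer because it will be
    \<open>1 - lam l\<close>, which may be negative.\<close>
  have k_nz: "pochhammer (\<kappa> i - \<kappa> l + of_int c) m \<noteq> 0" if l: "l \<in> {1..p} - {i}" for l c m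
  proof (rule pochhammer_neq_0)
    have "\<kappa> i - \<kappa> l \<notin> \<int>" using kappa_diff_notin_Ints[OF i, of l] l by auto
    moreover have "\<kappa> i - \<kappa> l = (\<kappa> i - \<kappa> l + of_int c) - of_int c" by simp
    ultimately show "\<kappa> i - \<kappa> l + of_int c \<notin> \<int>\<^sub>\<le>\<^sub>0"
      by (metis Ints_diff Ints_of_int nonpos_Ints_Int)
  qed
  have k10: "k1 \<noteq> 0"
    using k_nz[of _ "1 - int (lam _)" \<alpha>] by (auto simp: k1_def prod_zero_iff algebra_simps)
  have kp: "k1 * kprod lam i \<alpha> = kprod lam i 0 * k2"
    unfolding k1_def k2_def kprod_def prod.distrib[symmetric]
  proof (rule prod.cong[OF refl])
    fix l
    define y where "y = \<kappa> i - \<kappa> l - of_nat (lam l) + 1"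
    have "pochhammer y \<alpha> * pochhammer (y + of_nat \<alpha>) (lam l) = pochhammer y (lam l) * pochhammer (y + of_nat (lam l)) \<alpha>"
      by (simp add: pochhammer_product'[symmetric] add.commute)
    then show "pochhammer (\<kappa> i - \<kappa> l - of_nat (lam l) + 1) \<alpha> * pochhammer (\<kappa> i - \<kappa> l - of_nat (lam l) + of_nat \<alpha> + 1) (lam l)
      = pochhammer (\<kappa> i - \<kappa> l - of_nat (lam l) + of_nat 0 + 1) (lam l) * pochhammer (\<kappa> i - \<kappa> l + 1) \<alpha>"
      by (simp add: y_def algebra_simps)
  qed
  have be: "bden eta (\<kappa> i) * pe = bden eta (\<kappa> i + of_nat \<alpha>) * pb"
    unfolding bden_def pe_def pb_def prod.distrib[symmetric]
  proof (rule prod.cong[OF refl])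
    fix h
    define y where "y = \<kappa> i + b h + 1"
    have "pochhammer y (eta h) * pochhammer (y + of_nat (eta h)) \<alpha> = pochhammer (y + of_nat \<alpha>) (eta h) * pochhammer y \<alpha>"
      by (simp add: pochhammer_product'[symmetric] add.commute mult.commute)
    then show "pochhammer (\<kappa> i + b h + 1) (eta h) * pochhammer (\<kappa> i + b h + of_nat (eta h) + 1) \<alpha>
      = pochhammer (\<kappa> i + of_nat \<alpha> + b h + 1) (eta h) * pochhammer (\<kappa> i + b h + 1) \<alpha>"
      by (simp add: y_def algebra_simps)
  qed
  have g: "gquot (\<kappa> i + of_nat \<alpha>) = gquot (\<kappa> i) * pa / pb"
  proof -
    have G: "Gamma (y + of_nat \<alpha>) = Gamma y * pochhammer y \<alpha>" if "y \<notin> \<int>\<^sub>\<le>\<^sub>0" for y :: complex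
      using pochhammer_Gamma[OF that] that by (simp add: Gamma_eq_zero_iff)
    have "(\<Prod>\<rho>=1..r. Gamma (\<kappa> i + of_nat \<alpha> + a \<rho> + 1)) = (\<Prod>\<rho>=1..r. Gamma (\<kappa> i + a \<rho> + 1)) * pa"
      unfolding pa_def prod.distrib[symmetric] using G[OF kappa_a[OF i]]
      by (intro prod.cong) (simp_all add: algebra_simps)
    moreover have "(\<Prod>h=1..q. Gamma (\<kappa> i + of_nat \<alpha> + b h + 1)) = (\<Prod>h=1..q. Gamma (\<kappa> i + b h + 1)) * pb"
      unfolding pb_def prod.distrib[symmetric] using G[OF kappa_b[OF i]]
      by (intro prod.cong) (simp_all add: algebra_simps)
    ultimately show ?thesis by (simp add: gquot_def)
  qed
  have g0: "gquot (\<kappa> i) \<noteq> 0" using gquot_neq_0[OF i, of 0] by simp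
  have n1: "pochhammer (1 - of_nat n :: complex) \<alpha> = (-1) ^ \<alpha> * fact (n - 1) / fact (n - 1 - \<alpha>)"
    using pochhammer_neg_of_nat[of \<alpha> "n - 1"] \<alpha> by (simp add: n_def of_nat_diff)
  have const: "A_const p q r a b \<kappa> lam eta i = (-1) ^ vsum p lam * (1 / gquot (\<kappa> i)) *
      (bden eta (\<kappa> i) / ((-1) ^ (n - 1) * fact (n - 1) * kprod lam i 0))"
    by (simp add: A_const_def gquot_def bden_def kprod_def n_def)
  have "coeff (A lam eta i) \<alpha> = A_norm p q r a b \<kappa> lam eta * A_const p q r a b \<kappa> lam eta i *
      (pochhammer (1 - of_nat n) \<alpha> * pe * k1 / (pa * k2) / fact \<alpha>)"
    using i \<alpha> by (auto simp: A_vec_def coeff_sum n_def pe_def k1_def k2_def pa_def sum.delta)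
  then have "coeff (A lam eta i) \<alpha> * gquot (\<kappa> i + of_nat \<alpha>)
    = A_norm p q r a b \<kappa> lam eta * ((-1) ^ vsum p lam / (-1) ^ (n - 1) * (-1) ^ \<alpha>)
      * (bden eta (\<kappa> i) * pe / pb) * (k1 / (kprod lam i 0 * k2)) / (fact \<alpha> * fact (n - 1 - \<alpha>))"
    unfolding const n1 g using g0 pa0 by (simp add: mult_ac)
  also have "bden eta (\<kappa> i) * pe / pb = bden eta (\<kappa> i + of_nat \<alpha>)"
    using be pb0 by simp
  also have "k1 / (kprod lam i 0 * k2) = 1 / kprod lam i \<alpha>"
    using kp[symmetric] k10 by simp
  also have "(-1) ^ vsum p lam / (-1) ^ (n - 1) * (-1) ^ \<alpha> = (-1 :: complex) ^ (vsum p lam + (n - 1) + \<alpha>)"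
    by (simp add: power_add minus_one_power_iff)
  finally show ?thesis by (simp add: n_def)
qed

lemma coeff_A_eq_0: "k \<ge> lam i \<Longrightarrow> coeff (A lam eta i) k = 0"
  by (auto simp: A_vec_def coeff_sum intro!: sum.neutral)

section \<open>Moments and orthogonality of the vectors A\<close>

lemma mom_A:
  assumes "\<And>i. i \<in> {1..p} \<Longrightarrow> lam i \<le> N i"
  shows "mom N (A lam eta) j l = (\<Sum>i=1..p. \<Sum>\<alpha><lam i. coeff (A lam eta i) \<alpha> * moment j i (\<alpha> + l))"
  unfolding mom_def using assms
  by (intro sum.cong refl sum.mono_neutral_right) (auto simp: coeff_A_eq_0)

text \<open>Shifting coefficients up by one raises the order of each moment by one; the strict bound
  makes room for the new leading coefficient.\<close>

lemma mom_mult_z_A: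
  assumes "\<And>i. i \<in> {1..p} \<Longrightarrow> lam i < N i"
  shows "mom N (mult_z (A lam eta)) j l = (\<Sum>i=1..p. \<Sum>\<alpha><lam i. coeff (A lam eta i) \<alpha> * moment j i (\<alpha> + Suc l))"
  unfolding mom_def
proof (rule sum.cong[OF refl])
  fix i assume i: "i \<in> {1..p}"
  then obtain N' where N': "N i = Suc N'" "lam i \<le> N'"
    using assms[OF i] by (cases "N i") auto
  have "(\<Sum>\<alpha><N i. coeff (mult_z (A lam eta) i) \<alpha> * moment j i (\<alpha> + l))
      = (\<Sum>\<alpha><N'. coeff (A lam eta i) \<alpha> * moment j i (\<alpha> + Suc l))"
    unfolding N' by (simp add: mult_z_def sum.lessThan_Suc_shift coeff_monom_mult del: sum.lessThan_Suc)
  also have "\<dots> = (\<Sum>\<alpha><lam i. coeff (A lam eta i) \<alpha> * moment j i (\<alpha> + Suc l))"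
    using N' by (intro sum.mono_neutral_right) (auto simp: coeff_A_eq_0)
  finally show "(\<Sum>\<alpha><N i. coeff (mult_z (A lam eta) i) \<alpha> * moment j i (\<alpha> + l)) = \<dots>" .
qed

text \<open>The lone linear factor is absorbed into the symbol of index \<open>j\<close>, so that
  divisibility of \<open>bden\<close> by the denominator can be checked component by
  component.\<close>

lemma wfrac_eq:
  assumes "j \<in> {1..q}"
  shows "wfrac j l x = (\<Prod>\<rho>=1..r. pochhammer (x + a \<rho> + 1) l) /
     (\<Prod>h=1..q. pochhammer (x + b h + 1) (l + unit_vec j h))"
proof -
  have "(\<Prod>h=1..q. pochhammer (x + b h + 1) (l + unit_vec j h))
     = (\<Prod>h=1..q. pochhammer (x + b h + 1) l * (if h = j then x + b j + of_nat l + 1 else 1))"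
    by (intro prod.cong) (auto simp: unit_vec_def pochhammer_Suc)
  also have "\<dots> = (\<Prod>h=1..q. pochhammer (x + b h + 1) l) * (x + b j + of_nat l + 1)"
    using assms by (simp add: prod.distrib prod.delta)
  finally show ?thesis by (simp add: wfrac_def)
qed

text \<open>Up to a constant, \<open>coeff (A lam eta i) \<alpha>\<close> times the node factor of the moments is
  \<open>bden eta\<close> divided by the product of the differences to the other nodes, and
  \<open>bden eta x * wfrac j l x\<close> is a polynomial of degree less than \<open>vsum q eta\<close>, because \<open>eta\<close> is
  near the diagonal.\<close>
lemma mom_A_eq_0:
  assumes eta: "\<And>h. h \<in> {1..q} \<Longrightarrow> eta j \<le> eta h + 1" and j: "j \<in> {1..q}" and l: "l < eta j"
    and card: "vsum q eta < vsum p lam" and N: "\<And>i. i \<in> {1..p} \<Longrightarrow> lam i \<le> N i"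
  shows "mom N (A lam eta) j l = 0"
proof -
  define e where "e = (\<lambda>h. l + unit_vec j h)"
  have e: "e h \<le> eta h" if "h \<in> {1..q}" for h
    using eta[OF that] l by (auto simp: e_def unit_vec_def)
  define ga where "ga = (\<Prod>(\<rho>, k)\<in>index_set r (\<lambda>_. l). [:a \<rho> + 1 + of_nat k, 1:])"
  define gb where "gb = (\<Prod>(h, k)\<in>index_set q (\<lambda>h. eta h - e h). [:b h + 1 + of_nat (e h) + of_nat k, 1:])"
  have "degree ga \<le> r * l"
    using degree_prod_linear_le[OF finite_index_set, of "\<lambda>(\<rho>, k). a \<rho> + 1 + of_nat k" r "\<lambda>_. l"]
    by (simp add: ga_def case_prod_beta card_index_set vsum_def)
  moreover have "degree gb \<le> vsum q (\<lambda>h. eta h - e h)"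
    using degree_prod_linear_le[OF finite_index_set, of "\<lambda>(h, k). b h + 1 + of_nat (e h) + of_nat k" q "\<lambda>h. eta h - e h"]
    by (simp add: gb_def case_prod_beta card_index_set)
  moreover have "vsum q (\<lambda>h. eta h - e h) + (q * l + 1) = vsum q eta"
  proof -
    have "(\<Sum>h=1..q. e h) = q * l + 1"
      using j by (simp add: e_def sum.distrib unit_vec_def)
    moreover have "(\<Sum>h=1..q. eta h - e h) + (\<Sum>h=1..q. e h) = (\<Sum>h=1..q. eta h)"
      using e by (simp add: sum.distrib[symmetric])
    ultimately show ?thesis by (simp add: vsum_def)
  qed
  \<comment> \<open>At most \<open>r * l\<close> factors are gained from \<open>ga\<close> while
    \<open>q * l + 1\<close> are removed from \<open>bden eta\<close>, so the degree is at most
    \<open>vsum q eta - 1\<close>. With more than \<open>vsum q eta\<close> nodes the sum in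
    question vanishes.\<close>
  moreover have "r * l \<le> q * l" using r_less_q by simp
  ultimately have deg: "degree (ga * gb) + 1 < card (index_set p lam)"
    using degree_mult_le[of ga gb] card unfolding card_index_set by linarith
  have bw: "bden eta x * wfrac j l x = poly (ga * gb) x"
    if x: "\<And>h. h \<in> {1..q} \<Longrightarrow> x + b h + 1 \<notin> \<int>\<^sub>\<le>\<^sub>0" for x
  proof -
    have "poly ga x = (\<Prod>(\<rho>, k)\<in>index_set r (\<lambda>_. l). x + a \<rho> + 1 + of_nat k)"
      unfolding ga_def poly_prod by (intro prod.cong) (auto simp: algebra_simps)
    then have "poly ga x = (\<Prod>\<rho>=1..r. pochhammer (x + a \<rho> + 1) l)"
      by (simp add: prod_index_set pochhammer_prod_lessThan)
    moreover have "poly gb x = (\<Prod>(h, k)\<in>index_set q (\<lambda>h. eta h - e h). x + b h + 1 + of_nat (e h) + of_nat k)"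
      unfolding gb_def poly_prod by (intro prod.cong) (auto simp: algebra_simps)
    then have "poly gb x = (\<Prod>h=1..q. pochhammer (x + b h + 1 + of_nat (e h)) (eta h - e h))"
      by (simp add: prod_index_set pochhammer_prod_lessThan)
    moreover have "bden eta x = (\<Prod>h=1..q. pochhammer (x + b h + 1) (e h)) *
        (\<Prod>h=1..q. pochhammer (x + b h + 1 + of_nat (e h)) (eta h - e h))"
      unfolding bden_def prod.distrib[symmetric] using e by (intro prod.cong refl pochhammer_product)
    moreover have "(\<Prod>h=1..q. pochhammer (x + b h + 1) (e h)) \<noteq> 0"
      using pochhammer_neq_0[OF x] by (simp add: prod_zero_iff)
    moreover have "wfrac j l x = (\<Prod>\<rho>=1..r. pochhammer (x + a \<rho> + 1) l) / (\<Prod>h=1..q. pochhammer (x + b h + 1) (e h))"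
      by (simp add: wfrac_eq[OF j] e_def)
    ultimately show ?thesis
      by simp
  qed
  define C where "C = A_norm p q r a b \<kappa> lam eta * (-1) ^ vsum p lam"
  have "mom N (A lam eta) j l = (\<Sum>(i, \<alpha>)\<in>index_set p lam. coeff (A lam eta i) \<alpha> * moment j i (\<alpha> + l))"
    unfolding sum_index_set by (rule mom_A) (rule N)
  also have "\<dots> = (\<Sum>s\<in>index_set p lam. C * (poly (ga * gb) (node s) / (\<Prod>s'\<in>index_set p lam - {s}. node s - node s')))"
  proof (rule sum.cong[OF refl])
    fix s assume s: "s \<in> index_set p lam"
    then obtain i \<alpha> where s_eq: "s = (i, \<alpha>)" and i: "i \<in> {1..p}" and \<alpha>: "\<alpha> < lam i"
      by (auto simp: index_set_def)
    have "(-1 :: complex) ^ (vsum p lam + (lam i - 1) + \<alpha>) = (-1) ^ vsum p lam * (-1) ^ (lam i - 1 - \<alpha>)"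
      using \<alpha> by (simp add: power_add minus_one_power_iff)
    then have "coeff (A lam eta i) \<alpha> * gquot (\<kappa> i + of_nat \<alpha>)
       = C * (bden eta (\<kappa> i + of_nat \<alpha>) / (\<Prod>s'\<in>index_set p lam - {s}. node s - node s'))"
      unfolding A_coeff[where lam = lam, OF i \<alpha>] s_eq prod_node_diff[OF s[unfolded s_eq]]
      by (simp add: C_def minus_one_power_iff)
    then show "(case s of (i, \<alpha>) \<Rightarrow> coeff (A lam eta i) \<alpha> * moment j i (\<alpha> + l))
        = C * (poly (ga * gb) (node s) / (\<Prod>s'\<in>index_set p lam - {s}. node s - node s'))"
      using bw[OF kappa_b'[OF i, of _ \<alpha>]]
      by (simp add: moment_eq[OF i j] s_eq node_def mult.assoc[symmetric] del: poly_mult)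
  qed
  also have "\<dots> = 0"
    unfolding sum_distrib_left[symmetric]
    using sum_div_vandermonde_eq_0[OF finite_index_set inj_on_node deg] by simp
  finally show ?thesis .
qed

end

subsection \<open>The pairing block\<close>

lemma minus_one_powi_diff: "(-1 :: complex) powi (int m - int n) = (-1) ^ (m + n)"
proof -
  have "(-1 :: complex) powi (int m - int n) = (-1) ^ m / (-1) ^ n"
    by (simp add: power_int_diff)
  then show ?thesis by (simp add: power_add minus_one_power_iff)
qed

context hypergeometric_weights
begin

text \<open>The test vector \<open>B\<close> with row index \<open>mu\<close> and column index \<open>nu\<close> is, up to a scalar, the
  one with numerator \<open>npoly nu\<close>.\<close>
definition npoly :: "(nat \<Rightarrow> nat) \<Rightarrow> complex poly" where
  "npoly nu = (\<Prod>s\<in>index_set p nu. [:- node s, 1:])"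

lemma degree_npoly: "degree (npoly nu) \<le> vsum p nu"
  using degree_prod_linear_le[of "index_set p nu" "\<lambda>s. - node s"]
  by (simp add: npoly_def card_index_set)

lemma poly_npoly_node_eq_0: "s \<in> index_set p nu \<Longrightarrow> poly (npoly nu) (node s) = 0"
  unfolding npoly_def poly_prod by (intro prod_zero) auto

lemma poly_npoly_pole:
  "poly (npoly nu) (pole (H, K)) = (-1) ^ vsum p nu * (\<Prod>l=1..p. pochhammer (\<kappa> l + b H + of_nat K + 1) (nu l))"
proof -
  have "poly (npoly nu) (pole (H, K)) = (\<Prod>(l, k)\<in>index_set p nu. (-1) * (\<kappa> l + b H + of_nat K + 1 + of_nat k))"
    unfolding npoly_def poly_prod by (intro prod.cong) (auto simp: pole_def node_def algebra_simps)
  also have "\<dots> = (-1) ^ vsum p nu * (\<Prod>(l, k)\<in>index_set p nu. \<kappa> l + b H + of_nat K + 1 + of_nat k)"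
    unfolding case_prod_beta prod.distrib by (simp add: card_index_set)
  finally show ?thesis by (simp add: prod_index_set pochhammer_prod_lessThan)
qed

text \<open>The part of \<open>block_norm\<close> that depends on \<open>mu\<close> alone; the rest
  of it is \<open>- A_norm\<close>.\<close>

definition brest :: "(nat \<Rightarrow> nat) \<Rightarrow> complex" where
  "brest mu = (let jp = jmax q mu; Kp = vmax q mu - 1 in
     (\<Prod>\<rho>=1..r. pochhammer (a \<rho> - (b jp + of_nat Kp)) Kp) *
     (\<Prod>h\<in>{h\<in>{1..q}. h \<noteq> jp \<and> mu h = vmax q mu}. b h - b jp))"

text \<open>The denominator normalizes the quotient over \<open>nu\<close> in the block terms; the
  sign cancels the one in \<open>poly_npoly_pole\<close>.\<close>

definition bfac :: "(nat \<Rightarrow> nat) \<Rightarrow> (nat \<Rightarrow> nat) \<Rightarrow> complex" where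
  "bfac nu mu = (-1) ^ vsum p nu / (\<Prod>l=1..p. pochhammer (\<kappa> l + b (jmax q mu) + of_nat (vmax q mu - 1) + 1) (nu l))"

text \<open>Unlike in the orthogonality relations, \<open>l\<close> is not bounded by
  \<open>eta\<close>, so the quotient need not be a polynomial and negative indices can
  occur.\<close>

lemma bden_mult_wfrac:
  assumes i: "i \<in> {1..p}" and j: "j \<in> {1..q}"
  shows "bden eta (\<kappa> i + of_nat \<alpha>) * wfrac j l (\<kappa> i + of_nat \<alpha>)
    = (\<Prod>\<rho>=1..r. pochhammer (\<kappa> i + a \<rho> + of_nat \<alpha> + 1) l) *
      (\<Prod>h=1..q. ipoch (\<kappa> i + b h + of_nat (l + \<alpha> + 1) + of_nat (unit_vec j h)) (int (eta h) - int l - int (unit_vec j h)))"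
proof -
  have "(\<Prod>h=1..q. ipoch (\<kappa> i + b h + of_nat (l + \<alpha> + 1) + of_nat (unit_vec j h)) (int (eta h) - int l - int (unit_vec j h)))
    = (\<Prod>h=1..q. pochhammer (\<kappa> i + of_nat \<alpha> + b h + 1) (eta h) / pochhammer (\<kappa> i + of_nat \<alpha> + b h + 1) (l + unit_vec j h))"
  proof (rule prod.cong[OF refl])
    fix h assume "h \<in> {1..q}"
    from ipoch_add_diff[OF kappa_b'[OF i this, of \<alpha>], of "l + unit_vec j h" "eta h"]
    show "ipoch (\<kappa> i + b h + of_nat (l + \<alpha> + 1) + of_nat (unit_vec j h)) (int (eta h) - int l - int (unit_vec j h))
      = pochhammer (\<kappa> i + of_nat \<alpha> + b h + 1) (eta h) / pochhammer (\<kappa> i + of_nat \<alpha> + b h + 1) (l + unit_vec j h)"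
      by (simp add: algebra_simps)
  qed
  then show ?thesis
    by (simp add: bden_def wfrac_eq[OF j] prod_dividef add_ac)
qed

lemma b_notin_nonpos_Ints:
  assumes "h \<in> {1..q}" "H \<in> {1..q}" "h \<noteq> H"
  shows "b h - (b H + of_nat K) \<notin> \<int>\<^sub>\<le>\<^sub>0"
proof
  assume "b h - (b H + of_nat K) \<in> \<int>\<^sub>\<le>\<^sub>0"
  then have "b h - (b H + of_nat K) + of_nat K \<in> \<int>"
    by (intro Ints_add) auto
  then show False using b_diff_notin_Ints[OF assms] by simp
qed

lemma pcoef_npoly:
  assumes H: "H \<in> {1..q}" and K: "K < mu H"
  shows "bfac nu mu * pcoef (npoly nu) mu H K =
    (\<Prod>l=1..p. pochhammer (\<kappa> l + b H + of_nat K + 1) (nu l)) /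
    (\<Prod>l=1..p. pochhammer (\<kappa> l + b (jmax q mu) + of_nat (vmax q mu - 1) + 1) (nu l)) *
    ((-1) ^ K / (fact K * fact (mu H - 1 - K) * (\<Prod>h\<in>{1..q} - {H}. pochhammer (b h - (b H + of_nat K)) (mu h))))"
proof -
  have "(H, K) \<in> index_set q mu" using assms by (simp add: index_set_def)
  then have "pcoef (npoly nu) mu H K = (-1) ^ vsum p nu * (\<Prod>l=1..p. pochhammer (\<kappa> l + b H + of_nat K + 1) (nu l)) /
     ((-1) ^ K * fact K * fact (mu H - 1 - K) * (\<Prod>h\<in>{1..q} - {H}. pochhammer (b h - (b H + of_nat K)) (mu h)))"
    by (simp add: pcoef_def poly_npoly_pole prod_pole_diff)
  then show ?thesis
    by (simp add: bfac_def minus_one_power_iff)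
qed

text \<open>Separates a block term into a factor of \<open>A\<close> and a factor of the test
  vector. The two nonzero cases are the ranges left by \<open>ecoef_eq_0\<close>: the symbol of
  \<open>- K\<close> in \<open>ecoef\<close> supplies \<open>fact K / fact (K - \<beta>)\<close> or
  \<open>fact K / fact (K - 1 - \<beta>)\<close>, and its \<open>fact K\<close> cancels against
  \<open>pcoef\<close>.\<close>

lemma block_term_eq:
  assumes i: "i \<in> {1..p}" and j: "j \<in> {1..q}" and H: "H \<in> {1..q}"
    and \<alpha>: "\<alpha> < lam i" and K: "K < mu H" and \<beta>: "\<beta> < mu j"
    and a: "\<And>\<rho> d. \<lbrakk>\<rho> \<in> {1..r}; d \<le> K\<rbrakk> \<Longrightarrow> a \<rho> - (b H + of_nat K) + of_nat d \<noteq> 0"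
  shows "block_term p q r a b \<kappa> lam eta d nu mu i j H K \<alpha> \<beta> =
     (-1) ^ (vsum p lam + lam i + \<alpha>) / (fact \<alpha> * fact (lam i - 1 - \<alpha>) * kprod lam i \<alpha>) *
     (bden eta (\<kappa> i + of_nat \<alpha>) * wfrac j (d + \<beta>) (\<kappa> i + of_nat \<alpha>)) *
     (bfac nu mu * pcoef (npoly nu) mu H K * ecoef j \<beta> H K)"
proof -
  define u where "u = b H + of_nat K"
  define kap where "kap = kprod lam i \<alpha>"
  define quot where "quot = (\<Prod>l=1..p. pochhammer (\<kappa> l + b H + of_nat K + 1) (nu l)) /
    (\<Prod>l=1..p. pochhammer (\<kappa> l + b (jmax q mu) + of_nat (vmax q mu - 1) + 1) (nu l))"
  define Pa where "Pa = (\<Prod>\<rho>=1..r. pochhammer (\<kappa> i + a \<rho> + of_nat \<alpha> + 1) (d + \<beta>))"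
  define Ip where "Ip = (\<Prod>h=1..q. ipoch (\<kappa> i + b h + of_nat (d + \<alpha> + \<beta> + 1) + of_nat (unit_vec j h))
       (int (eta h) - int (d + \<beta>) - int (unit_vec j h)))"
  define pmu where "pmu = (\<Prod>h\<in>{1..q} - {H}. pochhammer (b h - u) (mu h))"
  have w: "bden eta (\<kappa> i + of_nat \<alpha>) * wfrac j (d + \<beta>) (\<kappa> i + of_nat \<alpha>) = Pa * Ip"
    using bden_mult_wfrac[OF i j, of eta \<alpha> "d + \<beta>"] by (simp add: Pa_def Ip_def add_ac)
  have pc: "bfac nu mu * pcoef (npoly nu) mu H K = quot * ((-1) ^ K / (fact K * fact (mu H - 1 - K) * pmu))"
    using pcoef_npoly[where nu = nu and mu = mu, OF H K] by (simp add: quot_def pmu_def u_def)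
  have a': "a \<rho> - u + of_nat d \<noteq> 0" if "\<rho> \<in> {1..r}" "d \<le> K" for \<rho> d
    using a[OF that] by (simp add: u_def)
  consider "j = H" "\<beta> \<le> K" | "j = H" "\<beta> > K" | "j \<noteq> H" "\<beta> < K" | "j \<noteq> H" "\<beta> \<ge> K"
    by linarith
  then show ?thesis
  proof cases
    case 1
    define pb where "pb = (\<Prod>h\<in>{1..q} - {H}. pochhammer (b h - u) (Suc \<beta>))"
    define Ra where "Ra = (\<Prod>\<rho>=1..r. pochhammer (a \<rho> - u + of_nat \<beta> + 1) (K - \<beta>))"
    have ip: "(\<Prod>h\<in>{1..q} - {H}. ipoch (b h - u + of_nat (\<beta> + 1)) (int (mu h) - int (\<beta> + 1))) = pmu / pb"
      unfolding pmu_def pb_def prod_dividef[symmetric] Suc_eq_plus1 u_def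
      using H by (intro prod.cong refl ipoch_add_diff b_notin_nonpos_Ints) auto
    \<comment> \<open>For \<open>j = H\<close> the block arranges the symbols of \<open>a\<close>
      differently. Both arrangements complete to \<open>pochhammer (a \<rho> - u) (Suc K)\<close>,
      whose last factor is \<open>a \<rho> - b H\<close>, a factor of the numerator of
      \<open>resb H\<close>.\<close>
    have "resb H / (\<Prod>\<rho>=1..r. pochhammer (a \<rho> - u) (Suc \<beta>))
       = Ra / (\<Prod>\<rho>=1..r. pochhammer (a \<rho> - u) K) / (\<Prod>h\<in>{1..q} - {H}. b h - b H)"
    proof -
      have "pochhammer (a \<rho> - u) (Suc \<beta>) * pochhammer (a \<rho> - u + of_nat \<beta> + 1) (K - \<beta>)
         = pochhammer (a \<rho> - u) K * (a \<rho> - b H)" for \<rho>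
        using 1 pochhammer_product[of "Suc \<beta>" "Suc K" "a \<rho> - u"]
        by (simp add: pochhammer_Suc[of _ K] u_def add_ac)
      then have "(\<Prod>\<rho>=1..r. pochhammer (a \<rho> - u) (Suc \<beta>)) * Ra = (\<Prod>\<rho>=1..r. pochhammer (a \<rho> - u) K) * (\<Prod>\<rho>=1..r. a \<rho> - b H)"
        unfolding Ra_def prod.distrib[symmetric] by simp
      moreover have "(\<Prod>\<rho>=1..r. pochhammer (a \<rho> - u) n) \<noteq> 0" if "n \<le> Suc K" for n
      proof -
        have "pochhammer (a \<rho> - u) n \<noteq> 0" if "\<rho> \<in> {1..r}" for \<rho>
        proof
          assume "pochhammer (a \<rho> - u) n = 0"
          then obtain k where "k < n" "a \<rho> - u = - of_nat k"
            by (auto simp: pochhammer_eq_0_iff)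
          then show False using a'[OF that, of k] \<open>n \<le> Suc K\<close> by simp
        qed
        then show ?thesis by (simp add: prod_zero_iff)
      qed
      then have "(\<Prod>\<rho>=1..r. pochhammer (a \<rho> - u) (Suc \<beta>)) \<noteq> 0" "(\<Prod>\<rho>=1..r. pochhammer (a \<rho> - u) K) \<noteq> 0"
        using 1 by (simp_all del: prod_zero_iff)
      ultimately have "(\<Prod>\<rho>=1..r. a \<rho> - b H) / (\<Prod>\<rho>=1..r. pochhammer (a \<rho> - u) (Suc \<beta>))
          = Ra / (\<Prod>\<rho>=1..r. pochhammer (a \<rho> - u) K)"
        by (metis frac_eq_eq mult.commute)
      moreover have "resb H / (\<Prod>\<rho>=1..r. pochhammer (a \<rho> - u) (Suc \<beta>)) = (\<Prod>\<rho>=1..r. a \<rho> - b H) /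
          (\<Prod>\<rho>=1..r. pochhammer (a \<rho> - u) (Suc \<beta>)) / (\<Prod>h\<in>{1..q} - {H}. b h - b H)"
        by (simp add: resb_def mult.commute)
      ultimately show ?thesis by simp
    qed
    then have e: "ecoef j \<beta> H K = Ra / (\<Prod>\<rho>=1..r. pochhammer (a \<rho> - u) K) / (\<Prod>h\<in>{1..q} - {H}. b h - b H) *
        (pb * ((-1) ^ \<beta> * fact K / fact (K - \<beta>)))"
      using 1 pochhammer_neg_of_nat[of \<beta> K] unfolding ecoef_def u_def[symmetric]
      by (simp add: pb_def u_def times_divide_eq_left[symmetric] del: times_divide_eq_left)
    have sgn: "(-1 :: complex) powi (int (vsum p lam) - int (lam i) + int \<alpha> + int \<beta> - int K)
       = (-1) ^ (vsum p lam + lam i + \<alpha>) * (-1) ^ \<beta> * (-1) ^ K"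
      using minus_one_powi_diff[of "vsum p lam + \<alpha> + \<beta>" "lam i + K"]
      by (simp add: power_add algebra_simps)
    have cond: "\<alpha> < lam i \<and> H = j \<and> K < mu H \<and> \<beta> \<le> K"
      using 1 \<alpha> K by simp
    have "block_term p q r a b \<kappa> lam eta d nu mu i j H K \<alpha> \<beta> =
      ((-1) powi (int (vsum p lam) - int (lam i) + int \<alpha> + int \<beta> - int K) /
        (fact \<alpha> * fact (lam i - 1 - \<alpha>) * fact (K - \<beta>) * fact (mu H - K - 1))) *
      (Pa * Ra / (kap * (\<Prod>\<rho>=1..r. pochhammer (a \<rho> - u) K))) * quot *
      (Ip / ((\<Prod>h\<in>{1..q} - {H}. b h - b H) * (pmu / pb)))"
      unfolding ip[symmetric]
      unfolding block_term_def Let_def if_P[OF cond] Pa_def Ra_def kap_def kprod_def quot_def Ip_def u_def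
      by (rule refl)
    then show ?thesis
      unfolding w pc e sgn kap_def[symmetric] by (simp add: mult_ac)
  next
    case 2
    then show ?thesis
      using H ecoef_eq_0[of j H K \<beta>] by (simp add: block_term_def Let_def)
  next
    case 3
    define pb where "pb = (\<Prod>h\<in>{1..q} - {H}. pochhammer (b h - u) (Suc \<beta> - unit_vec j h))"
    have ip: "(\<Prod>h\<in>{1..q} - {H}. ipoch (b h - u + of_nat (\<beta> + 1) - of_nat (unit_vec j h))
        (int (mu h) - int (\<beta> + 1) + int (unit_vec j h))) = pmu / pb"
      unfolding pmu_def pb_def prod_dividef[symmetric]
    proof (rule prod.cong[OF refl])
      fix h assume "h \<in> {1..q} - {H}"
      then have nn: "b h - u \<notin> \<int>\<^sub>\<le>\<^sub>0"
        unfolding u_def using H by (intro b_notin_nonpos_Ints) auto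
      have "of_nat (Suc \<beta> - unit_vec j h) = of_nat (\<beta> + 1) - (of_nat (unit_vec j h) :: complex)"
        "int (Suc \<beta> - unit_vec j h) = int (\<beta> + 1) - int (unit_vec j h)"
        by (auto simp: unit_vec_def)
      then show "ipoch (b h - u + of_nat (\<beta> + 1) - of_nat (unit_vec j h))
          (int (mu h) - int (\<beta> + 1) + int (unit_vec j h))
        = pochhammer (b h - u) (mu h) / pochhammer (b h - u) (Suc \<beta> - unit_vec j h)"
        using ipoch_add_diff[OF nn, of "Suc \<beta> - unit_vec j h" "mu h"]
        by (simp only: add_diff_eq diff_diff_eq2 diff_add_eq)
    qed
    \<comment> \<open>Writing the order as \<open>Suc \<beta> - unit_vec j h\<close> treats
      \<open>j\<close> like the other indices, so that \<open>H\<close> can be split off instead of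
      \<open>j\<close>.\<close>
    have "(\<Prod>h\<in>{1..q}-{j}. pochhammer (b h - u) (Suc \<beta>)) * pochhammer (b j - u) \<beta>
        = pb * ((-1) ^ Suc \<beta> * fact K / fact (K - 1 - \<beta>))"
    proof -
      have "(\<Prod>h\<in>{1..q}-{j}. pochhammer (b h - u) (Suc \<beta>)) * pochhammer (b j - u) \<beta>
          = (\<Prod>h=1..q. pochhammer (b h - u) (Suc \<beta> - unit_vec j h))"
        unfolding prod.remove[OF finite_atLeastAtMost j]
        by (simp add: unit_vec_def mult.commute)
      also have "\<dots> = pb * pochhammer (b H - u) (Suc \<beta>)"
        unfolding prod.remove[OF finite_atLeastAtMost H] pb_def
        using 3 by (simp add: unit_vec_def mult.commute)
      also have "pochhammer (b H - u) (Suc \<beta>) = (-1) ^ Suc \<beta> * fact K / fact (K - 1 - \<beta>)"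
        using 3 pochhammer_neg_of_nat[of "Suc \<beta>" K] by (simp add: u_def)
      finally show ?thesis .
    qed
    then have e: "ecoef j \<beta> H K = resb j * (pb * ((-1) ^ Suc \<beta> * fact K / fact (K - 1 - \<beta>))) /
       (\<Prod>\<rho>=1..r. pochhammer (a \<rho> - u) (\<beta> + 1))"
      by (simp add: ecoef_def u_def[symmetric])
    have sgn: "(-1 :: complex) powi (int (vsum p lam) - int (lam i) + 1 + int \<alpha> + int K + int \<beta>)
       = (-1) ^ (vsum p lam + lam i + \<alpha>) * (-1) ^ Suc \<beta> * (-1) ^ K"
      using minus_one_powi_diff[of "vsum p lam + 1 + \<alpha> + K + \<beta>" "lam i"]
      by (simp add: power_add algebra_simps)
    have cond: "\<not> (\<alpha> < lam i \<and> H = j \<and> K < mu H \<and> \<beta> \<le> K)"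
      "\<alpha> < lam i \<and> H \<noteq> j \<and> 1 \<le> K \<and> K < mu H \<and> \<beta> \<le> K - 1"
      using 3 \<alpha> K by auto
    have "block_term p q r a b \<kappa> lam eta d nu mu i j H K \<alpha> \<beta> =
      ((-1) powi (int (vsum p lam) - int (lam i) + 1 + int \<alpha> + int K + int \<beta>) /
        (fact \<alpha> * fact (lam i - 1 - \<alpha>) * fact (K - 1 - \<beta>) * fact (mu H - K - 1))) *
      ((\<Prod>\<rho>=1..r. a \<rho> - b j) * Pa / (kap * (\<Prod>\<rho>=1..r. pochhammer (a \<rho> - u) (\<beta> + 1)))) * quot *
      (Ip / ((\<Prod>h\<in>{1..q} - {j}. b h - b j) * (pmu / pb)))"
      unfolding ip[symmetric]
      unfolding block_term_def Let_def if_not_P[OF cond(1)] if_P[OF cond(2)] Pa_def kap_def kprod_def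
        quot_def Ip_def u_def
      by (rule refl)
    then show ?thesis
      unfolding w pc e sgn kap_def[symmetric] resb_def by (simp add: mult_ac)
  next
    case 4
    then have cond: "\<not> (\<alpha> < lam i \<and> H = j \<and> K < mu H \<and> \<beta> \<le> K)"
      "\<not> (\<alpha> < lam i \<and> H \<noteq> j \<and> 1 \<le> K \<and> K < mu H \<and> \<beta> \<le> K - 1)"
      by auto
    have "ecoef j \<beta> H K = 0"
      using 4 by (intro ecoef_eq_0[OF j H]) simp
    then show ?thesis
      unfolding block_term_def Let_def if_not_P[OF cond(1)] if_not_P[OF cond(2)] by simp
  qed
qed

text \<open>After the separation of the terms, the sum over \<open>H\<close> and \<open>K\<close>
  assembles \<open>bcoef\<close>, and the remaining factors with \<open>A_norm\<close> assemble
  coefficient times moment. The scalar depends on \<open>nu\<close> and \<open>mu\<close> only,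
  hence is common to numerator and denominator of a recurrence coefficient.\<close>

lemma pairing_block_eq:
  assumes M: "balanced mu"
  shows "pairing_block p q r a b \<kappa> lam eta d nu mu = brest mu * bfac nu mu *
    (\<Sum>j=1..q. \<Sum>\<beta><mu j. bcoef (npoly nu) mu j \<beta> *
       (\<Sum>i=1..p. \<Sum>\<alpha><lam i. coeff (A lam eta i) \<alpha> * moment j i (\<alpha> + (d + \<beta>))))"
proof -
  define N where "N = A_norm p q r a b \<kappa> lam eta"
  have bn: "block_norm p q r a b \<kappa> lam eta mu = - N * brest mu"
    by (simp add: block_norm_def N_def A_norm_def brest_def Let_def algebra_simps)
  have summand: "block_norm p q r a b \<kappa> lam eta mu *
      (\<Sum>H=1..q. \<Sum>K<mu H. block_term p q r a b \<kappa> lam eta d nu mu i j H K \<alpha> \<beta>)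
    = brest mu * bfac nu mu * (bcoef (npoly nu) mu j \<beta> * (coeff (A lam eta i) \<alpha> * moment j i (\<alpha> + (d + \<beta>))))"
    if j: "j \<in> {1..q}" and i: "i \<in> {1..p}" and \<beta>: "\<beta> < mu j" and \<alpha>: "\<alpha> < lam i" for i j \<alpha> \<beta>
  proof -
    define F where "F = fact \<alpha> * fact (lam i - 1 - \<alpha>) * kprod lam i \<alpha>"
    define W where "W = bden eta (\<kappa> i + of_nat \<alpha>) * wfrac j (d + \<beta>) (\<kappa> i + of_nat \<alpha>)"
    have "(\<Sum>H=1..q. \<Sum>K<mu H. block_term p q r a b \<kappa> lam eta d nu mu i j H K \<alpha> \<beta>)
      = (\<Sum>H=1..q. \<Sum>K<mu H. (-1) ^ (vsum p lam + lam i + \<alpha>) / F * W *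
           (bfac nu mu * pcoef (npoly nu) mu H K * ecoef j \<beta> H K))"
      unfolding F_def W_def
    proof (intro sum.cong refl block_term_eq[where lam = lam and mu = mu, OF i j _ \<alpha> _ \<beta>])
      fix H K \<rho> d assume *: "H \<in> {1..q}" "K \<in> {..<mu H}" "\<rho> \<in> {1..r}" "d \<le> K"
      then have "a \<rho> - b H - of_nat (K - d) \<noteq> 0"
        using M unfolding balanced_def by (metis lessThan_iff less_imp_diff_less)
      then show "a \<rho> - (b H + of_nat K) + of_nat d \<noteq> 0"
        using * by (simp add: of_nat_diff algebra_simps)
    qed auto
    also have "\<dots> = (-1) ^ (vsum p lam + lam i + \<alpha>) / F * W * (bfac nu mu * bcoef (npoly nu) mu j \<beta>)"
      unfolding bcoef_def sum_distrib_left by (simp only: mult.assoc)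
    finally have sum_eq: "(\<Sum>H=1..q. \<Sum>K<mu H. block_term p q r a b \<kappa> lam eta d nu mu i j H K \<alpha> \<beta>)
      = (-1) ^ (vsum p lam + lam i + \<alpha>) / F * W * (bfac nu mu * bcoef (npoly nu) mu j \<beta>)" .
    \<comment> \<open>The block carries \<open>lam i\<close> where \<open>A_coeff\<close> has
      \<open>lam i - 1\<close>; the resulting sign is the minus in \<open>- N\<close>.\<close>
    have sgn: "(-1 :: complex) ^ (vsum p lam + lam i + \<alpha>) = - ((-1) ^ (vsum p lam + (lam i - 1) + \<alpha>))"
      using \<alpha> by (cases "lam i") simp_all
    have coeff_eq: "N * (-1) ^ (vsum p lam + (lam i - 1) + \<alpha>) / F * W
        = coeff (A lam eta i) \<alpha> * moment j i (\<alpha> + (d + \<beta>))"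
      using A_coeff[where lam = lam and eta = eta, OF i \<alpha>]
      by (simp add: moment_eq[OF i j] W_def F_def N_def mult.assoc[symmetric])
    show ?thesis
      unfolding bn sum_eq sgn coeff_eq[symmetric] by (simp add: mult_ac)
  qed
  have "pairing_block p q r a b \<kappa> lam eta d nu mu
     = (\<Sum>j=1..q. \<Sum>i=1..p. \<Sum>\<beta><mu j. \<Sum>\<alpha><lam i. block_norm p q r a b \<kappa> lam eta mu *
          (\<Sum>H=1..q. \<Sum>K<mu H. block_term p q r a b \<kappa> lam eta d nu mu i j H K \<alpha> \<beta>))"
    by (simp add: pairing_block_def sum_distrib_left)
  also have "\<dots> = (\<Sum>j=1..q. \<Sum>i=1..p. \<Sum>\<beta><mu j. \<Sum>\<alpha><lam i. brest mu * bfac nu mu *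
          (bcoef (npoly nu) mu j \<beta> * (coeff (A lam eta i) \<alpha> * moment j i (\<alpha> + (d + \<beta>)))))"
    by (intro sum.cong refl summand) auto
  also have "\<dots> = (\<Sum>j=1..q. \<Sum>\<beta><mu j. \<Sum>i=1..p. \<Sum>\<alpha><lam i. brest mu * bfac nu mu *
          (bcoef (npoly nu) mu j \<beta> * (coeff (A lam eta i) \<alpha> * moment j i (\<alpha> + (d + \<beta>)))))"
    by (intro sum.cong refl sum.swap)
  finally show ?thesis
    by (simp add: sum_distrib_left)
qed

end

subsection \<open>Diagonal pairing and the basis property\<close>

lemma degree_less_iff_coeff: "(P = 0 \<or> degree P < n) \<longleftrightarrow> (\<forall>k\<ge>n. coeff P k = 0)"
proof
  assume *: "\<forall>k\<ge>n. coeff P k = 0"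
  show "P = 0 \<or> degree P < n"
  proof (rule ccontr)
    assume "\<not> (P = 0 \<or> degree P < n)"
    then show False using *[rule_format, of "degree P"] by auto
  qed
qed (auto intro: coeff_eq_0)

context hypergeometric_weights
begin

lemma rec_space_iff:
  "P \<in> rec_space p q r a b \<kappa> N M \<longleftrightarrow> (\<forall>i. i \<notin> {1..p} \<longrightarrow> P i = 0) \<and>
     (\<forall>i\<in>{1..p}. \<forall>k\<ge>N i. coeff (P i) k = 0) \<and> (\<forall>j\<in>{1..q}. \<forall>l<M j. mom N P j l = 0)"
  by (simp add: rec_space_eq degree_less_iff_coeff)

lemma mom_add: "mom N (P + Q) j l = mom N P j l + mom N Q j l"
  by (simp add: mom_def algebra_simps sum.distrib)

lemma mom_scale: "mom N (pscale c P) j l = c * mom N P j l"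
  by (simp add: mom_def pscale_def sum_distrib_left mult.assoc)

lemma mom_zero: "mom N 0 j l = 0"
  by (simp add: mom_def)

lemma pscale_apply: "pscale c P i = smult c (P i)"
  by (simp add: pscale_def)

lemma subspace_rec_space: "pvec.subspace (rec_space p q r a b \<kappa> N M)"
  by (rule pvec.subspaceI) (auto simp: rec_space_iff mom_add mom_scale mom_zero pscale_apply)

lemma pair_add: "pair N g M (P + Q) = pair N g M P + pair N g M Q"
  by (simp add: pair_def mom_add algebra_simps sum.distrib)

lemma pair_scale: "pair N g M (pscale c P) = c * pair N g M P"
  by (simp add: pair_def mom_scale sum_distrib_left mult.left_commute)

end

text \<open>The local index pairs form one staircase: the recurrence vectors are
  \<open>A (N (k + 1)) (M k)\<close> and the test vectors \<open>B (N k) (M (k + 1))\<close>, where both \<open>N\<close> and \<open>M\<close> grow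
  by one unit vector at each step.\<close>
locale recurrence_chain = hypergeometric_weights p q r a b \<kappa>
  for p q r :: nat and a b \<kappa> :: "nat \<Rightarrow> complex" +
  fixes S :: nat and N M :: "nat \<Rightarrow> nat \<Rightarrow> nat"
  assumes balanced: "k \<le> S \<Longrightarrow> balanced (M k)"
    and N_step: "k < S \<Longrightarrow> \<exists>c\<in>{1..p}. \<forall>i\<in>{1..p}. N (Suc k) i = N k i + unit_vec c i"
    and M_step: "\<lbrakk>k < S; h \<in> {1..q}\<rbrakk> \<Longrightarrow> M k h \<le> M (Suc k) h"
    and vsum_eq: "k \<le> S \<Longrightarrow> vsum p (N k) = vsum q (M k)"
    and block_neq_0: "k < S \<Longrightarrow> pairing_block p q r a b \<kappa> (N (Suc k)) (M k) 0 (N k) (M (Suc k)) \<noteq> 0"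
begin

definition V :: "nat \<Rightarrow> pvec" where
  "V k = A (N (Suc k)) (M k)"

text \<open>Scaled so that its values on \<open>V k\<close> and on \<open>mult_z\<close> of a vector
  \<open>A\<close> are exactly pairing blocks; the common bound \<open>N S\<close> makes it one
  functional on all of \<open>R\<close>.\<close>

definition L :: "nat \<Rightarrow> pvec \<Rightarrow> complex" where
  "L k P = brest (M (Suc k)) * bfac (N k) (M (Suc k)) * pair (N S) (npoly (N k)) (M (Suc k)) P"

abbreviation R :: "pvec set" where
  "R \<equiv> rec_space p q r a b \<kappa> (N S) (M 0)"

lemma L_add: "L k (P + Q) = L k P + L k Q"
  by (simp add: L_def pair_add algebra_simps)

lemma L_scale: "L k (pscale c P) = c * L k P"
  by (simp add: L_def pair_scale)

lemma L_zero: "L k 0 = 0"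
  using L_scale[of k 0 0] by simp

lemma L_sum: "L k (\<Sum>x\<in>X. f x) = (\<Sum>x\<in>X. L k (f x))"
  by (induction X rule: infinite_finite_induct) (simp_all only: sum.infinite sum.empty sum.insert L_zero L_add
      not_False_eq_True)

lemma N_mono:
  assumes i: "i \<in> {1..p}" and "k \<le> k'" "k' \<le> S"
  shows "N k i \<le> N k' i"
  using assms(2,3)
proof (induction rule: dec_induct)
  case (step l)
  then have "N l i \<le> N (Suc l) i"
    using N_step[of l] i by force
  then show ?case using step by simp
qed simp

lemma M_mono:
  assumes h: "h \<in> {1..q}" and "k \<le> k'" "k' \<le> S"
  shows "M k h \<le> M k' h"
  using assms(2,3)
proof (induction rule: dec_induct)
  case (step l)
  then show ?case using M_step[of l h] h by simp
qed simp

lemma vsum_N_Suc: "k < S \<Longrightarrow> vsum p (N (Suc k)) = vsum p (N k) + 1"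
  using N_step[of k] by (auto simp: vsum_def sum.distrib unit_vec_def)

lemma vsum_M_Suc: "k < S \<Longrightarrow> vsum q (M (Suc k)) = vsum p (N k) + 1"
  using vsum_N_Suc[of k] vsum_eq[of "Suc k"] by simp

lemma coeff_V_eq_0: "l \<ge> N (Suc k) i \<Longrightarrow> coeff (V k i) l = 0"
  by (simp add: V_def coeff_A_eq_0)

lemma mom_V_eq_0:
  assumes "k < S" "j \<in> {1..q}" "l < M k j"
  shows "mom (N S) (V k) j l = 0"
  unfolding V_def
proof (rule mom_A_eq_0[where eta = "M k", OF _ assms(2,3)])
  show "\<And>h. h \<in> {1..q} \<Longrightarrow> M k j \<le> M k h + 1"
    using balanced[of k] assms by (simp add: balanced_def)
  show "vsum q (M k) < vsum p (N (Suc k))"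
    using vsum_N_Suc[of k] vsum_eq[of k] assms by simp
  show "\<And>i. i \<in> {1..p} \<Longrightarrow> N (Suc k) i \<le> N S i"
    using assms by (intro N_mono) auto
qed

lemma V_mem: "k < S \<Longrightarrow> V k \<in> R"
  unfolding rec_space_iff
proof (intro conjI ballI allI impI)
  assume k: "k < S"
  fix i l assume "i \<in> {1..p}" "N S i \<le> l"
  then show "coeff (V k i) l = 0"
    using N_mono[of i "Suc k" S] k by (intro coeff_V_eq_0) simp
next
  assume k: "k < S"
  fix j l assume "j \<in> {1..q}" "l < M 0 j"
  then show "mom (N S) (V k) j l = 0"
    using M_mono[of j 0 k] k by (intro mom_V_eq_0) auto
qed (simp add: V_def A_vec_def)

text \<open>Multiplication by \<open>z\<close> costs one degree and trades the moment of order
  \<open>l\<close> for that of order \<open>l + 1\<close>, so one unit of slack in each component of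
  \<open>N\<close> and of \<open>M\<close> is enough.\<close>

lemma mult_z_V_mem:
  assumes k: "k < S" and N: "\<And>i. i \<in> {1..p} \<Longrightarrow> N (Suc k) i < N S i"
    and M: "\<And>j. j \<in> {1..q} \<Longrightarrow> M 0 j < M k j"
  shows "mult_z (V k) \<in> R"
  unfolding rec_space_iff
proof (intro conjI ballI allI impI)
  fix i l assume "i \<in> {1..p}" "N S i \<le> l"
  then show "coeff (mult_z (V k) i) l = 0"
    using N[of i] by (simp add: mult_z_def coeff_monom_mult coeff_V_eq_0)
next
  fix j l assume j: "j \<in> {1..q}" and l: "l < M 0 j"
  have "mom (N S) (mult_z (V k)) j l = mom (N S) (V k) j (Suc l)"
    unfolding V_def
    by (rule trans[OF mom_mult_z_A mom_A[symmetric]]) (use N in \<open>auto intro: less_imp_le\<close>)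
  then show "mom (N S) (mult_z (V k)) j l = 0"
    using mom_V_eq_0[OF k j, of "Suc l"] M[OF j] l by simp
qed (simp add: mult_z_def V_def A_vec_def)

lemma L_V:
  assumes "k < S"
  shows "L k (V k) = pairing_block p q r a b \<kappa> (N (Suc k)) (M k) 0 (N k) (M (Suc k))"
proof -
  have le: "N (Suc k) i \<le> N S i" if "i \<in> {1..p}" for i
    using N_mono[OF that, of "Suc k" S] assms by simp
  have bal: "balanced (M (Suc k))" using assms by (intro balanced) simp
  have mom: "mom (N S) (A (N (Suc k)) (M k)) j l
      = (\<Sum>i=1..p. \<Sum>\<alpha><N (Suc k) i. coeff (A (N (Suc k)) (M k) i) \<alpha> * moment j i (\<alpha> + l))" for j l
    by (rule mom_A) (rule le)
  show ?thesis
    unfolding L_def V_def pair_def pairing_block_eq[OF bal] mom add_0_left ..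
qed

lemma L_mult_z:
  assumes "k < S" "\<And>i. i \<in> {1..p} \<Longrightarrow> lam i < N S i"
  shows "L k (mult_z (A lam eta)) = pairing_block p q r a b \<kappa> lam eta 1 (N k) (M (Suc k))"
proof -
  have bal: "balanced (M (Suc k))" using assms by (intro balanced) simp
  have mom: "mom (N S) (mult_z (A lam eta)) j l
      = (\<Sum>i=1..p. \<Sum>\<alpha><lam i. coeff (A lam eta i) \<alpha> * moment j i (\<alpha> + Suc l))" for j l
    by (rule mom_mult_z_A) (rule assms(2))
  show ?thesis
    unfolding L_def pair_def pairing_block_eq[OF bal] plus_1_eq_Suc mom ..
qed

lemma L_eval:
  assumes "k < S"
  shows "L k P = brest (M (Suc k)) * bfac (N k) (M (Suc k)) *
     (\<Sum>(i, \<alpha>)\<in>index_set p (N S). coeff (P i) \<alpha> * gquot (node (i, \<alpha>)) *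
            (poly (npoly (N k)) (node (i, \<alpha>)) / bden (M (Suc k)) (node (i, \<alpha>))))"
proof -
  have "degree (npoly (N k)) < vsum q (M (Suc k))"
    using degree_npoly[of "N k"] vsum_M_Suc[OF assms] by simp
  then show ?thesis
    unfolding L_def using balanced[of "Suc k"] assms by (subst pair_eval) auto
qed

text \<open>Coefficients below \<open>N k\<close> belong to nodes that are roots of
  \<open>npoly (N k)\<close>; all others vanish by assumption.\<close>

lemma L_eq_0:
  assumes "k < S" and P: "\<And>i l. \<lbrakk>i \<in> {1..p}; l \<ge> N k i\<rbrakk> \<Longrightarrow> coeff (P i) l = 0"
  shows "L k P = 0"
proof -
  have "coeff (P i) \<alpha> * poly (npoly (N k)) (node (i, \<alpha>)) = 0" if "(i, \<alpha>) \<in> index_set p (N S)" for i \<alpha>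
    using that P[of i \<alpha>] poly_npoly_node_eq_0[of "(i, \<alpha>)" "N k"]
    by (cases "\<alpha> < N k i") (auto simp: index_set_def)
  then show ?thesis
    unfolding L_eval[OF assms(1)] by (subst sum.neutral) fastforce+
qed

text \<open>The two triangles vanish for different reasons: for \<open>l < k\<close> the degrees of
  \<open>V l\<close> lie below \<open>N k\<close>, and for \<open>l > k\<close> the orthogonality of
  \<open>V l\<close> covers all orders below \<open>M (Suc k)\<close>.\<close>

lemma L_V_eq_0:
  assumes "k < S" "l < S" "k \<noteq> l"
  shows "L k (V l) = 0"
proof (cases "l < k")
  case True
  then show ?thesis
    using N_mono[of _ "Suc l" k] assms by (intro L_eq_0 coeff_V_eq_0) (auto intro: order_trans)
next
  case False
  then have "mom (N S) (V l) j \<beta> = 0" if "j \<in> {1..q}" "\<beta> < M (Suc k) j" for j \<beta>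
    using M_mono[of j "Suc k" l] that assms by (intro mom_V_eq_0) auto
  then have "pair (N S) (npoly (N k)) (M (Suc k)) (V l) = 0" by (rule pair_eq_0)
  then show ?thesis by (simp add: L_def)
qed

text \<open>On the vectors of degree below \<open>N (Suc k)\<close> the functional \<open>L k\<close> only sees the one
  coefficient that is not allowed in degree below \<open>N k\<close>.\<close>
lemma coeff_eq_0_step:
  assumes k: "k < S" and P: "\<And>i l. \<lbrakk>i \<in> {1..p}; l \<ge> N (Suc k) i\<rbrakk> \<Longrightarrow> coeff (P i) l = 0"
    and L: "L k P = 0" and i: "i \<in> {1..p}" and l: "l \<ge> N k i"
  shows "coeff (P i) l = 0"
proof -
  obtain c where c: "c \<in> {1..p}" and Suc: "\<And>i. i \<in> {1..p} \<Longrightarrow> N (Suc k) i = N k i + unit_vec c i"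
    using N_step[OF k] by blast
  define s where "s = (c, N k c)"
  define W where "W = brest (M (Suc k)) * bfac (N k) (M (Suc k)) * (gquot (node s) *
            (poly (npoly (N k)) (node s) / bden (M (Suc k)) (node s)))"
  have top: "L k Q = coeff (Q c) (N k c) * W"
    if Q: "\<And>i l. \<lbrakk>i \<in> {1..p}; l \<ge> N (Suc k) i\<rbrakk> \<Longrightarrow> coeff (Q i) l = 0" for Q
  proof -
    have s: "s \<in> index_set p (N S)"
      using N_mono[of c "Suc k" S] k c Suc[OF c] by (auto simp: s_def index_set_def unit_vec_def)
    define F where "F = (\<lambda>(i, \<alpha>). coeff (Q i) \<alpha> * gquot (node (i, \<alpha>)) *
            (poly (npoly (N k)) (node (i, \<alpha>)) / bden (M (Suc k)) (node (i, \<alpha>))))"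
    have "F x = 0" if x: "x \<in> index_set p (N S)" "x \<noteq> s" for x
    proof -
      obtain i \<alpha> where x_eq: "x = (i, \<alpha>)" by (cases x)
      have i: "i \<in> {1..p}" using x by (simp add: x_eq index_set_def)
      show ?thesis
      proof (cases "\<alpha> < N k i")
        case True
        then have "poly (npoly (N k)) (node (i, \<alpha>)) = 0"
          using i by (intro poly_npoly_node_eq_0) (simp add: index_set_def)
        then show ?thesis by (simp add: x_eq F_def)
      next
        case False
        then have "\<alpha> \<ge> N (Suc k) i"
          using x(2) Suc[OF i] by (cases "i = c") (auto simp: x_eq s_def unit_vec_def)
        then show ?thesis using Q[OF i] by (simp add: x_eq F_def)
      qed
    qed
    then have "sum F (index_set p (N S)) = F s"
      by (intro sum_unique_nonzero s) auto
    then have "L k Q = brest (M (Suc k)) * bfac (N k) (M (Suc k)) * F s"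
      unfolding L_eval[OF k] F_def by (simp only:)
    then show ?thesis by (simp add: s_def W_def F_def)
  qed
  \<comment> \<open>Applying \<open>top\<close> to \<open>V k\<close> writes the nonzero block as a
    multiple of \<open>W\<close>, so all factors of \<open>W\<close> are settled at once.\<close>
  have "W \<noteq> 0"
    using top[of "V k"] coeff_V_eq_0 L_V[OF k] block_neq_0[OF k] by auto
  then have "coeff (P c) (N k c) = 0"
    using top[of P] P L by auto
  then show ?thesis
    using P[OF i, of l] l Suc[OF i] by (cases "l = N k i \<and> i = c") (auto simp: unit_vec_def split: if_splits)
qed

lemma eq_0_if_L_eq_0:
  assumes P: "P \<in> R" and L: "\<And>k. k < S \<Longrightarrow> L k P = 0"
  shows "P = 0"
proof -
  have "\<forall>i\<in>{1..p}. \<forall>l\<ge>N k i. coeff (P i) l = 0" if "k \<le> S" for k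
    using that
  proof (induction rule: inc_induct)
    case base
    show ?case using P by (simp add: rec_space_iff)
  next
    case (step k)
    then show ?case using coeff_eq_0_step[of k P] L[of k] by blast
  qed
  then have deg: "\<And>i l. \<lbrakk>i \<in> {1..p}; l \<ge> N 0 i\<rbrakk> \<Longrightarrow> coeff (P i) l = 0" by blast
  \<comment> \<open>With the coefficients from \<open>N 0\<close> on gone, the bound can be lowered
    to \<open>N 0\<close>, where there are as many coefficients as moment conditions.\<close>
  have "mom (N S) P j l = mom (N 0) P j l" for j l
    unfolding mom_def using deg N_mono[of _ 0 S]
    by (intro sum.cong refl sum.mono_neutral_right) auto
  then have mom: "mom (N 0) P j l = 0" if "j \<in> {1..q}" "l < M 0 j" for j l
    using P that by (simp add: rec_space_iff)
  have "coeff (P i) l = 0" if i: "i \<in> {1..p}" for i l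
  proof (cases "l < N 0 i")
    case True
    then show ?thesis
      using coeff_eq_0_if_mom_eq_0[OF balanced[of 0] _ mom i] vsum_eq[of 0] by simp
  qed (use deg i in auto)
  moreover have "P i = 0" if "i \<notin> {1..p}" for i
    using P that by (simp add: rec_space_iff)
  ultimately have "P i = 0" for i
    by (cases "i \<in> {1..p}") (auto intro: poly_eqI)
  then show ?thesis by auto
qed

text \<open>By the diagonal pairing every \<open>L k\<close> takes the same value on both sides, and
  an element of \<open>R\<close> on which all of them vanish is zero.\<close>

lemma expansion:
  assumes P: "P \<in> R"
  shows "P = (\<Sum>k<S. pscale (L k P / L k (V k)) (V k))"
proof -
  define Q where "Q = (\<Sum>k<S. pscale (L k P / L k (V k)) (V k))"
  have "Q \<in> R"
    unfolding Q_def by (intro pvec.subspace_sum pvec.subspace_scale subspace_rec_space V_mem) auto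
  then have "P + pscale (-1) Q \<in> R"
    by (intro pvec.subspace_add pvec.subspace_scale subspace_rec_space P)
  moreover have "L k (P + pscale (-1) Q) = 0" if k: "k < S" for k
  proof -
    have "L k Q = (\<Sum>l<S. L l P / L l (V l) * L k (V l))"
      by (simp add: Q_def L_sum L_scale)
    also have "\<dots> = L k P / L k (V k) * L k (V k)"
      using k L_V_eq_0[OF k] by (intro sum_unique_nonzero) auto
    also have "\<dots> = L k P"
      using L_V[OF k] block_neq_0[OF k] by simp
    finally show ?thesis unfolding L_add L_scale by simp
  qed
  ultimately have "P + pscale (-1) Q = 0"
    by (rule eq_0_if_L_eq_0)
  then have "P = Q"
    by (auto simp: fun_eq_iff pscale_def)
  then show ?thesis by (simp add: Q_def)
qed

section \<open>The recurrence vectors as a basis\<close>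

lemma L_V_neq_0: "k < S \<Longrightarrow> L k (V k) \<noteq> 0"
  by (simp add: L_V block_neq_0)

lemma inj_on_V: "inj_on V {..<S}"
  using L_V_eq_0 L_V_neq_0 by (intro inj_onI) (metis lessThan_iff)

lemma independent_V: "pvec.independent (V ` {..<S})"
proof (rule pvec.independent_if_scalars_zero)
  fix f x assume f: "(\<Sum>x\<in>V ` {..<S}. pscale (f x) x) = 0" and "x \<in> V ` {..<S}"
  then obtain k where k: "k < S" "x = V k" by auto
  have "0 = L k (\<Sum>l<S. pscale (f (V l)) (V l))"
    using f by (simp add: sum.reindex[OF inj_on_V] L_zero)
  also have "\<dots> = (\<Sum>l<S. f (V l) * L k (V l))"
    by (simp add: L_sum L_scale)
  also have "\<dots> = f (V k) * L k (V k)"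
    using k L_V_eq_0[OF k(1)] by (intro sum_unique_nonzero) auto
  finally show "f x = 0" using L_V_neq_0[OF k(1)] k by simp
qed simp

lemma span_V: "pvec.span (V ` {..<S}) = R"
proof
  show "pvec.span (V ` {..<S}) \<subseteq> R"
    by (rule pvec.span_minimal) (use V_mem subspace_rec_space in auto)
  show "R \<subseteq> pvec.span (V ` {..<S})"
  proof
    fix P assume "P \<in> R"
    define Q where "Q = (\<Sum>k<S. pscale (L k P / L k (V k)) (V k))"
    have "P = Q"
      unfolding Q_def by (rule expansion) fact
    moreover have "Q \<in> pvec.span (V ` {..<S})"
      unfolding Q_def by (intro pvec.span_sum pvec.span_scale pvec.span_base) auto
    ultimately show "P \<in> pvec.span (V ` {..<S})" by simp
  qed
qed

end

subsection \<open>The recurrence\<close>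

lemma basis_steps_le:
  assumes "basis_steps d x" "k \<le> l"
  shows "x k i \<le> x l i"
  using assms(2)
proof (induction rule: dec_induct)
  case (step l)
  obtain j where "x (Suc l) = x l + unit_vec j"
    using assms(1) unfolding basis_steps_def by blast
  then show ?case using step by simp
qed simp

lemma vsum_basis_steps:
  assumes "basis_steps d x"
  shows "vsum d (x k) = k"
proof (induction k)
  case 0
  then show ?case using assms by (simp add: basis_steps_def vsum_def)
next
  case (Suc k)
  obtain j where "j \<in> {1..d}" "x (Suc k) = x k + unit_vec j"
    using assms unfolding basis_steps_def by blast
  then show ?case using Suc by (simp add: vsum_def sum.distrib unit_vec_def)
qed

text \<open>The \<open>d\<close> entries add up to \<open>d\<close> and none exceeds 1. Hence the
  ends of the chain do not depend on the order of the steps.\<close>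

lemma basis_steps_full:
  assumes "basis_steps d x" "\<And>i. i \<in> {1..d} \<Longrightarrow> x d i \<le> 1" and i: "i \<in> {1..d}"
  shows "x d i = 1"
proof (rule ccontr)
  assume "x d i \<noteq> 1"
  then have "(\<Sum>i=1..d. x d i) < (\<Sum>i=1..d. 1)"
    using assms(2) i by (intro sum_strict_mono_ex1) (auto intro!: bexI[of _ i] simp: le_less)
  then show False
    using vsum_basis_steps[OF assms(1), of d] by (simp add: vsum_def)
qed

lemma vsum_add: "vsum d (x + y) = vsum d x + vsum d y"
  by (simp add: vsum_def sum.distrib)

lemma vsum_diff:
  assumes "\<And>i. i \<in> {1..d} \<Longrightarrow> y i \<le> x i"
  shows "vsum d (x - y) = vsum d x - vsum d y"
proof -
  have "vsum d (x - y) + vsum d y = vsum d x"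
    unfolding vsum_def sum.distrib[symmetric] using assms by (intro sum.cong) auto
  then show ?thesis by simp
qed

lemma sum_lessThan_split:
  fixes f :: "nat \<Rightarrow> 'a::comm_monoid_add"
  shows "(\<Sum>k<p + q + 1. f k) = (\<Sum>i=1..p. f (q + i)) + f q + (\<Sum>j=1..q. f (q - j))"
proof -
  have "(\<Sum>k<q. f k) = (\<Sum>j=1..q. f (q - j))"
    by (rule sum.reindex_bij_witness[of _ "\<lambda>j. q - j" "\<lambda>k. q - k"]) auto
  moreover have "(\<Sum>k\<in>{q<..<p + q + 1}. f k) = (\<Sum>i=1..p. f (q + i))"
    by (rule sum.reindex_bij_witness[of _ "\<lambda>i. q + i" "\<lambda>k. k - q"]) auto
  moreover have "sum f ({..<q} \<union> {q<..<p + q + 1}) = (\<Sum>k<q. f k) + (\<Sum>k\<in>{q<..<p + q + 1}. f k)"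
    by (rule sum.union_disjoint) auto
  then have "sum f (insert q ({..<q} \<union> {q<..<p + q + 1})) = f q + ((\<Sum>k<q. f k) + (\<Sum>k\<in>{q<..<p + q + 1}. f k))"
    by (subst sum.insert) auto
  moreover have "{..<p + q + 1} = insert q ({..<q} \<union> {q<..<p + q + 1})" by auto
  ultimately show ?thesis by (simp add: ac_simps)
qed

theorem theorem7p13:
  fixes p q r :: nat
    and a b \<kappa> :: "nat \<Rightarrow> complex"
    and n m :: "nat \<Rightarrow> nat"
    and t tf s sf :: "nat \<Rightarrow> nat \<Rightarrow> nat"
  assumes "p \<ge> 1" and "q \<ge> 1" and "r < q"
    and "regular p q b \<kappa>"
    and "vsum p n = vsum q m + 1"
    and "m \<in> near_diag q (vsum q m)"
    and "\<forall>j\<in>{1..q}. m j \<ge> 1"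
    and "admissible_data p q r a b \<kappa> n m t tf s sf"
    and "\<forall>i\<in>{1..p}. pairing_block p q r a b \<kappa> (n + t i) (m + sf i) 0
                       (n + t (i - 1)) (m + sf (i + 1)) \<noteq> 0"
    and "pairing_block p q r a b \<kappa> n m 0 (n - tf 1) (m + sf 1) \<noteq> 0"
    and "\<forall>j\<in>{1..q}. pairing_block p q r a b \<kappa> (n - tf j) (m - s j) 0
                       (n - tf (j + 1)) (m - s (j - 1)) \<noteq> 0"
  shows "let A = A_vec p q r a b \<kappa>;
             P = pairing_block p q r a b \<kappa>;
             Vp = (\<lambda>i. A (n + t i) (m + sf i));
             V0 = A n m;
             Vm = (\<lambda>j. A (n - tf j) (m - s j));
             ap = (\<lambda>i. P n m 1 (n + t (i - 1)) (m + sf (i + 1)) /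
                       P (n + t i) (m + sf i) 0 (n + t (i - 1)) (m + sf (i + 1)));
             a0 = P n m 1 (n - tf 1) (m + sf 1) / P n m 0 (n - tf 1) (m + sf 1);
             am = (\<lambda>j. P n m 1 (n - tf (j + 1)) (m - s (j - 1)) /
                       P (n - tf j) (m - s j) 0 (n - tf (j + 1)) (m - s (j - 1)));
             R = rec_space p q r a b \<kappa> (\<lambda>i. n i + 1) (\<lambda>j. m j - 1)
         in mult_z V0 = (\<Sum>i=1..p. pscale (ap i) (Vp i)) + pscale a0 V0
                          + (\<Sum>j=1..q. pscale (am j) (Vm j)) \<and>
            basis_of (map Vp [1..<p+1] @ [V0] @ map Vm [1..<q+1]) R \<and>
            mult_z V0 \<in> R"
proof -
  have steps: "basis_steps p t" "basis_steps p tf" "basis_steps q s" "basis_steps q sf"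
    and t_le: "\<And>i. i \<in> {1..p} \<Longrightarrow> t p i \<le> 1" and s_le: "\<And>j. j \<in> {1..q} \<Longrightarrow> s q j \<le> 1"
    and tf_n: "\<And>i. i \<in> {1..p} \<Longrightarrow> tf (q + 1) i \<le> n i"
    and s_m: "\<And>j. j \<in> {1..q} \<Longrightarrow> s q j \<le> m j"
    and pairs: "\<And>\<nu> \<mu>. (\<nu>, \<mu>) \<in> local_index_pairs p q n m t tf s sf \<Longrightarrow>
        \<mu> \<in> near_diag q (vsum q \<mu>) \<and> params_admissible p q r a b \<kappa> \<mu>"
    using assms(8) by (auto simp: admissible_data_def A_local_data_def)
  have tf_le: "tf k i \<le> n i" if "i \<in> {1..p}" "k \<le> q + 1" for k i
    using basis_steps_le[OF steps(2) that(2), of i] tf_n[OF that(1)] by simp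
  have s_le_m: "s k j \<le> m j" if "j \<in> {1..q}" "k \<le> q" for k j
    using basis_steps_le[OF steps(3) that(2), of j] s_m[OF that(1)] by simp
  have zero: "t 0 = 0" "tf 0 = 0" "s 0 = 0" "sf 0 = 0"
    using steps by (simp_all add: basis_steps_def)
  \<comment> \<open>Position \<open>q\<close> of the chain stands for \<open>A n m\<close>, position
    \<open>q - j\<close> for the \<open>j\<close>-th vector below it and \<open>q + i\<close> for
    the \<open>i\<close>-th above. On the lower part \<open>tf\<close> runs one step ahead of
    \<open>s\<close>; this makes up for \<open>vsum p n = vsum q m + 1\<close>, so that both indices
    have the same sum at each \<open>k\<close>, and it puts \<open>n\<close> at position
    \<open>Suc q\<close> of \<open>N\<close>.\<close>
  define N where "N = (\<lambda>k. if k \<le> q then n - tf (q + 1 - k) else n + t (k - q - 1))"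
  define M where "M = (\<lambda>k. if k \<le> q then m - s (q - k) else m + sf (k - q))"
  define S where "S = p + q + 1"
  have nm: "n + t 0 = n" "m - s 0 = m"
    by (auto simp: zero)
  have idx_p: "N (q + i) = n + t (i - 1)" "M (q + i) = m + sf i"
      "N (Suc (q + i)) = n + t i" "M (Suc (q + i)) = m + sf (i + 1)" if "i \<in> {1..p}" for i
  proof -
    have "\<not> q + i \<le> q" "\<not> Suc (q + i) \<le> q" "q + i - q - 1 = i - 1" "Suc (q + i) - q - 1 = i"
      "q + i - q = i" "Suc (q + i) - q = i + 1"
      using that by auto
    then show "N (q + i) = n + t (i - 1)" "M (q + i) = m + sf i"
      "N (Suc (q + i)) = n + t i" "M (Suc (q + i)) = m + sf (i + 1)"
      by (simp_all only: N_def M_def if_False)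
  qed
  have idx_0: "N q = n - tf 1" "M (Suc q) = m + sf 1"
    by (simp_all add: N_def M_def)
  have idx_m: "N (q - j) = n - tf (j + 1)" "M (q - j) = m - s j"
      "N (Suc (q - j)) = n - tf j" "M (Suc (q - j)) = m - s (j - 1)" if "j \<in> {1..q}" for j
  proof -
    have "q - j \<le> q" "Suc (q - j) \<le> q" "q + 1 - (q - j) = j + 1" "q + 1 - Suc (q - j) = j"
      "q - (q - j) = j" "q - Suc (q - j) = j - 1"
      using that by auto
    then show "N (q - j) = n - tf (j + 1)" "M (q - j) = m - s j"
      "N (Suc (q - j)) = n - tf j" "M (Suc (q - j)) = m - s (j - 1)"
      by (simp_all only: N_def M_def if_True)
  qed
  have M_q: "M q = m" by (simp add: M_def nm)
  have N_q: "N (Suc q) = n" by (simp add: N_def nm)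
  have N_S: "N S i = n i + 1" if "i \<in> {1..p}" for i
    using basis_steps_full[OF steps(1) t_le that] by (simp add: N_def S_def)
  have M_0: "M 0 j = m j - 1" if "j \<in> {1..q}" for j
    using basis_steps_full[OF steps(3) s_le that] by (simp add: M_def)
  \<comment> \<open>Any pair containing \<open>M k\<close> will do, because the admissibility
    conditions concern only its row index.\<close>
  have M_pair: "\<exists>\<nu>. (\<nu>, M k) \<in> local_index_pairs p q n m t tf s sf" if "k \<le> S" for k
  proof -
    consider "k < q" | "k = q" | "k = q + 1" | "k > q + 1"
      by linarith
    then show ?thesis
    proof cases
      case 1
      then have "(n - tf (q - k), M k) \<in> local_index_pairs p q n m t tf s sf"
        by (auto simp: local_index_pairs_def M_def intro!: bexI[of _ "q - k"])
      then show ?thesis by blast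
    next
      case 2
      then have "(n, M k) \<in> local_index_pairs p q n m t tf s sf"
        by (simp add: local_index_pairs_def M_q)
      then show ?thesis by blast
    next
      case 3
      then have "(n - tf 1, M k) \<in> local_index_pairs p q n m t tf s sf"
        by (simp add: local_index_pairs_def M_def)
      then show ?thesis by blast
    next
      case 4
      then obtain i where "k = q + i + 1" "i \<in> {1..p}"
        using \<open>k \<le> S\<close> by (intro that[of "k - q - 1"]) (auto simp: S_def)
      then have "(n + t (i - 1), M k) \<in> local_index_pairs p q n m t tf s sf"
        by (auto simp: local_index_pairs_def M_def)
      then show ?thesis by blast
    qed
  qed
  have M_adm: "M k \<in> near_diag q (vsum q (M k))" "params_admissible p q r a b \<kappa> (M k)" if "k \<le> S" for k
    using M_pair[OF that] pairs by blast+
  have block: "pairing_block p q r a b \<kappa> (N (Suc k)) (M k) 0 (N k) (M (Suc k)) \<noteq> 0" if "k < S" for k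
  proof -
    consider j where "j \<in> {1..q}" "k = q - j" | "k = q" | i where "i \<in> {1..p}" "k = q + i"
    proof -
      assume *: "\<And>j. \<lbrakk>j \<in> {1..q}; k = q - j\<rbrakk> \<Longrightarrow> thesis" "k = q \<Longrightarrow> thesis"
        "\<And>i. \<lbrakk>i \<in> {1..p}; k = q + i\<rbrakk> \<Longrightarrow> thesis"
      show thesis
        using *(1)[of "q - k"] *(2) *(3)[of "k - q"] \<open>k < S\<close> by (cases k q rule: linorder_cases) (auto simp: S_def)
    qed
    then show ?thesis
    proof cases
      case 1
      then show ?thesis using assms(11) idx_m[of j] by simp
    next
      case 2
      then show ?thesis using assms(10) idx_0 N_q M_q by simp
    next
      case 3
      then show ?thesis using assms(9) idx_p[of i] by simp
    qed
  qed
  interpret hypergeometric_weights p q r a b \<kappa>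
    using assms(3,4) M_adm(2)[of q] by unfold_locales (auto simp: params_admissible_def S_def)
  interpret recurrence_chain p q r a b \<kappa> S N M
  proof unfold_locales
    fix k assume "k \<le> S"
    then show "balanced (M k)" by (intro balancedI M_adm)
    show "vsum p (N k) = vsum q (M k)"
    proof (cases "k \<le> q")
      case True
      have "vsum p (n - tf (q + 1 - k)) = vsum p n - vsum p (tf (q + 1 - k))"
        by (intro vsum_diff tf_le) auto
      moreover have "vsum q (m - s (q - k)) = vsum q m - vsum q (s (q - k))"
        by (intro vsum_diff s_le_m) auto
      ultimately show ?thesis
        using True assms(5)
        by (simp add: N_def M_def vsum_basis_steps[OF steps(2)] vsum_basis_steps[OF steps(3)])
    next
      case False
      then show ?thesis
        using assms(5) by (simp add: N_def M_def vsum_add vsum_basis_steps[OF steps(1)] vsum_basis_steps[OF steps(4)])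
    qed
  next
    fix k assume k: "k < S"
    show "\<exists>c\<in>{1..p}. \<forall>i\<in>{1..p}. N (Suc k) i = N k i + unit_vec c i"
    proof (cases "k \<le> q")
      case True
      have "N k = n - tf (Suc (q - k))" "N (Suc k) = n - tf (q - k)"
        using True by (auto simp: N_def Suc_diff_le zero)
      moreover obtain c where "c \<in> {1..p}" "tf (Suc (q - k)) = tf (q - k) + unit_vec c"
        using steps(2) unfolding basis_steps_def by blast
      ultimately show ?thesis
        using tf_le[of _ "Suc (q - k)"] by (intro bexI[of _ c]) auto
    next
      case False
      have "N k = n + t (k - q - 1)" "N (Suc k) = n + t (Suc (k - q - 1))"
        using False by (auto simp: N_def Suc_diff_Suc)
      moreover obtain c where "c \<in> {1..p}" "t (Suc (k - q - 1)) = t (k - q - 1) + unit_vec c"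
        using steps(1) unfolding basis_steps_def by blast
      ultimately show ?thesis
        by (intro bexI[of _ c]) auto
    qed
    show "M k h \<le> M (Suc k) h" for h
      using basis_steps_le[OF steps(3), of "q - Suc k" "q - k" h] basis_steps_le[OF steps(4), of "k - q" "Suc k - q" h]
      by (auto simp: M_def intro: diff_le_mono2)
  qed (fact block)
  have R_eq: "rec_space p q r a b \<kappa> (\<lambda>i. n i + 1) (\<lambda>j. m j - 1) = R"
    unfolding rec_space_def using N_S M_0 by (intro Collect_cong conj_cong ball_cong refl) auto
  have V_p: "V (q + i) = A (n + t i) (m + sf i)" if "i \<in> {1..p}" for i
    unfolding V_def idx_p[OF that] ..
  have V_q: "V q = A n m"
    unfolding V_def N_q M_q ..
  have V_m: "V (q - j) = A (n - tf j) (m - s j)" if "j \<in> {1..q}" for j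
    unfolding V_def idx_m[OF that] ..
  have mem: "mult_z (A n m) \<in> R"
    unfolding V_q[symmetric]
  proof (rule mult_z_V_mem)
    fix j assume "j \<in> {1..q}"
    then have "m j \<ge> 1" "M 0 j = m j - 1" using assms(7) M_0 by auto
    then show "M 0 j < M q j" by (simp add: M_q)
  next
    fix i assume "i \<in> {1..p}"
    then show "N (Suc q) i < N S i" by (simp only: N_q N_S less_add_one)
  qed (use assms(1) in \<open>simp add: S_def\<close>)
  have L_z: "L k (mult_z (A n m)) = pairing_block p q r a b \<kappa> n m 1 (N k) (M (Suc k))" if "k < S" for k
    using N_S by (intro L_mult_z that) auto
  define co where "co = (\<lambda>k. pairing_block p q r a b \<kappa> n m 1 (N k) (M (Suc k)) /
     pairing_block p q r a b \<kappa> (N (Suc k)) (M k) 0 (N k) (M (Suc k)))"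
  have "mult_z (A n m) = (\<Sum>k<S. pscale (L k (mult_z (A n m)) / L k (V k)) (V k))"
    by (rule expansion) (rule mem)
  also have "\<dots> = (\<Sum>k<S. pscale (co k) (V k))"
    by (intro sum.cong refl) (simp add: L_z L_V co_def)
  also have "\<dots> = (\<Sum>i=1..p. pscale (co (q + i)) (V (q + i))) + pscale (co q) (V q) +
      (\<Sum>j=1..q. pscale (co (q - j)) (V (q - j)))"
    unfolding S_def by (rule sum_lessThan_split)
  finally have rec: "mult_z (A n m) = (\<Sum>i=1..p. pscale (co (q + i)) (V (q + i))) + pscale (co q) (V q) +
      (\<Sum>j=1..q. pscale (co (q - j)) (V (q - j)))" .
  have sum_p: "(\<Sum>i=1..p. pscale (co (q + i)) (V (q + i))) = (\<Sum>i=1..p. pscale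
      (pairing_block p q r a b \<kappa> n m 1 (n + t (i - 1)) (m + sf (i + 1)) /
       pairing_block p q r a b \<kappa> (n + t i) (m + sf i) 0 (n + t (i - 1)) (m + sf (i + 1))) (A (n + t i) (m + sf i)))"
    by (intro sum.cong refl) (simp only: co_def V_def idx_p)
  have sum_q: "pscale (co q) (V q) = pscale (pairing_block p q r a b \<kappa> n m 1 (n - tf 1) (m + sf 1) /
      pairing_block p q r a b \<kappa> n m 0 (n - tf 1) (m + sf 1)) (A n m)"
    by (simp only: co_def V_q N_q M_q idx_0)
  have sum_m: "(\<Sum>j=1..q. pscale (co (q - j)) (V (q - j))) = (\<Sum>j=1..q. pscale
      (pairing_block p q r a b \<kappa> n m 1 (n - tf (j + 1)) (m - s (j - 1)) /
       pairing_block p q r a b \<kappa> (n - tf j) (m - s j) 0 (n - tf (j + 1)) (m - s (j - 1))) (A (n - tf j) (m - s j)))"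
    by (intro sum.cong refl) (simp only: co_def V_def idx_m)
  note recurrence = rec[unfolded sum_p sum_q sum_m]
  \<comment> \<open>The positions in the order of the asserted list. Distinctness of the list of
    vectors then follows from that of \<open>ks\<close> and injectivity of \<open>V\<close>.\<close>
  define ks where "ks = map (\<lambda>i. q + i) [1..<p + 1] @ [q] @ map (\<lambda>j. q - j) [1..<q + 1]"
  have "map (\<lambda>i. A (n + t i) (m + sf i)) [1..<p + 1] @ [A n m] @ map (\<lambda>j. A (n - tf j) (m - s j)) [1..<q + 1]
     = map V ks"
    using V_p V_q V_m by (auto simp: ks_def simp del: upt_Suc)
  moreover have "set ks = {..<S}"
  proof (intro set_eqI iffI)
    fix k assume "k \<in> {..<S}"
    then have "k \<in> (\<lambda>j. q - j) ` {1..<q + 1} \<or> k = q \<or> k \<in> (\<lambda>i. q + i) ` {1..<p + 1}"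
    proof (cases k q rule: linorder_cases)
      case less
      then have "k = q - (q - k)" "q - k \<in> {1..<q + 1}" by auto
      then show ?thesis by blast
    next
      case greater
      then have "k = q + (k - q)" "k - q \<in> {1..<p + 1}"
        using \<open>k \<in> {..<S}\<close> by (auto simp: S_def)
      then show ?thesis by blast
    qed simp
    then show "k \<in> set ks" by (auto simp: ks_def simp del: upt_Suc)
  qed (auto simp: ks_def S_def simp del: upt_Suc)
  moreover have "distinct ks"
    by (auto simp: ks_def distinct_map inj_on_def simp del: upt_Suc)
  ultimately have "basis_of (map (\<lambda>i. A (n + t i) (m + sf i)) [1..<p + 1] @ [A n m] @
      map (\<lambda>j. A (n - tf j) (m - s j)) [1..<q + 1]) R"
    using inj_on_V independent_V span_V by (simp add: basis_of_def distinct_map)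
  from recurrence this mem show ?thesis
    unfolding Let_def R_eq by (intro conjI)
qed

end
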